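(* Assume the Lipschitz, growth, and jump-moment conditions stated in the context. Assume that for every $\epsilon\in(0,1)$ the auxiliary Dirichlet problem in the context admits a classical solution $u^\epsilon\in C^{2,4}([t_0,T]\times\mathbb{R}^d)$, and that there are constants $K'>0$ and $q\ge1$ such that for all $x\in\mathbb{R}^d$, $t\in[t_0,T]$, $\epsilon\in(0,1)$, all integers $l,j\ge0$ with $0\le2l+j\le4$ and all $i_1,\dots,i_j\in\{1,\dots,d\}$, $$\Big|\frac{\partial^{l+j}}{\partial t^l\,\partial x^{i_1}\cdots\partial x^{i_j}}u^\epsilon(t,x)\Big|\le K'(1+|x|^q).$$ Let $(t_0,x_0)\in Q$ and let $(\bar\vartheta_\varkappa,X_\varkappa,Y_\varkappa,Z_\varkappa)$ be the output of the random walk algorithm described in the context with time step $h\in(0,T-t_0]$ and cut-off $\epsilon$. Then there is a constant $K>0$ independent of $h$ and $\epsilon$ such that $$\big|\mathbb{E}[\varphi(\bar\vartheta_\varkappa,X_\varkappa)Y_\varkappa+Z_\varkappa]-u^\epsilon(t_0,x_0)\big|\le K(1+|\gamma_\epsilon|^2)\left(\frac1{\lambda_\epsilon}-h\frac{e^{-\lambda_\epsilon h}}{1-e^{-\lambda_\epsilon h}}\right)+K\frac{1-e^{-\lambda_\epsilon h}}{\lambda_\epsilon}.$$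
   Context: Let $t_0<T$, let $G\subset\mathbb{R}^d$ be a bounded domain, $Q=[t_0,T)\times G$, $G^c=\mathbb{R}^d\setminus G$, $Q^c:=(t_0,T]\times G^c\cup\{T\}\times\bar G$. Let $\nu$ be a Lévy measure on $\mathbb{R}^m$ ($\int(|z|^2\wedge1)\nu(\mathrm{d}z)<\infty$, infinite total mass allowed) having a density, denoted $\nu(z)$. On $[t_0,T]\times\mathbb{R}^d$ there are given functions: $d\times d$ matrices $a=(a^{ij})$, $\sigma$ with $\sigma\sigma^\top=a$, a vector $b\in\mathbb{R}^d$, scalars $c,g$, and a $d\times m$ matrix $F$; $\varphi$ is a scalar function on $Q^c$. For $\epsilon\in(0,1)$: $\gamma_\epsilon\in\mathbb{R}^m$, $\gamma_\epsilon^i=\int_{\epsilon\le|z|\le1}z^i\nu(\mathrm{d}z)$; $B_\epsilon^{ij}=\int_{|z|<\epsilon}z^iz^j\nu(\mathrm{d}z)$ ($m\times m$); $\beta_\epsilon\beta_\epsilon^\top=B_\epsilon$; $\lambda_\epsilon=\int_{|z|>\epsilon}\nu(\mathrm{d}z)$, assumed positive; $J_\epsilon$ is an $\mathbb{R}^m$-valued random variable with density $\rho_\epsilon(z)=\nu(z)\mathbf{1}_{|z|>\epsilon}/\lambda_\epsilon$. Lipschitz condition: there is $K>0$ such that for all $x_1,x_2\in\mathbb{R}^d$, $t\in[t_0,T]$, $$|b(t,x_1)-b(t,x_2)|^2+\|\sigma(t,x_1)-\sigma(t,x_2)\|^2+|c(t,x_1)-c(t,x_2)|^2+|g(t,x_1)-g(t,x_2)|^2+\int_{\mathbb{R}^m}\|F(t,x_1)-F(t,x_2)\|^2|z|^2\nu(\mathrm{d}z)\le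 K|x_1-x_2|^2.$$ Growth condition: there is $K>0$ such that for all $x\in\mathbb{R}^d$, $t\in[t_0,T]$, $$|b(t,x)|^2+\|\sigma(t,x)\|^2+|g(t,x)|^2+\int_{\mathbb{R}^m}\|F(t,x)\|^2|z|^2\nu(\mathrm{d}z)\le K(1+|x|)^2,\qquad|c(t,x)|\le K.$$ Jump-moment condition: for all sufficiently large $p\ge2$ there is a constant $K_p>0$ independent of $\epsilon$ with $\mathbb{E}|J_\epsilon|^p=\frac1{\lambda_\epsilon}\int_{|z|>\epsilon}|z|^p\nu(\mathrm{d}z)\le K_p$. Auxiliary Dirichlet problem: $$\frac{\partial u^\epsilon}{\partial t}+L_\epsilon u^\epsilon+c(t,x)u^\epsilon+g(t,x)=0,\ (t,x)\in Q;\qquad u^\epsilon(t,x)=\varphi(t,x),\ (t,x)\in Q^c,$$ where $$L_\epsilon v(t,x)=\frac12\sum_{i,j=1}^d\big[a^{ij}+(FB_\epsilon F^\top)^{ij}\big](t,x)\frac{\partial^2v}{\partial x^i\partial x^j}(t,x)+\sum_{i=1}^d\Big(b^i(t,x)-\sum_{j=1}^mF^{ij}(t,x)\gamma_\epsilon^j\Big)\frac{\partial v}{\partial x^i}(t,x)+\int_{|z|\ge\epsilon}\{v(t,x+F(t,x)z)-v(t,x)\}\nu(\mathrm{d}z).$$ $C^{l,k}$ denotes $l$ times continuously differentiable in $t$ and $k$ times in $x$. Algorithm (restricted jump-adapted weak Euler random walk) with step $h>0$. Start from $\vartheta_0=t_0$, $X_0=x_0$, $Y_0=1$, $Z_0=0$,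 $k=0$. At step $k$, independently of the past, draw mutually independent: $\xi_k\in\{\pm1\}^d$ and $\eta_k\in\{\pm1\}^m$ with i.i.d. components equal to $\pm1$ with probability $1/2$, and $I_k\sim\mathrm{Bernoulli}(1-e^{-\lambda_\epsilon h})$. If $I_k=0$ set $\theta_k=h$. If $I_k=1$ draw $\theta_k=\delta_k$ from the density $\lambda_\epsilon e^{-\lambda_\epsilon x}/(1-e^{-\lambda_\epsilon h})$ on $[0,h]$ and, independently, a jump size $J_{\epsilon,k}$ with density $\rho_\epsilon$. (Thus $\theta_k$ has the law of $\delta\wedge h$ with $\delta$ exponential of rate $\lambda_\epsilon$, and a jump is made iff $\delta<h$.) With $b,\sigma,F,c,g$ evaluated at $(\vartheta_k,X_k)$, set $$X_{k+1}=X_k+\theta_k(b-F\gamma_\epsilon)+\sqrt{\theta_k}(\sigma\xi_k+F\beta_\epsilon\eta_k)+I_kFJ_{\epsilon,k},\quad Y_{k+1}=Y_k+\theta_kcY_k,\quad Z_{k+1}=Z_k+\theta_kgY_k,\quad\vartheta_{k+1}=\vartheta_k+\theta_k.$$ If $\vartheta_{k+1}\ge T$ or $X_{k+1}\notin G$, stop: set $\varkappa=k+1$, $\bar\vartheta_\varkappa=\min(\vartheta_{k+1},T)$ and output $(\bar\vartheta_\varkappa,X_\varkappa,Y_\varkappa,Z_\varkappa)$. Otherwise increase $k$ by one and repeat. *)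

theory Defs
  imports "HOL-Probability.Probability"
begin

text \<open>
  Vectors in \<open>\<real>\<^sup>d\<close>, \<open>\<real>\<^sup>m\<close> are elements of \<open>real ^ 'd\<close>, \<open>real ^ 'm\<close>; a \<open>d \<times> m\<close> matrix has type
  \<open>real ^ 'm ^ 'd\<close>, and its \<open>norm\<close> is the Frobenius norm.  Functions of time and space are curried
  and total.  Only their values on the set where they are given mathematically
  (\<open>[t\<^sub>0,T] \<times> \<real>\<^sup>d\<close>, or the exterior set for \<open>\<phi>\<close>) carry any hypothesis, apart from Borel measurability.
\<close>

subsection \<open>The L\'evy measure and its truncations\<close>

definition levy :: "(real ^ 'm \<Rightarrow> real) \<Rightarrow> (real ^ 'm) measure" where
  "levy \<nu> = density lborel (\<lambda>z. ennreal (\<nu> z))"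

definition levy_density :: "(real ^ 'm \<Rightarrow> real) \<Rightarrow> bool" where
  "levy_density \<nu> \<longleftrightarrow>
     \<nu> \<in> borel_measurable borel \<and> (\<forall>z. 0 \<le> \<nu> z) \<and>
     (\<integral>\<^sup>+ z. ennreal (min ((norm z)\<^sup>2) 1) \<partial>levy \<nu>) < \<infinity>"

definition drift_corr :: "(real ^ 'm \<Rightarrow> real) \<Rightarrow> real \<Rightarrow> real ^ 'm" where
  "drift_corr \<nu> \<epsilon> = (\<chi> i. LINT z:{z. \<epsilon> \<le> norm z \<and> norm z \<le> 1}|levy \<nu>. z $ i)"

definition small_jump_cov :: "(real ^ 'm \<Rightarrow> real) \<Rightarrow> real \<Rightarrow> real ^ 'm ^ 'm" where
  "small_jump_cov \<nu> \<epsilon> = (\<chi> i j. LINT z:{z. norm z < \<epsilon>}|levy \<nu>. z $ i * z $ j)"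

definition intensity :: "(real ^ 'm \<Rightarrow> real) \<Rightarrow> real \<Rightarrow> real" where
  "intensity \<nu> \<epsilon> = measure (levy \<nu>) {z. norm z > \<epsilon>}"

definition jump_law :: "(real ^ 'm \<Rightarrow> real) \<Rightarrow> real \<Rightarrow> (real ^ 'm) measure" where
  "jump_law \<nu> \<epsilon> =
     density lborel (\<lambda>z. ennreal (\<nu> z * indicator {z. norm z > \<epsilon>} z / intensity \<nu> \<epsilon>))"

subsection \<open>Conditions on the coefficients\<close>

text \<open>The integrals in these conditions are \<open>ennreal\<close>-valued, so that each bound includes finiteness.\<close>

definition lipschitz_cond ::
  "real \<Rightarrow> real \<Rightarrow> (real ^ 'm \<Rightarrow> real) \<Rightarrow> (real \<Rightarrow> real ^ 'd \<Rightarrow> real ^ 'd) \<Rightarrow>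
   (real \<Rightarrow> real ^ 'd \<Rightarrow> real ^ 'd ^ 'd) \<Rightarrow> (real \<Rightarrow> real ^ 'd \<Rightarrow> real) \<Rightarrow>
   (real \<Rightarrow> real ^ 'd \<Rightarrow> real) \<Rightarrow> (real \<Rightarrow> real ^ 'd \<Rightarrow> real ^ 'm ^ 'd) \<Rightarrow> bool" where
  "lipschitz_cond t0 T \<nu> b \<sigma> c g F \<longleftrightarrow>
     (\<exists>K>0. \<forall>x1 x2. \<forall>t\<in>{t0..T}.
        ennreal ((norm (b t x1 - b t x2))\<^sup>2 + (norm (\<sigma> t x1 - \<sigma> t x2))\<^sup>2
          + \<bar>c t x1 - c t x2\<bar>\<^sup>2 + \<bar>g t x1 - g t x2\<bar>\<^sup>2)
        + (\<integral>\<^sup>+ z. ennreal ((norm (F t x1 - F t x2))\<^sup>2 * (norm z)\<^sup>2) \<partial>levy \<nu>)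
        \<le> ennreal (K * (norm (x1 - x2))\<^sup>2))"

definition growth_cond ::
  "real \<Rightarrow> real \<Rightarrow> (real ^ 'm \<Rightarrow> real) \<Rightarrow> (real \<Rightarrow> real ^ 'd \<Rightarrow> real ^ 'd) \<Rightarrow>
   (real \<Rightarrow> real ^ 'd \<Rightarrow> real ^ 'd ^ 'd) \<Rightarrow> (real \<Rightarrow> real ^ 'd \<Rightarrow> real) \<Rightarrow>
   (real \<Rightarrow> real ^ 'd \<Rightarrow> real) \<Rightarrow> (real \<Rightarrow> real ^ 'd \<Rightarrow> real ^ 'm ^ 'd) \<Rightarrow> bool" where
  "growth_cond t0 T \<nu> b \<sigma> c g F \<longleftrightarrow>
     (\<exists>K>0. \<forall>x. \<forall>t\<in>{t0..T}.
        ennreal ((norm (b t x))\<^sup>2 + (norm (\<sigma> t x))\<^sup>2 + \<bar>g t x\<bar>\<^sup>2)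
        + (\<integral>\<^sup>+ z. ennreal ((norm (F t x))\<^sup>2 * (norm z)\<^sup>2) \<partial>levy \<nu>)
        \<le> ennreal (K * (1 + norm x)\<^sup>2)
        \<and> \<bar>c t x\<bar> \<le> K)"

definition jump_moment_cond :: "(real ^ 'm \<Rightarrow> real) \<Rightarrow> bool" where
  "jump_moment_cond \<nu> \<longleftrightarrow>
     (\<exists>p0\<ge>2. \<forall>p\<ge>p0. \<exists>Kp>0. \<forall>\<epsilon>\<in>{0<..<1}.
        (\<integral>\<^sup>+ z. ennreal (norm z powr p) \<partial>jump_law \<nu> \<epsilon>) \<le> ennreal Kp)"

subsection \<open>Partial derivatives and the classes \<open>C(l,k)\<close>\<close>

text \<open>Time derivatives are relative to \<open>[t\<^sub>0,T]\<close>, hence one-sided at the end points.\<close>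

definition partial_t ::
  "real \<Rightarrow> real \<Rightarrow> (real \<Rightarrow> real ^ 'd \<Rightarrow> real) \<Rightarrow> real \<Rightarrow> real ^ 'd \<Rightarrow> real" where
  "partial_t t0 T v t x = vector_derivative (\<lambda>s. v s x) (at t within {t0..T})"

definition partial_x ::
  "'d \<Rightarrow> (real \<Rightarrow> real ^ 'd \<Rightarrow> real) \<Rightarrow> real \<Rightarrow> real ^ 'd \<Rightarrow> real" where
  "partial_x i v t x = deriv (\<lambda>r. v t (x + r *\<^sub>R axis i 1)) 0"

text \<open>\<open>pderivs t0 T l [i\<^sub>1, \<dots>, i\<^sub>j] v\<close> is the iterated derivative of \<open>v\<close> in the directions
  \<open>i\<^sub>j, \<dots>, i\<^sub>1\<close> of space and then \<open>l\<close> times in time; \<open>pderivs_exist\<close> says that every stage of the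
  iteration is differentiable on \<open>[t\<^sub>0,T] \<times> \<real>\<^sup>d\<close>, so that no derivative operator returns a junk value.\<close>

definition pderivs ::
  "real \<Rightarrow> real \<Rightarrow> nat \<Rightarrow> 'd list \<Rightarrow> (real \<Rightarrow> real ^ 'd \<Rightarrow> real) \<Rightarrow>
   real \<Rightarrow> real ^ 'd \<Rightarrow> real" where
  "pderivs t0 T l is v = (partial_t t0 T ^^ l) (foldr partial_x is v)"

definition pderivs_exist ::
  "real \<Rightarrow> real \<Rightarrow> nat \<Rightarrow> 'd list \<Rightarrow> (real \<Rightarrow> real ^ 'd \<Rightarrow> real) \<Rightarrow> bool" where
  "pderivs_exist t0 T l is v \<longleftrightarrow>
     (\<forall>t\<in>{t0..T}. \<forall>x.
        (\<forall>n<length is.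
           (\<lambda>r. foldr partial_x (drop (Suc n) is) v t (x + r *\<^sub>R axis (is ! n) 1))
             differentiable at 0) \<and>
        (\<forall>k<l. (\<lambda>s. pderivs t0 T k is v s x) differentiable at t within {t0..T}))"

text \<open>\<open>l\<close> times continuously differentiable in \<open>t\<close> and \<open>k\<close> times in \<open>x\<close>, with joint continuity in
  \<open>(t, x)\<close>.  Mixed derivatives are not part of the class.\<close>

definition C_class ::
  "real \<Rightarrow> real \<Rightarrow> nat \<Rightarrow> nat \<Rightarrow> (real \<Rightarrow> real ^ 'd \<Rightarrow> real) \<Rightarrow> bool" where
  "C_class t0 T l k v \<longleftrightarrow>
     (\<forall>n\<le>l. pderivs_exist t0 T n [] v \<and>
        continuous_on ({t0..T} \<times> UNIV) (\<lambda>(t, x). pderivs t0 T n [] v t x)) \<and>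
     (\<forall>is. length is \<le> k \<longrightarrow> pderivs_exist t0 T 0 is v \<and>
        continuous_on ({t0..T} \<times> UNIV) (\<lambda>(t, x). pderivs t0 T 0 is v t x))"

subsection \<open>The auxiliary Dirichlet problem\<close>

definition generator ::
  "(real ^ 'm \<Rightarrow> real) \<Rightarrow> (real \<Rightarrow> real ^ 'd \<Rightarrow> real ^ 'd ^ 'd) \<Rightarrow>
   (real \<Rightarrow> real ^ 'd \<Rightarrow> real ^ 'd) \<Rightarrow> (real \<Rightarrow> real ^ 'd \<Rightarrow> real ^ 'm ^ 'd) \<Rightarrow> real \<Rightarrow>
   (real \<Rightarrow> real ^ 'd \<Rightarrow> real) \<Rightarrow> real \<Rightarrow> real ^ 'd \<Rightarrow> real" where
  "generator \<nu> a b F \<epsilon> v t x =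
     1 / 2 * (\<Sum>i\<in>UNIV. \<Sum>j\<in>UNIV.
        (a t x + F t x ** small_jump_cov \<nu> \<epsilon> ** transpose (F t x)) $ i $ j
          * partial_x i (partial_x j v) t x)
     + (\<Sum>i\<in>UNIV. (b t x $ i - (\<Sum>j\<in>UNIV. F t x $ i $ j * drift_corr \<nu> \<epsilon> $ j))
          * partial_x i v t x)
     + (LINT z:{z. norm z \<ge> \<epsilon>}|levy \<nu>. v t (x + F t x *v z) - v t x)"

definition Q :: "real \<Rightarrow> real \<Rightarrow> (real ^ 'd) set \<Rightarrow> (real \<times> (real ^ 'd)) set" where
  "Q t0 T G = {t0..<T} \<times> G"

definition Qc :: "real \<Rightarrow> real \<Rightarrow> (real ^ 'd) set \<Rightarrow> (real \<times> (real ^ 'd)) set" where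
  "Qc t0 T G = {t0<..T} \<times> (- G) \<union> {T} \<times> closure G"

definition dirichlet_solution ::
  "real \<Rightarrow> real \<Rightarrow> (real ^ 'd) set \<Rightarrow> (real ^ 'm \<Rightarrow> real) \<Rightarrow>
   (real \<Rightarrow> real ^ 'd \<Rightarrow> real ^ 'd ^ 'd) \<Rightarrow> (real \<Rightarrow> real ^ 'd \<Rightarrow> real ^ 'd) \<Rightarrow>
   (real \<Rightarrow> real ^ 'd \<Rightarrow> real) \<Rightarrow> (real \<Rightarrow> real ^ 'd \<Rightarrow> real) \<Rightarrow>
   (real \<Rightarrow> real ^ 'd \<Rightarrow> real ^ 'm ^ 'd) \<Rightarrow> (real \<Rightarrow> real ^ 'd \<Rightarrow> real) \<Rightarrow> real \<Rightarrow>
   (real \<Rightarrow> real ^ 'd \<Rightarrow> real) \<Rightarrow> bool" where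
  "dirichlet_solution t0 T G \<nu> a b c g F \<phi> \<epsilon> v \<longleftrightarrow>
     (\<forall>(t, x)\<in>Q t0 T G.
        partial_t t0 T v t x + generator \<nu> a b F \<epsilon> v t x + c t x * v t x + g t x = 0) \<and>
     (\<forall>(t, x)\<in>Qc t0 T G. v t x = \<phi> t x)"

subsection \<open>The restricted jump-adapted random walk\<close>

text \<open>The noise of one step is a tuple \<open>(\<xi>, \<eta>, I, \<delta>, J)\<close>.  The variables \<open>\<delta>\<close> and \<open>J\<close> are drawn in
  every step, independently of the rest, but used only if \<open>I\<close> holds.\<close>

type_synonym ('d, 'm) noise = "(real ^ 'd) \<times> (real ^ 'm) \<times> bool \<times> real \<times> (real ^ 'm)"

definition sign_law :: "(real ^ 'n) measure" where
  "sign_law =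
     distr (\<Pi>\<^sub>M i\<in>(UNIV :: 'n set). measure_pmf (pmf_of_set {-1, 1 :: real})) borel (\<lambda>w. \<chi> i. w i)"

definition trunc_exp_law :: "real \<Rightarrow> real \<Rightarrow> real measure" where
  "trunc_exp_law r h =
     density lborel (\<lambda>s. ennreal (indicator {0..h} s * (r * exp (- r * s) / (1 - exp (- r * h)))))"

definition step_law :: "(real ^ 'm \<Rightarrow> real) \<Rightarrow> real \<Rightarrow> real \<Rightarrow> ('d::finite, 'm) noise measure" where
  "step_law \<nu> \<epsilon> h =
     sign_law \<Otimes>\<^sub>M sign_law
     \<Otimes>\<^sub>M measure_pmf (bernoulli_pmf (1 - exp (- intensity \<nu> \<epsilon> * h)))
     \<Otimes>\<^sub>M trunc_exp_law (intensity \<nu> \<epsilon>) h \<Otimes>\<^sub>M jump_law \<nu> \<epsilon>"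

definition walk_noise ::
  "(real ^ 'm \<Rightarrow> real) \<Rightarrow> real \<Rightarrow> real \<Rightarrow> 'w measure \<Rightarrow> (nat \<Rightarrow> 'w \<Rightarrow> ('d::finite, 'm) noise) \<Rightarrow> bool" where
  "walk_noise \<nu> \<epsilon> h M N \<longleftrightarrow>
     prob_space M \<and>
     prob_space.indep_vars M (\<lambda>_. step_law \<nu> \<epsilon> h) N UNIV \<and>
     (\<forall>k. distr M (step_law \<nu> \<epsilon> h) (N k) = step_law \<nu> \<epsilon> h)"

text \<open>The state of the walk is \<open>(\<tau>, X, Y, Z)\<close> with running time \<open>\<tau>\<close>; \<open>\<gamma>\<close>
  and \<open>\<beta>\<close> are the values for the given cut-off.\<close>

type_synonym 'd state = "real \<times> (real ^ 'd) \<times> real \<times> real"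

fun walk_step ::
  "(real \<Rightarrow> real ^ 'd \<Rightarrow> real ^ 'd) \<Rightarrow> (real \<Rightarrow> real ^ 'd \<Rightarrow> real ^ 'd ^ 'd) \<Rightarrow>
   (real \<Rightarrow> real ^ 'd \<Rightarrow> real) \<Rightarrow> (real \<Rightarrow> real ^ 'd \<Rightarrow> real) \<Rightarrow>
   (real \<Rightarrow> real ^ 'd \<Rightarrow> real ^ 'm ^ 'd) \<Rightarrow> real ^ 'm \<Rightarrow> real ^ 'm ^ 'm \<Rightarrow> real \<Rightarrow>
   'd state \<Rightarrow> ('d, 'm) noise \<Rightarrow> 'd state" where
  "walk_step b \<sigma> c g F \<gamma> \<beta> h (\<tau>, X, Y, Z) (\<xi>, \<eta>, I, \<delta>, J) =
     (let \<theta> = (if I then \<delta> else h) in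
       (\<tau> + \<theta>,
        X + \<theta> *\<^sub>R (b \<tau> X - F \<tau> X *v \<gamma>)
          + sqrt \<theta> *\<^sub>R (\<sigma> \<tau> X *v \<xi> + F \<tau> X *v (\<beta> *v \<eta>))
          + (if I then F \<tau> X *v J else 0),
        Y + \<theta> * c \<tau> X * Y,
        Z + \<theta> * g \<tau> X * Y))"

text \<open>\<open>walk\<close> is the recursion run along a noise sequence without the stopping test; \<open>walk_output\<close>
  reads it off at the first index at which the test succeeds, so later states are irrelevant.\<close>

primrec walk ::
  "(real \<Rightarrow> real ^ 'd \<Rightarrow> real ^ 'd) \<Rightarrow> (real \<Rightarrow> real ^ 'd \<Rightarrow> real ^ 'd ^ 'd) \<Rightarrow>
   (real \<Rightarrow> real ^ 'd \<Rightarrow> real) \<Rightarrow> (real \<Rightarrow> real ^ 'd \<Rightarrow> real) \<Rightarrow>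
   (real \<Rightarrow> real ^ 'd \<Rightarrow> real ^ 'm ^ 'd) \<Rightarrow> real ^ 'm \<Rightarrow> real ^ 'm ^ 'm \<Rightarrow> real \<Rightarrow>
   real \<Rightarrow> real ^ 'd \<Rightarrow> (nat \<Rightarrow> ('d, 'm) noise) \<Rightarrow> nat \<Rightarrow> 'd state" where
  "walk b \<sigma> c g F \<gamma> \<beta> h t0 x0 n 0 = (t0, x0, 1, 0)"
| "walk b \<sigma> c g F \<gamma> \<beta> h t0 x0 n (Suc k) =
     walk_step b \<sigma> c g F \<gamma> \<beta> h (walk b \<sigma> c g F \<gamma> \<beta> h t0 x0 n k) (n k)"

definition stop_index :: "real \<Rightarrow> (real ^ 'd) set \<Rightarrow> (nat \<Rightarrow> 'd state) \<Rightarrow> nat" where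
  "stop_index T G S =
     (LEAST k. 0 < k \<and> (case S k of (\<tau>, X, Y, Z) \<Rightarrow> T \<le> \<tau> \<or> X \<notin> G))"

definition walk_output :: "real \<Rightarrow> (real ^ 'd) set \<Rightarrow> (nat \<Rightarrow> 'd state) \<Rightarrow> 'd state" where
  "walk_output T G S =
     (case S (stop_index T G S) of (\<tau>, X, Y, Z) \<Rightarrow> (min \<tau> T, X, Y, Z))"

fun payoff :: "(real \<Rightarrow> real ^ 'd \<Rightarrow> real) \<Rightarrow> 'd state \<Rightarrow> real" where
  "payoff \<phi> (\<tau>, X, Y, Z) = \<phi> \<tau> X * Y + Z"

end

theory Submission
  imports Defs
begin

text \<open>
  Let \<open>u\<close> be the solution for the given cut-off and let \<open>V(\<tau>, X, Y, Z) = u(\<tau>, X) Y + Z\<close>, with \<open>u\<close> frozen at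
  its terminal value for times after \<open>T\<close>.  The walk starts with \<open>V = u(t\<^sub>0, x\<^sub>0)\<close>.  When it stops, \<open>V\<close>
  is the payoff, because the boundary data are met at time \<open>T\<close> and outside \<open>G\<close>, so that jumping far out
  of \<open>G\<close> does no harm.  Hence the error is the sum over the steps of the defect \<open>E[V(next) - V]\<close>.

  \<^bold>\<open>One step.\<close> Write \<open>\<theta>\<close> for the random time step and \<open>\<lambda>\<close>, \<open>\<gamma>\<close> for the intensity and the drift
  correction.  Because the signs are symmetric and have the right covariance, the diffusive part of the
  step reproduces the local part of the generator up to \<open>\<theta>\<^sup>2\<close>.  A jump has probability \<open>\<lambda> E\<theta>\<close>, and
  \<open>\<lambda> E[f(y + F J) - f(y)]\<close> is the jump operator at \<open>y\<close>; it is evaluated at the position before the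
  jump instead of the starting point, which is again a difference of first order in \<open>\<theta>\<close>.  The point is
  uniformity in the cut-off.  The jump operator applied to a function with two derivatives is bounded by
  a multiple of \<open>1 + |\<gamma>|\<close> (\<open>jump_op_bound\<close>): after compensation the small jumps contribute through
  the second moment of the Levy measure only.  The drift \<open>b - F \<gamma>\<close> has the same size, and this is
  where \<open>|\<gamma>|\<^sup>2\<close> comes from.  Moreover \<open>|\<gamma>|\<close> is at most a multiple of \<open>\<lambda>\<close>, and \<open>\<lambda> \<theta>\<close> has moments
  of all orders, uniformly; this controls the polynomial weights.  By the equation for \<open>u\<close> all terms of
  first order cancel, and the defect is at most a constant times \<open>(1 + |\<gamma>|\<^sup>2) E\<theta>\<^sup>2\<close>, plus a constant
  times the mean overshoot of \<open>T\<close> in this step (\<open>one_step_expansion\<close>, \<open>one_step_defect\<close>).  Working with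
  finite differences in time, whose space derivatives are controlled by \<open>\<partial>\<^sub>t\<close> of space derivatives, avoids
  any exchange of derivatives.

  \<^bold>\<open>Summation.\<close> The steps add up to at most \<open>T - t\<^sub>0 + h\<close>, so on average there are at most
  \<open>2 (T - t\<^sub>0) / E\<theta>\<close> of them, and \<open>E\<theta>\<^sup>2 / E\<theta>\<close> is twice the first bracket of the claim.  By the lack
  of memory of the exponential law an overshoot is on average at most \<open>E\<theta>\<close>, the second bracket, and
  it happens only once.  Both sums are bounded by one potential that decreases along the walk by at least
  the defect (\<open>potential_drop\<close>); the passage from one-step estimates to the exit time is
  \<open>killed_chain_defect\<close>.
\<close>

section \<open>Functions with polynomially bounded derivatives\<close>

text \<open>\<open>partial_x\<close> without its time argument, so that it can be iterated on functions of space alone.\<close>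

definition pd :: "'d \<Rightarrow> (real ^ 'd \<Rightarrow> real) \<Rightarrow> real ^ 'd \<Rightarrow> real" where
  "pd i f y = deriv (\<lambda>r. f (y + r *\<^sub>R axis i 1)) 0"

definition dird :: "real ^ 'd \<Rightarrow> (real ^ 'd \<Rightarrow> real) \<Rightarrow> real ^ 'd \<Rightarrow> real" where
  "dird v f y = (\<Sum>i\<in>UNIV. v $ i * pd i f y)"

text \<open>All partial derivatives up to the order \<open>k\<close> are bounded by the weight \<open>A (1 + |y|)\<^sup>n\<close>, and those
  below the order \<open>k\<close> are totally differentiable.  The class is closed under translations and
  differences, and each difference trades one derivative for one power of the increment; the
  expansions below rest on this.\<close>

fun smooth_wt :: "nat \<Rightarrow> nat \<Rightarrow> real \<Rightarrow> (real ^ 'd \<Rightarrow> real) \<Rightarrow> bool" where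
  "smooth_wt n 0 A f \<longleftrightarrow> (\<forall>y. \<bar>f y\<bar> \<le> A * (1 + norm y) ^ n)"
| "smooth_wt n (Suc k) A f \<longleftrightarrow> (\<forall>y. \<bar>f y\<bar> \<le> A * (1 + norm y) ^ n) \<and>
     (\<forall>y. (f has_derivative (\<lambda>v. dird v f y)) (at y)) \<and> (\<forall>i. smooth_wt n k A (pd i f))"

lemma smooth_wt_bound: "smooth_wt n k A f \<Longrightarrow> \<bar>f y\<bar> \<le> A * (1 + norm y) ^ n"
  by (cases k) auto

lemma smooth_wt_Suc_D: "smooth_wt n (Suc k) A f \<Longrightarrow> smooth_wt n k A f"
  by (induction k arbitrary: f) auto

lemma smooth_wt_antimono: "smooth_wt n k A f \<Longrightarrow> j \<le> k \<Longrightarrow> smooth_wt n j A f"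
proof (induction k)
  case (Suc k)
  then show ?case using smooth_wt_Suc_D[of n k A f] by (cases "j = Suc k") (auto simp del: smooth_wt.simps)
qed auto

lemma smooth_wt_has_derivative:
  "smooth_wt n k A f \<Longrightarrow> 0 < k \<Longrightarrow> (f has_derivative (\<lambda>v. dird v f y)) (at y)"
  by (cases k) auto

lemma smooth_wt_mono:
  assumes "smooth_wt n k A f" "A \<le> B"
  shows "smooth_wt n k B f"
  using assms(1)
proof (induction k arbitrary: f)
  case 0
  have "\<bar>f y\<bar> \<le> B * (1 + norm y) ^ n" for y
    using smooth_wt_bound[OF 0, of y] mult_right_mono[OF assms(2), of "(1 + norm y) ^ n"] by simp
  then show ?case by simp
next
  case (Suc k)
  have "\<bar>f y\<bar> \<le> B * (1 + norm y) ^ n" for y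
    using smooth_wt_bound[OF Suc.prems, of y] mult_right_mono[OF assms(2), of "(1 + norm y) ^ n"] by simp
  then show ?case using Suc by auto
qed

lemma smooth_wt_nonneg: "smooth_wt n k A f \<Longrightarrow> 0 \<le> A"
  using smooth_wt_bound[of n k A f 0] by simp

lemma has_derivative_pd:
  assumes "(f has_derivative D) (at y)"
  shows "pd i f y = D (axis i 1)"
proof -
  have "((\<lambda>r. y + r *\<^sub>R axis i (1::real)) has_derivative (\<lambda>r. r *\<^sub>R axis i 1)) (at 0)"
    by (auto intro!: derivative_eq_intros)
  then have "((\<lambda>r. f (y + r *\<^sub>R axis i 1)) has_derivative (\<lambda>r. D (r *\<^sub>R axis i 1))) (at 0)"
    using assms has_derivative_compose[of "\<lambda>r. y + r *\<^sub>R axis i 1" _ 0 UNIV f D] by simp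
  moreover have "D (r *\<^sub>R axis i 1) = D (axis i 1) * r" for r
    using has_derivative_bounded_linear[OF assms] by (simp add: linear_simps)
  ultimately show ?thesis
    unfolding pd_def by (intro DERIV_imp_deriv) (simp add: has_field_derivative_def mult.commute[of _ "D _"] cong: )
qed

lemma has_derivative_dird:
  assumes "(f has_derivative D) (at y)"
  shows "D v = dird v f y"
proof -
  interpret bounded_linear D using has_derivative_bounded_linear[OF assms] .
  have "D v = D (\<Sum>i\<in>UNIV. v $ i *\<^sub>R axis i 1)"
    by (subst basis_expansion[symmetric, of v]) (simp add: scalar_mult_eq_scaleR)
  also have "\<dots> = (\<Sum>i\<in>UNIV. v $ i * D (axis i 1))" by (simp add: sum scaleR)
  finally show ?thesis by (simp add: dird_def has_derivative_pd[OF assms])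
qed

lemma smooth_wtI:
  assumes "\<And>y. \<bar>f y\<bar> \<le> A * (1 + norm y) ^ n" "\<And>y. (f has_derivative D y) (at y)"
    "\<And>i. smooth_wt n k A (\<lambda>y. D y (axis i 1))"
  shows "smooth_wt n (Suc k) A f"
proof -
  have "pd i f = (\<lambda>y. D y (axis i 1))" for i
    using has_derivative_pd[OF assms(2)] by auto
  moreover have "D y = (\<lambda>v. dird v f y)" for y
    using has_derivative_dird[OF assms(2)] by auto
  ultimately show ?thesis using assms by simp
qed

lemma dird_axis [simp]: "dird (axis i 1) f y = pd i f y"
  by (simp add: dird_def axis_def if_distrib[of "\<lambda>x. x * _"] cong: if_cong)

lemma smooth_wt_lincomb:
  assumes "smooth_wt n k A f" "smooth_wt n k B g"
  shows "smooth_wt n k (\<bar>r\<bar> * A + \<bar>s\<bar> * B) (\<lambda>y. r * f y + s * g y)"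
proof -
  have *: "\<bar>r * f y + s * g y\<bar> \<le> (\<bar>r\<bar> * A + \<bar>s\<bar> * B) * (1 + norm y) ^ n"
    if "smooth_wt n k A f" "smooth_wt n k B g" for f g k and y :: "real ^ 'a"
  proof -
    have "\<bar>r * f y + s * g y\<bar> \<le> \<bar>r\<bar> * \<bar>f y\<bar> + \<bar>s\<bar> * \<bar>g y\<bar>"
      by (metis abs_mult abs_triangle_ineq)
    also have "\<dots> \<le> \<bar>r\<bar> * (A * (1 + norm y) ^ n) + \<bar>s\<bar> * (B * (1 + norm y) ^ n)"
      by (intro add_mono mult_left_mono smooth_wt_bound[OF that(1)] smooth_wt_bound[OF that(2)]) auto
    finally show ?thesis by (simp add: algebra_simps)
  qed
  from assms show ?thesis
  proof (induction k arbitrary: f g)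
    case 0
    then show ?case using *[OF 0] by simp
  next
    case (Suc k)
    show ?case
    proof (rule smooth_wtI)
      show "\<bar>r * f y + s * g y\<bar> \<le> (\<bar>r\<bar> * A + \<bar>s\<bar> * B) * (1 + norm y) ^ n" for y
        by (rule *[OF Suc.prems])
      show "((\<lambda>y. r * f y + s * g y) has_derivative (\<lambda>v. r * dird v f y + s * dird v g y)) (at y)" for y
        using Suc.prems by (auto intro!: derivative_eq_intros)
    next
      fix i
      have "smooth_wt n k (\<bar>r\<bar> * A + \<bar>s\<bar> * B) (\<lambda>y. r * pd i f y + s * pd i g y)"
        using Suc by auto
      then show "smooth_wt n k (\<bar>r\<bar> * A + \<bar>s\<bar> * B) (\<lambda>y. r * dird (axis i 1) f y + s * dird (axis i 1) g y)"
        by simp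
    qed
  qed
qed

lemma smooth_wt_add:
  "smooth_wt n k A f \<Longrightarrow> smooth_wt n k B g \<Longrightarrow> smooth_wt n k (A + B) (\<lambda>y. f y + g y)"
  using smooth_wt_lincomb[of n k A f B g 1 1] by simp

lemma smooth_wt_cmult: "smooth_wt n k A f \<Longrightarrow> smooth_wt n k (\<bar>r\<bar> * A) (\<lambda>y. r * f y)"
  using smooth_wt_lincomb[of n k A f A f r 0] by simp

lemma smooth_wt_zero: "smooth_wt n k 0 (\<lambda>y. 0)"
proof (induction k)
  case (Suc k)
  show ?case by (rule smooth_wtI[where D = "\<lambda>y v. 0"]) (use Suc in auto)
qed simp

lemma smooth_wt_sum:
  "(\<And>i. i \<in> I \<Longrightarrow> smooth_wt n k (A i) (f i)) \<Longrightarrow> smooth_wt n k (\<Sum>i\<in>I. A i) (\<lambda>y. \<Sum>i\<in>I. f i y)"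
  by (induction I rule: infinite_finite_induct)
     (auto intro!: smooth_wt_add smooth_wt_zero simp del: smooth_wt.simps)

lemma smooth_wt_dird:
  fixes f :: "real ^ 'd \<Rightarrow> real"
  assumes "smooth_wt n (Suc k) A f"
  shows "smooth_wt n k (CARD('d) * norm v * A) (dird v f)"
proof -
  have "smooth_wt n k (\<Sum>i\<in>UNIV. \<bar>v $ i\<bar> * A) (\<lambda>y. \<Sum>i\<in>UNIV. v $ i * pd i f y)"
    using assms by (intro smooth_wt_sum smooth_wt_cmult) auto
  moreover have "(\<Sum>i\<in>UNIV. \<bar>v $ i\<bar> * A) \<le> (\<Sum>i\<in>(UNIV::'d set). norm v * A)"
    using smooth_wt_nonneg[OF assms] by (intro sum_mono mult_right_mono component_le_norm_cart)
  ultimately show ?thesis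
    unfolding dird_def[abs_def] by (elim smooth_wt_mono) simp
qed

lemma dird_dird:
  assumes "smooth_wt n (Suc (Suc k)) A f"
  shows "dird u (dird v f) y = (\<Sum>i\<in>UNIV. \<Sum>j\<in>UNIV. u $ i * v $ j * pd i (pd j f) y)"
proof -
  have "((\<lambda>y. \<Sum>j\<in>UNIV. v $ j * pd j f y) has_derivative (\<lambda>w. \<Sum>j\<in>UNIV. v $ j * dird w (pd j f) y)) (at y)"
    using assms by (auto intro!: derivative_eq_intros)
  then have "(dird v f has_derivative (\<lambda>w. \<Sum>j\<in>UNIV. v $ j * dird w (pd j f) y)) (at y)"
    by (simp add: dird_def[abs_def])
  from has_derivative_dird[OF this, of u, symmetric]
  have "dird u (dird v f) y = (\<Sum>j\<in>UNIV. v $ j * dird u (pd j f) y)" .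
  also have "\<dots> = (\<Sum>j\<in>UNIV. \<Sum>i\<in>UNIV. u $ i * v $ j * pd i (pd j f) y)"
    by (simp add: dird_def sum_distrib_left mult_ac)
  also have "\<dots> = (\<Sum>i\<in>UNIV. \<Sum>j\<in>UNIV. u $ i * v $ j * pd i (pd j f) y)" by (rule sum.swap)
  finally show ?thesis .
qed

lemma weight_add_le: "(1 + norm (y + p)) ^ n \<le> (1 + norm y) ^ n * (1 + norm p) ^ n"
  for y p :: "'a::real_normed_vector"
proof -
  have "1 + norm (y + p) \<le> (1 + norm y) * (1 + norm p)"
    using norm_triangle_ineq[of y p] mult_nonneg_nonneg[OF norm_ge_zero[of y] norm_ge_zero[of p]]
    unfolding distrib_left distrib_right by linarith
  then show ?thesis by (metis power_mono power_mult_distrib add_nonneg_nonneg norm_ge_zero zero_le_one)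
qed

lemma smooth_wt_shift:
  assumes "smooth_wt n k A f"
  shows "smooth_wt n k (A * (1 + norm p) ^ n) (\<lambda>y. f (y + p))"
proof -
  have *: "\<bar>f (y + p)\<bar> \<le> A * (1 + norm p) ^ n * (1 + norm y) ^ n" if "smooth_wt n k A f" for f k y
    using mult_left_mono[OF weight_add_le[of y p n] smooth_wt_nonneg[OF that]]
      smooth_wt_bound[OF that, of "y + p"] by (simp add: mult_ac)
  from assms show ?thesis
  proof (induction k arbitrary: f)
    case 0
    then show ?case using *[OF 0] by simp
  next
    case (Suc k)
    show ?case
    proof (rule smooth_wtI)
      show "\<bar>f (y + p)\<bar> \<le> A * (1 + norm p) ^ n * (1 + norm y) ^ n" for y by (rule *[OF Suc.prems])
      show "((\<lambda>y. f (y + p)) has_derivative (\<lambda>v. dird v f (y + p))) (at y)" for y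
        using Suc.prems
        by (intro has_derivative_compose[of "\<lambda>y. y + p" "\<lambda>y. y", of y UNIV f])
          (auto intro!: derivative_eq_intros)
    next
      fix i
      show "smooth_wt n k (A * (1 + norm p) ^ n) (\<lambda>y. dird (axis i 1) f (y + p))"
        using Suc by simp
    qed
  qed
qed

lemma smooth_wt_along:
  assumes "smooth_wt n (Suc k) A f"
  shows "((\<lambda>r. f (y + r *\<^sub>R v)) has_field_derivative dird v f (y + r *\<^sub>R v)) (at r)"
proof -
  have "((\<lambda>r. f (y + r *\<^sub>R v)) has_derivative (\<lambda>s. dird (s *\<^sub>R v) f (y + r *\<^sub>R v))) (at r)"
    by (rule has_derivative_compose[of "\<lambda>r. y + r *\<^sub>R v" "\<lambda>s. s *\<^sub>R v"])
       (use assms in \<open>auto intro!: derivative_eq_intros\<close>)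
  moreover have "(\<lambda>s. dird (s *\<^sub>R v) f z) = (*) (dird v f z)" for z
    by (simp add: fun_eq_iff dird_def sum_distrib_left sum_distrib_right mult_ac)
  ultimately show ?thesis by (simp add: has_field_derivative_def)
qed

lemma weight_along_le:
  assumes "0 \<le> r" "r \<le> 1"
  shows "(1 + norm (y + r *\<^sub>R v)) ^ n \<le> (1 + norm y) ^ n * (1 + norm v) ^ n"
proof -
  have "norm (r *\<^sub>R v) \<le> norm v" using assms mult_right_mono[of r 1 "norm v"] by simp
  then have "(1 + norm (r *\<^sub>R v)) ^ n \<le> (1 + norm v) ^ n" by (intro power_mono) auto
  then show ?thesis using weight_add_le[of y "r *\<^sub>R v" n]
    by (meson mult_left_mono order_trans zero_le_power add_nonneg_nonneg norm_ge_zero zero_le_one)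
qed

lemma smooth_wt_increment:
  fixes f :: "real ^ 'd \<Rightarrow> real"
  assumes "smooth_wt n (Suc k) A f"
  shows "\<bar>f (y + v) - f y\<bar> \<le> CARD('d) * norm v * A * (1 + norm v) ^ n * (1 + norm y) ^ n"
proof -
  obtain r where r: "0 < r" "r < 1" and e: "f (y + 1 *\<^sub>R v) - f (y + 0 *\<^sub>R v) = (1 - 0) * dird v f (y + r *\<^sub>R v)"
    using MVT2[of 0 1 "\<lambda>r. f (y + r *\<^sub>R v)" "\<lambda>r. dird v f (y + r *\<^sub>R v)"] smooth_wt_along[OF assms]
    by auto
  have s: "smooth_wt n k (CARD('d) * norm v * A) (dird v f)" by (rule smooth_wt_dird[OF assms])
  have "\<bar>dird v f (y + r *\<^sub>R v)\<bar> \<le> (CARD('d) * norm v * A) * ((1 + norm y) ^ n * (1 + norm v) ^ n)"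
    using smooth_wt_bound[OF s, of "y + r *\<^sub>R v"]
      mult_left_mono[OF weight_along_le[of r y v n] smooth_wt_nonneg[OF s]] r by linarith
  then show ?thesis using e by (simp add: mult_ac)
qed

lemma smooth_wt_delta:
  fixes f :: "real ^ 'd \<Rightarrow> real"
  assumes "smooth_wt n (Suc k) A f"
  shows "smooth_wt n k (CARD('d) * norm p * A * (1 + norm p) ^ n) (\<lambda>y. f (y + p) - f y)"
  using assms
proof (induction k arbitrary: f)
  case 0
  then show ?case using smooth_wt_increment[OF 0, of _ p] by (simp add: mult_ac)
next
  case (Suc k)
  show ?case
  proof (rule smooth_wtI)
    show "\<bar>f (y + p) - f y\<bar> \<le> CARD('d) * norm p * A * (1 + norm p) ^ n * (1 + norm y) ^ n" for y
      by (rule smooth_wt_increment[OF Suc.prems])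
    have "((\<lambda>y. f (y + p)) has_derivative (\<lambda>v. dird v f (y + p))) (at y)" for y
      using Suc.prems
        by (intro has_derivative_compose[of "\<lambda>y. y + p" "\<lambda>y. y", of y UNIV f])
          (auto intro!: derivative_eq_intros)
    then show "((\<lambda>y. f (y + p) - f y) has_derivative (\<lambda>v. dird v f (y + p) - dird v f y)) (at y)" for y
      using Suc.prems by (auto intro!: derivative_eq_intros)
  next
    fix i
    show "smooth_wt n k (CARD('d) * norm p * A * (1 + norm p) ^ n)
        (\<lambda>y. dird (axis i 1) f (y + p) - dird (axis i 1) f y)"
      using Suc by simp
  qed
qed

text \<open>A second difference is a first difference taken twice and then translated.\<close>

lemma smooth_wt_delta2:
  fixes f :: "real ^ 'd \<Rightarrow> real"
  assumes "smooth_wt n (Suc (Suc k)) A f"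
  shows "smooth_wt n k ((CARD('d))\<^sup>2 * (norm s)\<^sup>2 * A * (1 + norm s) ^ (3 * n))
    (\<lambda>y. f (y + s) + f (y - s) - 2 * f y)"
proof -
  have "smooth_wt n k (CARD('d) * norm s * (CARD('d) * norm s * A * (1 + norm s) ^ n)
      * (1 + norm s) ^ n * (1 + norm (- s)) ^ n)
    (\<lambda>y. (f ((y + - s) + s + s) - f ((y + - s) + s)) - (f ((y + - s) + s) - f (y + - s)))"
    by (rule smooth_wt_shift, rule smooth_wt_delta, rule smooth_wt_delta, rule assms)
  moreover have "(f ((y + - s) + s + s) - f ((y + - s) + s)) - (f ((y + - s) + s) - f (y + - s))
      = f (y + s) + f (y - s) - 2 * f y" for y by simp
  moreover have "CARD('d) * norm s * (CARD('d) * norm s * A * (1 + norm s) ^ n)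
      * (1 + norm s) ^ n * (1 + norm (- s)) ^ n
    = (CARD('d))\<^sup>2 * (norm s)\<^sup>2 * A * ((1 + norm s) ^ n * (1 + norm s) ^ n * (1 + norm s) ^ n)"
    by (simp add: power2_eq_square mult_ac)
  moreover have "(1 + norm s) ^ n * (1 + norm s) ^ n * (1 + norm s) ^ n = (1 + norm s) ^ (3 * n)"
    by (metis power_add numeral_3_eq_3 mult_Suc mult_0 add_0_right add.commute)
  ultimately show ?thesis by (simp only:)
qed

lemma smooth_wt_taylor2:
  fixes f :: "real ^ 'd \<Rightarrow> real"
  assumes "smooth_wt n 2 A f"
  shows "\<bar>f (y + v) - f y - dird v f y\<bar>
    \<le> (CARD('d))\<^sup>2 * (norm v)\<^sup>2 * A * (1 + norm v) ^ n * (1 + norm y) ^ n"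
proof -
  let ?d = "real CARD('d)"
  have S: "smooth_wt n (Suc (Suc 0)) A f" using assms by (simp add: numeral_2_eq_2)
  have s: "smooth_wt n (Suc 0) (?d * norm v * A) (dird v f)" by (rule smooth_wt_dird[OF S])
  obtain r where r: "0 < r" "r < 1" and e: "f (y + 1 *\<^sub>R v) - f (y + 0 *\<^sub>R v) = (1 - 0) * dird v f (y + r *\<^sub>R v)"
    using MVT2[of 0 1 "\<lambda>r. f (y + r *\<^sub>R v)" "\<lambda>r. dird v f (y + r *\<^sub>R v)"] smooth_wt_along[OF S]
    by auto
  have nr: "norm (r *\<^sub>R v) \<le> norm v" using r mult_right_mono[of r 1 "norm v"] by simp
  have "\<bar>dird v f (y + r *\<^sub>R v) - dird v f y\<bar>
      \<le> ?d * norm (r *\<^sub>R v) * (?d * norm v * A) * (1 + norm (r *\<^sub>R v)) ^ n * (1 + norm y) ^ n"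
    by (rule smooth_wt_increment[OF s])
  also have "\<dots> \<le> ?d * norm v * (?d * norm v * A) * (1 + norm v) ^ n * (1 + norm y) ^ n"
    using smooth_wt_nonneg[OF assms] nr
    by (intro mult_right_mono mult_mono mult_left_mono power_mono) auto
  finally show ?thesis using e by (simp add: power2_eq_square mult_ac)
qed

text \<open>The odd Taylor terms cancel in the symmetric second difference, so that its error is of
  fourth order.\<close>

lemma smooth_wt_sym_taylor4:
  fixes f :: "real ^ 'd \<Rightarrow> real"
  assumes "smooth_wt n 4 A f"
  shows "\<bar>f (y + s) + f (y - s) - 2 * f y - dird s (dird s f) y\<bar>
    \<le> (CARD('d)) ^ 4 * norm s ^ 4 * A * (1 + norm s) ^ (3 * n) * (1 + norm y) ^ n"
proof -
  let ?d = "real CARD('d)"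
  have S: "smooth_wt n (Suc (Suc (Suc (Suc 0)))) A f" using assms by (simp add: numeral_eq_Suc)
  have s1: "smooth_wt n (Suc (Suc (Suc 0))) (?d * norm s * A) (dird s f)" by (rule smooth_wt_dird[OF S])
  have s2: "smooth_wt n (Suc (Suc 0)) (?d * norm s * (?d * norm s * A)) (dird s (dird s f))"
    by (rule smooth_wt_dird[OF s1])
  define D2 where "D2 = dird s (dird s f)"
  define F where "F r = f (y + r *\<^sub>R s) + f (y + r *\<^sub>R (- s)) - r\<^sup>2 * D2 y" for r
  define F1 where "F1 r = dird s f (y + r *\<^sub>R s) + dird (- s) f (y + r *\<^sub>R (- s)) - 2 * r * D2 y" for r
  define F2 where "F2 r = D2 (y + r *\<^sub>R s) + D2 (y - r *\<^sub>R s) - 2 * D2 y" for r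
  have neg: "dird (- s) g z = - dird s g z" for g z by (simp add: dird_def sum_negf)
  have d0: "(F has_real_derivative F1 r) (at r)" for r
    unfolding F_def[abs_def] F1_def
    by (rule derivative_eq_intros smooth_wt_along[OF S] refl | simp)+
  have F1': "F1 r = dird s f (y + r *\<^sub>R s) - dird s f (y + r *\<^sub>R (- s)) - 2 * r * D2 y" for r
    by (simp add: F1_def neg)
  have d1: "(F1 has_real_derivative F2 r) (at r)" for r
    unfolding F1'[abs_def] F2_def D2_def
    by (rule derivative_eq_intros smooth_wt_along[OF s1] refl | simp add: neg)+
  obtain r where r: "0 < r" "r < 1" and e: "F 1 - F 0 = (1 - 0) * F1 r"
    using MVT2[of 0 1 F F1] d0 by auto
  obtain q where q: "0 < q" "q < r" and e1: "F1 r - F1 0 = (r - 0) * F2 q"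
    using MVT2[of 0 r F1 F2] d1 r by auto
  have q1: "q \<le> 1" using q r by simp
  have nq: "norm (q *\<^sub>R s) \<le> norm s" using q q1 mult_right_mono[of q 1 "norm s"] by simp
  have "\<bar>F 1 - F 0\<bar> \<le> \<bar>F2 q\<bar>"
    using e e1 r mult_right_mono[of r 1 "\<bar>F2 q\<bar>"] by (simp add: F1' abs_mult)
  also have "\<dots> \<le> (?d\<^sup>2 * (norm (q *\<^sub>R s))\<^sup>2 * (?d * norm s * (?d * norm s * A)) * (1 + norm (q *\<^sub>R s)) ^ (3 * n)) * (1 + norm y) ^ n"
    unfolding F2_def D2_def using smooth_wt_bound[OF smooth_wt_delta2[OF s2, of "q *\<^sub>R s"], of y] by simp
  also have "\<dots> \<le> (?d\<^sup>2 * (norm s)\<^sup>2 * (?d * norm s * (?d * norm s * A)) * (1 + norm s) ^ (3 * n)) * (1 + norm y) ^ n"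
    using smooth_wt_nonneg[OF assms] nq
    by (intro mult_right_mono mult_mono mult_left_mono power_mono mult_nonneg_nonneg) auto
  finally show ?thesis by (simp add: F_def D2_def power2_eq_square numeral_eq_Suc mult_ac)
qed

text \<open>The coordinates are changed one after the other; each change is controlled by the mean value theorem
  and the continuity of the partial derivative.\<close>

lemma has_derivative_continuous_partials:
  fixes f :: "real ^ 'd \<Rightarrow> real"
  assumes ex: "\<And>i y. (\<lambda>r. f (y + r *\<^sub>R axis i 1)) differentiable at 0"
    and cont: "\<And>i. continuous_on UNIV (pd i f)"
  shows "(f has_derivative (\<lambda>v. dird v f y)) (at y)"
proof -
  have der: "((\<lambda>r. f (z + r *\<^sub>R axis i 1)) has_real_derivative pd i f (z + r *\<^sub>R axis i 1)) (at r)" for z i r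
  proof -
    have "((\<lambda>q. f ((z + r *\<^sub>R axis i 1) + q *\<^sub>R axis i 1)) has_real_derivative pd i f (z + r *\<^sub>R axis i 1)) (at 0)"
      using ex[of "z + r *\<^sub>R axis i 1" i] unfolding pd_def by (metis DERIV_deriv_iff_real_differentiable)
    then have "((\<lambda>q. f (z + (q + r) *\<^sub>R axis i 1)) has_real_derivative pd i f (z + r *\<^sub>R axis i 1)) (at 0)"
      by (simp add: algebra_simps)
    then show ?thesis
      using DERIV_shift[of "\<lambda>q. f (z + q *\<^sub>R axis i 1)" _ 0 r] by simp
  qed
  have key: "\<exists>d>0. \<forall>v. norm v < d \<longrightarrow>
      \<bar>f (y + (\<Sum>i\<in>S. v $ i *\<^sub>R axis i 1)) - f y - (\<Sum>i\<in>S. v $ i * pd i f y)\<bar> \<le> e * norm v"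
    if "0 < e" for S :: "'d set" and e
  proof -
    have "finite S" by simp
    then show ?thesis using that
    proof (induction S arbitrary: e rule: finite_induct)
      case empty
      then show ?case by (auto intro!: exI[of _ 1])
    next
      case (insert j S)
      obtain d1 where d1: "d1 > 0" "\<And>v. norm v < d1 \<Longrightarrow>
        \<bar>f (y + (\<Sum>i\<in>S. v $ i *\<^sub>R axis i 1)) - f y - (\<Sum>i\<in>S. v $ i * pd i f y)\<bar> \<le> e / 2 * norm v"
        using insert.IH[of "e / 2"] insert.prems by auto
      have "isCont (pd j f) y" using cont[of j] by (simp add: continuous_on_eq_continuous_at)
      then obtain d2 where d2: "d2 > 0" "\<And>z. norm (z - y) < d2 \<Longrightarrow> \<bar>pd j f z - pd j f y\<bar> < e / 2"
        using insert.prems unfolding continuous_at_eps_delta dist_norm real_norm_def by (meson half_gt_zero)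
      let ?d = "min d1 (d2 / (real (card S) + 2))"
      have "?d > 0" using d1 d2 by simp
      moreover have "\<bar>f (y + (\<Sum>i\<in>insert j S. v $ i *\<^sub>R axis i 1)) - f y - (\<Sum>i\<in>insert j S. v $ i * pd i f y)\<bar> \<le> e * norm v"
        if v: "norm v < ?d" for v
      proof -
        define z where "z = y + (\<Sum>i\<in>S. v $ i *\<^sub>R axis i 1)"
        have nz: "norm (z - y) \<le> card S * norm v"
        proof -
          have "norm (z - y) \<le> (\<Sum>i\<in>S. norm v)" unfolding z_def add_diff_cancel_left'
            by (rule sum_norm_le) (simp add: component_le_norm_cart)
          then show ?thesis by simp
        qed
        have mv: "\<exists>r. \<bar>r\<bar> \<le> \<bar>v $ j\<bar> \<and> f (z + (v $ j) *\<^sub>R axis j 1) - f z = v $ j * pd j f (z + r *\<^sub>R axis j 1)"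
        proof (cases "v $ j = 0")
          case False
          consider "v $ j > 0" | "v $ j < 0" using False by linarith
          then show ?thesis
          proof cases
            case 1
            show ?thesis
              using MVT2[OF 1, of "\<lambda>r. f (z + r *\<^sub>R axis j 1)" "\<lambda>r. pd j f (z + r *\<^sub>R axis j 1)"] der[of z j] 1
              by (force)
          next
            case 2
            obtain r where "v $ j < r" "r < 0"
              "f (z + 0 *\<^sub>R axis j 1) - f (z + v $ j *\<^sub>R axis j 1) = (0 - v $ j) * pd j f (z + r *\<^sub>R axis j 1)"
              using MVT2[OF 2, of "\<lambda>r. f (z + r *\<^sub>R axis j 1)" "\<lambda>r. pd j f (z + r *\<^sub>R axis j 1)"] der[of z j]
              by blast
            then show ?thesis by (intro exI[of _ r]) auto
          qed
        qed auto
        then obtain r where r: "\<bar>r\<bar> \<le> \<bar>v $ j\<bar>" "f (z + (v $ j) *\<^sub>R axis j 1) - f z = v $ j * pd j f (z + r *\<^sub>R axis j 1)"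
          by blast
        have "norm (z + r *\<^sub>R axis j 1 - y) \<le> norm (z - y) + norm (r *\<^sub>R axis j (1::real))"
          using norm_triangle_ineq[of "z - y" "r *\<^sub>R axis j 1"] by (simp add: algebra_simps)
        also have "\<dots> \<le> (card S + 2) * norm v"
          using nz r(1) component_le_norm_cart[of v j] by (simp add: algebra_simps)
        also have "\<dots> < d2" using v by (simp add: pos_less_divide_eq mult.commute add.commute)
        finally have p: "\<bar>pd j f (z + r *\<^sub>R axis j 1) - pd j f y\<bar> < e / 2" by (rule d2(2))
        have "\<bar>f (z + (v $ j) *\<^sub>R axis j 1) - f z - v $ j * pd j f y\<bar> = \<bar>v $ j\<bar> * \<bar>pd j f (z + r *\<^sub>R axis j 1) - pd j f y\<bar>"
          using r(2) by (simp add: abs_mult[symmetric] algebra_simps)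
        also have "\<dots> \<le> norm v * (e / 2)"
          using p component_le_norm_cart[of v j] by (intro mult_mono) auto
        finally have a: "\<bar>f (z + (v $ j) *\<^sub>R axis j 1) - f z - v $ j * pd j f y\<bar> \<le> e / 2 * norm v"
          by (simp add: mult.commute)
        have b: "\<bar>f z - f y - (\<Sum>i\<in>S. v $ i * pd i f y)\<bar> \<le> e / 2 * norm v"
          unfolding z_def using v by (intro d1) simp
        have "y + (\<Sum>i\<in>insert j S. v $ i *\<^sub>R axis i 1) = z + (v $ j) *\<^sub>R axis j 1"
          using insert.hyps by (simp add: z_def add_ac)
        then have "f (y + (\<Sum>i\<in>insert j S. v $ i *\<^sub>R axis i 1)) - f y - (\<Sum>i\<in>insert j S. v $ i * pd i f y)
          = (f (z + (v $ j) *\<^sub>R axis j 1) - f z - v $ j * pd j f y) + (f z - f y - (\<Sum>i\<in>S. v $ i * pd i f y))"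
          using insert.hyps by (simp only:) simp
        then show ?thesis using a b by (smt (verit) field_sum_of_halves distrib_right)
      qed
      ultimately show ?case by blast
    qed
  qed
  have lin: "bounded_linear (\<lambda>v. dird v f y)"
    unfolding dird_def
    by (intro bounded_linear_sum bounded_linear_mult_const[OF bounded_linear_vec_nth])
  show ?thesis
    unfolding has_derivative_at_alt
  proof (intro conjI lin allI impI)
    fix e :: real assume "0 < e"
    from key[OF this, of UNIV] obtain d where d: "d > 0"
      "\<And>v. norm v < d \<Longrightarrow> \<bar>f (y + (\<Sum>i\<in>UNIV. v $ i *\<^sub>R axis i 1)) - f y - (\<Sum>i\<in>UNIV. v $ i * pd i f y)\<bar> \<le> e * norm v"
      by blast
    have expand: "(\<Sum>i\<in>UNIV. v $ i *\<^sub>R axis i 1) = v" for v :: "real ^ 'd"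
      using basis_expansion[of v] by (simp add: scalar_mult_eq_scaleR)
    have "norm (f z - f y - dird (z - y) f y) \<le> e * norm (z - y)" if "norm (z - y) < d" for z
      using d(2)[OF that] unfolding dird_def expand by simp
    then show "\<exists>d>0. \<forall>z. norm (z - y) < d \<longrightarrow> norm (f z - f y - dird (z - y) f y) \<le> e * norm (z - y)"
      using d(1) by blast
  qed
qed

section \<open>The Levy measure and its jump operator\<close>

lemma sets_levy [measurable_cong, simp]: "sets (levy \<nu>) = sets borel"
  by (simp add: levy_def)

lemma space_levy [simp]: "space (levy \<nu>) = UNIV"
  by (simp add: levy_def)

text \<open>Spheres are null sets, so strict and weak cut-offs agree.\<close>

lemma AE_levy_norm_neq:
  fixes \<nu> :: "real ^ 'm \<Rightarrow> real"
  shows "levy_density \<nu> \<Longrightarrow> AE z in levy \<nu>. norm z \<noteq> e"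
proof -
  assume "levy_density \<nu>"
  then have [measurable]: "\<nu> \<in> borel_measurable borel" by (simp add: levy_density_def)
  have "sphere (0::real^'m) e \<in> null_sets lebesgue"
    using negligible_sphere[of "0::real^'m" e] by (simp add: negligible_iff_null_sets)
  then have "sphere (0::real^'m) e \<in> null_sets lborel"
    by (auto simp: null_sets_def emeasure_completion main_part_sets)
  then have "AE z in lborel. z \<notin> sphere (0::real^'m) e" by (rule AE_not_in)
  then have "AE z in (lborel :: (real^'m) measure). norm z \<noteq> e" by simp
  then show ?thesis unfolding levy_def by (subst AE_density) auto
qed

lemma emeasure_levy_away:
  assumes "levy_density \<nu>" "0 < e"
  shows "emeasure (levy \<nu>) {z. e \<le> norm z} < \<infinity>"
proof -
  have "ennreal (min (e\<^sup>2) 1) * emeasure (levy \<nu>) {z. e \<le> norm z}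
      = (\<integral>\<^sup>+z. ennreal (min (e\<^sup>2) 1) * indicator {z. e \<le> norm z} z \<partial>levy \<nu>)"
    by (subst nn_integral_cmult_indicator) auto
  also have "\<dots> \<le> (\<integral>\<^sup>+z. ennreal (min ((norm z)\<^sup>2) 1) \<partial>levy \<nu>)"
    using assms(2)
    by (intro nn_integral_mono) (auto split: split_indicator intro!: ennreal_leI min.mono power_mono simp del: min.bounded_iff)
  also have "\<dots> < \<infinity>" using assms(1) by (simp add: levy_density_def)
  finally have "ennreal (min (e\<^sup>2) 1) * emeasure (levy \<nu>) {z. e \<le> norm z} < \<infinity>" .
  moreover have "0 < min (e\<^sup>2) 1" using assms(2) by simp
  ultimately show ?thesis by (auto simp: ennreal_mult_less_top simp del: min_less_iff_conj)
qed

lemma emeasure_levy_gt: "levy_density \<nu> \<Longrightarrow> 0 < e \<Longrightarrow> emeasure (levy \<nu>) {z. e < norm z} < \<infinity>"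
  using emeasure_levy_away[of \<nu> e]
  by (rule le_less_trans[OF emeasure_mono, rotated 2]) auto

lemma emeasure_levy_intensity:
  "levy_density \<nu> \<Longrightarrow> 0 < e \<Longrightarrow> emeasure (levy \<nu>) {z. e < norm z} = ennreal (intensity \<nu> e)"
  using emeasure_levy_gt[of \<nu> e] by (simp add: intensity_def emeasure_eq_ennreal_measure less_top)

lemma jump_law_density:
  assumes "levy_density \<nu>"
  shows "jump_law \<nu> e = density (levy \<nu>) (\<lambda>z. ennreal (indicator {z. e < norm z} z / intensity \<nu> e))"
proof -
  have [measurable]: "\<nu> \<in> borel_measurable borel" and nn: "0 \<le> \<nu> z" for z
    using assms by (auto simp: levy_density_def)
  have i: "0 \<le> intensity \<nu> e" by (simp add: intensity_def)
  show ?thesis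
    unfolding jump_law_def levy_def using nn i
    by (subst density_density_eq) (auto intro!: density_cong simp: ennreal_mult[symmetric])
qed

lemma nn_integral_jump_law:
  assumes "levy_density \<nu>" and [measurable]: "f \<in> borel_measurable borel"
  shows "(\<integral>\<^sup>+z. f z \<partial>jump_law \<nu> e) = ennreal (1 / intensity \<nu> e) * (\<integral>\<^sup>+z. f z * indicator {z. e < norm z} z \<partial>levy \<nu>)"
proof -
  have "(\<integral>\<^sup>+z. f z \<partial>jump_law \<nu> e)
    = (\<integral>\<^sup>+z. ennreal (1 / intensity \<nu> e) * (f z * indicator {z. e < norm z} z) \<partial>levy \<nu>)"
    unfolding jump_law_density[OF assms(1)]
    by (subst nn_integral_density) (auto intro!: nn_integral_cong simp: mult_ac split: split_indicator)
  then show ?thesis by (simp add: nn_integral_cmult)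
qed

lemma sets_jump_law [measurable_cong, simp]: "sets (jump_law \<nu> e) = sets borel"
  by (simp add: jump_law_def)

lemma prob_space_jump_law:
  assumes "levy_density \<nu>" "0 < e" "0 < intensity \<nu> e"
  shows "prob_space (jump_law \<nu> e)"
proof
  have "emeasure (jump_law \<nu> e) (space (jump_law \<nu> e)) = (\<integral>\<^sup>+z. 1 \<partial>jump_law \<nu> e)" by simp
  also have "\<dots> = ennreal (1 / intensity \<nu> e) * ennreal (intensity \<nu> e)"
    using assms by (subst nn_integral_jump_law) (auto simp: emeasure_levy_intensity)
  also have "\<dots> = 1" using assms(3) by (simp add: ennreal_mult[symmetric])
  finally show "emeasure (jump_law \<nu> e) (space (jump_law \<nu> e)) = 1" .
qed

lemma jump_law_integral:
  fixes f :: "real ^ 'm \<Rightarrow> real"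
  assumes "levy_density \<nu>" and [measurable]: "f \<in> borel_measurable borel"
  shows "0 < intensity \<nu> e \<Longrightarrow> integrable (jump_law \<nu> e) f \<longleftrightarrow> set_integrable (levy \<nu>) {z. e < norm z} f"
    and "(\<integral>z. f z \<partial>jump_law \<nu> e) = 1 / intensity \<nu> e * (LINT z:{z. e < norm z}|levy \<nu>. f z)"
proof -
  have i: "0 \<le> intensity \<nu> e" by (simp add: intensity_def)
  have eq: "(\<lambda>z. (indicator {z. e < norm z} z / intensity \<nu> e) *\<^sub>R f z)
      = (\<lambda>z. (1 / intensity \<nu> e) * (indicator {z. e < norm z} z *\<^sub>R f z))" by auto
  show "0 < intensity \<nu> e \<Longrightarrow> integrable (jump_law \<nu> e) f \<longleftrightarrow> set_integrable (levy \<nu>) {z. e < norm z} f"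
    unfolding jump_law_density[OF assms(1)] set_integrable_def using i
    by (subst integrable_density) (auto simp only: eq integrable_mult_left_iff, auto)
  show "(\<integral>z. f z \<partial>jump_law \<nu> e) = 1 / intensity \<nu> e * (LINT z:{z. e < norm z}|levy \<nu>. f z)"
    unfolding jump_law_density[OF assms(1)] set_lebesgue_integral_def using i
    by (subst integral_density) (auto simp only: eq integral_mult_right_zero, auto)
qed

text \<open>The factor \<open>|z|\<^sup>2\<close> makes up for the possibly infinite mass near the origin.\<close>

definition levy_moment :: "(real ^ 'm \<Rightarrow> real) \<Rightarrow> nat \<Rightarrow> real" where
  "levy_moment \<nu> n = (\<integral>z. (norm z)\<^sup>2 * (1 + norm z) ^ n \<partial>levy \<nu>)"

text \<open>Near the origin the Levy condition suffices.  Away from it a single cut-off, here \<open>1/2\<close>, turns the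
  moments of the jump law into moments of the measure.\<close>

lemma levy_moment_integrable:
  fixes \<nu> :: "real ^ 'm \<Rightarrow> real"
  assumes lev: "levy_density \<nu>" and "jump_moment_cond \<nu>" "0 < intensity \<nu> (1/2)"
  shows "integrable (levy \<nu>) (\<lambda>z. (norm z)\<^sup>2 * (1 + norm z) ^ n)"
proof -
  obtain p0 where p0: "p0 \<ge> 2" "\<And>p. p \<ge> p0 \<Longrightarrow> \<exists>Kp>0. \<forall>e\<in>{0<..<1}.
        (\<integral>\<^sup>+ z. ennreal (norm z powr p) \<partial>jump_law \<nu> e) \<le> ennreal Kp"
    using assms(2) unfolding jump_moment_cond_def by blast
  define p where "p = max p0 (real (n + 2))"
  obtain Kp where Kp: "(\<integral>\<^sup>+ z. ennreal (norm z powr p) \<partial>jump_law \<nu> (1/2)) \<le> ennreal Kp"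
    using p0(2)[of p] unfolding p_def by fastforce
  have fin1: "(\<integral>\<^sup>+z. ennreal (norm z powr p) * indicator {z. 1/2 < norm z} z \<partial>levy \<nu>) < \<infinity>"
  proof -
    have "ennreal (1 / intensity \<nu> (1/2)) * (\<integral>\<^sup>+z. ennreal (norm z powr p) * indicator {z. 1/2 < norm z} z \<partial>levy \<nu>) < \<infinity>"
      using Kp by (subst nn_integral_jump_law[OF lev, symmetric]) (auto intro: le_less_trans)
    then show ?thesis using assms(3) by (auto simp: ennreal_mult_less_top)
  qed
  have fin2: "(\<integral>\<^sup>+z. ennreal (min ((norm z)\<^sup>2) 1) \<partial>levy \<nu>) < \<infinity>"
    using lev by (simp add: levy_density_def)
  have le: "(norm z)\<^sup>2 * (1 + norm z) ^ n \<le> 2 ^ n * min ((norm z)\<^sup>2) 1 + 2 ^ n * (norm z powr p) * indicator {z. 1/2 < norm z} z"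
    for z :: "real ^ 'm"
  proof (cases "norm z \<le> 1")
    case True
    then have "(norm z)\<^sup>2 \<le> 1" by (simp add: power_le_one)
    moreover have "(1 + norm z) ^ n \<le> 2 ^ n" using True by (intro power_mono) auto
    ultimately have "(norm z)\<^sup>2 * (1 + norm z) ^ n \<le> 2 ^ n * min ((norm z)\<^sup>2) 1"
      using mult_left_mono[of "(1 + norm z) ^ n" "2 ^ n" "(norm z)\<^sup>2"] by (simp add: mult.commute)
    moreover have "0 \<le> 2 ^ n * (norm z powr p) * indicator {z. 1/2 < norm z} z" by simp
    ultimately show ?thesis by linarith
  next
    case False
    then have "(1 + norm z) ^ n \<le> (2 * norm z) ^ n" by (intro power_mono) auto
    then have "(norm z)\<^sup>2 * (1 + norm z) ^ n \<le> 2 ^ n * norm z ^ (n + 2)"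
      using mult_left_mono[of "(1 + norm z) ^ n" "(2 * norm z) ^ n" "(norm z)\<^sup>2"]
      by (simp add: power_mult_distrib power_add power2_eq_square mult_ac)
    also have "norm z ^ (n + 2) = norm z powr (real (n + 2))"
      using False by (intro powr_realpow[symmetric]) auto
    also have "2 ^ n * norm z powr (real (n + 2)) \<le> 2 ^ n * norm z powr p"
      using False by (intro mult_left_mono powr_mono) (auto simp: p_def)
    finally have "(norm z)\<^sup>2 * (1 + norm z) ^ n \<le> 2 ^ n * norm z powr p" .
    moreover have "0 \<le> 2 ^ n * min ((norm z)\<^sup>2) 1" by simp
    moreover have "indicat_real {z. 1/2 < norm z} z = 1" using False by simp
    ultimately show ?thesis by (simp only: mult_1_right)
  qed
  have "(\<integral>\<^sup>+z. ennreal ((norm z)\<^sup>2 * (1 + norm z) ^ n) \<partial>levy \<nu>)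
     \<le> (\<integral>\<^sup>+z. ennreal (2 ^ n) * ennreal (min ((norm z)\<^sup>2) 1) + ennreal (2 ^ n) * (ennreal (norm z powr p) * indicator {z. 1/2 < norm z} z) \<partial>levy \<nu>)"
  proof (rule nn_integral_mono)
    fix z :: "real ^ 'm"
    have "ennreal ((norm z)\<^sup>2 * (1 + norm z) ^ n) \<le> ennreal (2 ^ n * min ((norm z)\<^sup>2) 1 + 2 ^ n * (norm z powr p) * indicator {z. 1/2 < norm z} z)"
      by (rule ennreal_leI[OF le])
    also have "\<dots> = ennreal (2 ^ n) * ennreal (min ((norm z)\<^sup>2) 1) + ennreal (2 ^ n) * (ennreal (norm z powr p) * indicator {z. 1/2 < norm z} z)"
      by (simp add: ennreal_plus ennreal_mult ennreal_indicator mult.assoc)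
    finally show "ennreal ((norm z)\<^sup>2 * (1 + norm z) ^ n) \<le> \<dots>" .
  qed
  also have "\<dots> < \<infinity>"
    using fin1 fin2 by (simp add: nn_integral_add nn_integral_cmult ennreal_mult_less_top)
  finally show ?thesis by (intro integrableI_nonneg) auto
qed

lemma levy_moment_nonneg: "0 \<le> levy_moment \<nu> n"
  unfolding levy_moment_def by (intro integral_nonneg_AE) auto

text \<open>Beyond the cut-off \<open>|z|\<^sup>2 / e\<^sup>2\<close> is at least \<open>1\<close>, so the moment of the measure is a majorant.\<close>

lemma set_integrable_weight_away:
  assumes int: "integrable (levy \<nu>) (\<lambda>z. (norm z)\<^sup>2 * (1 + norm z) ^ n)" and "0 < e"
    and [measurable]: "f \<in> borel_measurable borel"
    and le: "\<And>z. \<bar>f z\<bar> \<le> C * (1 + norm z) ^ n"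
  shows "set_integrable (levy \<nu>) {z. e < norm z} (f :: real ^ 'm \<Rightarrow> real)"
  unfolding set_integrable_def
proof (rule Bochner_Integration.integrable_bound)
  show "integrable (levy \<nu>) (\<lambda>z. C / e\<^sup>2 * ((norm z)\<^sup>2 * (1 + norm z) ^ n))" using int by simp
  have C: "0 \<le> C" using le[of 0] by simp
  have "\<bar>f z\<bar> \<le> C / e\<^sup>2 * ((norm z)\<^sup>2 * (1 + norm z) ^ n)" if "e < norm z" for z
  proof -
    have "e\<^sup>2 \<le> (norm z)\<^sup>2" using that \<open>0 < e\<close> by (intro power_mono) auto
    then have "1 \<le> (norm z)\<^sup>2 / e\<^sup>2" using \<open>0 < e\<close> by simp
    then have "C * (1 + norm z) ^ n * 1 \<le> C * (1 + norm z) ^ n * ((norm z)\<^sup>2 / e\<^sup>2)"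
      using C by (intro mult_left_mono) auto
    then show ?thesis using le[of z] by (simp add: mult_ac)
  qed
  then show "AE z in levy \<nu>. norm (indicator {z. e < norm z} z *\<^sub>R f z) \<le> norm (C / e\<^sup>2 * ((norm z)\<^sup>2 * (1 + norm z) ^ n))"
    using C by (auto split: split_indicator)
qed simp

lemma LINT_ge_eq_gt:
  fixes f :: "real ^ 'm \<Rightarrow> real"
  assumes "levy_density \<nu>" and [measurable]: "f \<in> borel_measurable borel"
  shows "(LINT z:{z. norm z \<ge> e}|levy \<nu>. f z) = (LINT z:{z. e < norm z}|levy \<nu>. f z)"
  unfolding set_lebesgue_integral_def
  by (rule integral_cong_AE) (use AE_levy_norm_neq[OF assms(1), of e] in \<open>auto split: split_indicator\<close>)

lemma drift_corr_gt:
  assumes "levy_density \<nu>"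
  shows "drift_corr \<nu> e $ k = (LINT z:{z. e < norm z}|levy \<nu>. indicator {z. norm z \<le> 1} z * z $ k)"
  unfolding drift_corr_def set_lebesgue_integral_def
  by (simp, rule integral_cong_AE)
     (use AE_levy_norm_neq[OF assms(1), of e] in \<open>auto split: split_indicator\<close>)

text \<open>The drift correction integrates \<open>|z| \<le> 1\<close> over part of the mass \<open>intensity \<nu> e\<close>.\<close>

lemma drift_corr_le:
  fixes \<nu> :: "real ^ 'm \<Rightarrow> real"
  assumes "levy_density \<nu>" "0 < e"
  shows "norm (drift_corr \<nu> e) \<le> CARD('m) * intensity \<nu> e"
proof -
  have fin: "emeasure (levy \<nu>) {z. e < norm z} < \<infinity>" by (rule emeasure_levy_gt[OF assms])
  have "\<bar>drift_corr \<nu> e $ k\<bar> \<le> intensity \<nu> e" for k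
  proof -
    have "\<bar>drift_corr \<nu> e $ k\<bar> \<le> (\<integral>z. indicator {z. e < norm z} z \<partial>levy \<nu>)"
      unfolding drift_corr_gt[OF assms(1)] set_lebesgue_integral_def
    proof (rule order_trans[OF integral_abs_bound], rule integral_mono')
      show "integrable (levy \<nu>) (indicat_real {z. e < norm z})"
        using fin by (simp add: integrable_indicator_iff)
      show "\<bar>indicator {z. e < norm z} z *\<^sub>R (indicator {z. norm z \<le> 1} z * z $ k)\<bar> \<le> indicator {z. e < norm z} z" for z :: "real ^ 'm"
        using component_le_norm_cart[of z k] by (auto split: split_indicator)
    qed auto
    then show ?thesis by (simp add: intensity_def)
  qed
  then have "(\<Sum>k\<in>UNIV. \<bar>drift_corr \<nu> e $ k\<bar>) \<le> (\<Sum>k\<in>(UNIV :: 'm set). intensity \<nu> e)"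
    by (intro sum_mono)
  then show ?thesis using norm_le_l1_cart[of "drift_corr \<nu> e"] by simp
qed

lemma norm_sq_matrix: "(norm (A :: real ^ 'm ^ 'k))\<^sup>2 = (\<Sum>i\<in>UNIV. \<Sum>j\<in>UNIV. (A $ i $ j)\<^sup>2)"
  by (simp add: norm_vec_def L2_set_def sum_nonneg)

lemma norm_matrix_vector_le: "norm (A *v x) \<le> norm A * norm x" for A :: "real ^ 'm ^ 'k"
proof -
  have "(norm (A *v x))\<^sup>2 = (\<Sum>i\<in>UNIV. (A $ i \<bullet> x)\<^sup>2)"
    by (simp add: norm_vec_def L2_set_def sum_nonneg matrix_vector_mult_def inner_vec_def)
  also have "\<dots> \<le> (\<Sum>i\<in>UNIV. (norm (A $ i))\<^sup>2 * (norm x)\<^sup>2)"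
    by (intro sum_mono) (metis Cauchy_Schwarz_ineq2 abs_ge_zero power2_abs power_mono power_mult_distrib)
  also have "\<dots> = (norm A * norm x)\<^sup>2"
    by (simp add: norm_vec_def L2_set_def sum_nonneg power_mult_distrib sum_distrib_right)
  finally show ?thesis by (rule power2_le_imp_le) simp
qed

text \<open>The squared Frobenius norm of \<open>\<beta>\<close> is the trace of \<open>\<beta> \<beta>\<^sup>T\<close>, hence a second moment of the small jumps.\<close>

lemma norm_sqrt_small_jump_cov_le:
  fixes \<nu> :: "real ^ 'm \<Rightarrow> real"
  assumes lev: "levy_density \<nu>" and "e \<le> 1" and int: "integrable (levy \<nu>) (\<lambda>z. (norm z)\<^sup>2 * (1 + norm z) ^ n)"
    and b: "\<beta> ** transpose \<beta> = small_jump_cov \<nu> e"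
  shows "(norm \<beta>)\<^sup>2 \<le> CARD('m) * levy_moment \<nu> n"
proof -
  have "(norm \<beta>)\<^sup>2 = (\<Sum>i\<in>UNIV. small_jump_cov \<nu> e $ i $ i)"
    unfolding norm_sq_matrix b[symmetric] by (simp add: matrix_matrix_mult_def transpose_def power2_eq_square)
  also have "\<dots> \<le> (\<Sum>i\<in>(UNIV::'m set). levy_moment \<nu> n)"
  proof (rule sum_mono)
    fix i :: 'm
    have "small_jump_cov \<nu> e $ i $ i = (\<integral>z. indicator {z. norm z < e} z *\<^sub>R (z $ i * z $ i) \<partial>levy \<nu>)"
      by (simp add: small_jump_cov_def set_lebesgue_integral_def)
    also have "\<dots> \<le> levy_moment \<nu> n"
      unfolding levy_moment_def
    proof (rule integral_mono'[OF int])
      fix z :: "real ^ 'm"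
      have "z $ i * z $ i = \<bar>z $ i\<bar>\<^sup>2" by (simp add: power2_eq_square)
      also have "\<dots> \<le> (norm z)\<^sup>2" by (intro power_mono component_le_norm_cart) simp
      also have "\<dots> \<le> (norm z)\<^sup>2 * (1 + norm z) ^ n"
        using mult_left_mono[of 1 "(1 + norm z) ^ n" "(norm z)\<^sup>2"] by simp
      finally show "indicator {z. norm z < e} z *\<^sub>R (z $ i * z $ i) \<le> (norm z)\<^sup>2 * (1 + norm z) ^ n"
        by (auto split: split_indicator)
    qed simp
    finally show "small_jump_cov \<nu> e $ i $ i \<le> levy_moment \<nu> n" .
  qed
  finally show ?thesis by simp
qed

text \<open>The nonlocal part of the generator, without compensation.\<close>

definition jump_op :: "(real ^ 'm \<Rightarrow> real) \<Rightarrow> real \<Rightarrow> real ^ 'm ^ 'd \<Rightarrow> (real ^ 'd \<Rightarrow> real) \<Rightarrow> real ^ 'd \<Rightarrow> real" where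
  "jump_op \<nu> e F w y = (LINT z:{z. e < norm z}|levy \<nu>. w (y + F *v z) - w y)"

lemma weight_jump_le:
  fixes F :: "real ^ 'm ^ 'd"
  assumes F: "norm F \<le> R"
  shows "(1 + norm (F *v z)) ^ n \<le> (1 + R) ^ n * (1 + norm z) ^ n"
proof -
  have R: "0 \<le> R" using F norm_ge_zero order_trans by blast
  have "norm (F *v z) \<le> R * norm z"
    using norm_matrix_vector_le[of F z] mult_right_mono[OF F norm_ge_zero[of z]] by simp
  then have "1 + norm (F *v z) \<le> (1 + R) * (1 + norm z)" using R by (simp add: algebra_simps add_increasing)
  then have "(1 + norm (F *v z)) ^ n \<le> ((1 + R) * (1 + norm z)) ^ n" by (intro power_mono) auto
  then show ?thesis by (simp add: power_mult_distrib)
qed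

lemma smooth_wt_continuous: "smooth_wt n k A w \<Longrightarrow> 0 < k \<Longrightarrow> continuous_on UNIV w"
  by (meson has_derivative_continuous_on has_derivative_at_withinI smooth_wt_has_derivative)

lemma smooth_wt_measurable: "smooth_wt n k A w \<Longrightarrow> 0 < k \<Longrightarrow> w \<in> borel_measurable borel"
  by (intro borel_measurable_continuous_onI smooth_wt_continuous)

lemma jump_increment_le:
  fixes F :: "real ^ 'm ^ 'd"
  assumes w: "\<And>y. \<bar>w y\<bar> \<le> A * (1 + norm y) ^ n" and F: "norm F \<le> R"
  shows "\<bar>w (y + F *v z) - w y\<bar> \<le> 2 * A * (1 + norm y) ^ n * (1 + R) ^ n * (1 + norm z) ^ n"
proof -
  have A: "0 \<le> A" using w[of 0] by simp
  have R: "0 \<le> R" using F norm_ge_zero order_trans by blast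
  have "\<bar>w (y + F *v z)\<bar> \<le> A * ((1 + norm y) ^ n * (1 + norm (F *v z)) ^ n)"
    using w[of "y + F *v z"] mult_left_mono[OF weight_add_le[of y "F *v z" n] A] by linarith
  also have "\<dots> \<le> A * ((1 + norm y) ^ n * ((1 + R) ^ n * (1 + norm z) ^ n))"
    using A by (intro mult_left_mono weight_jump_le F) auto
  finally have 1: "\<bar>w (y + F *v z)\<bar> \<le> A * (1 + norm y) ^ n * ((1 + R) ^ n * (1 + norm z) ^ n)" by (simp add: mult.assoc)
  have "1 \<le> (1 + R) ^ n * (1 + norm z) ^ n"
    using R mult_mono[of 1 "(1 + R) ^ n" 1 "(1 + norm z) ^ n"] by simp
  then have "A * (1 + norm y) ^ n * 1 \<le> A * (1 + norm y) ^ n * ((1 + R) ^ n * (1 + norm z) ^ n)"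
    using A by (intro mult_left_mono) auto
  then have 2: "\<bar>w y\<bar> \<le> A * (1 + norm y) ^ n * ((1 + R) ^ n * (1 + norm z) ^ n)" using w[of y] by simp
  show ?thesis using 1 2 abs_triangle_ineq4[of "w (y + F *v z)" "w y"] by (simp add: mult_ac)
qed

lemma jump_increment_integrable:
  fixes F :: "real ^ 'm ^ 'd"
  assumes int: "integrable (levy \<nu>) (\<lambda>z. (norm z)\<^sup>2 * (1 + norm z) ^ n)" and "0 < e"
    and w: "smooth_wt n k A w" "0 < k"
  shows "set_integrable (levy \<nu>) {z. e < norm z} (\<lambda>z. w (y + F *v z) - w y)"
proof (rule set_integrable_weight_away[OF int \<open>0 < e\<close>])
  have "continuous_on UNIV (\<lambda>z. w (y + F *v z) - w y)"
    by (intro continuous_intros continuous_on_compose2[OF smooth_wt_continuous[OF w]]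
        linear_continuous_on) auto
  then show "(\<lambda>z. w (y + F *v z) - w y) \<in> borel_measurable borel"
    by (rule borel_measurable_continuous_onI)
  show "\<bar>w (y + F *v z) - w y\<bar> \<le> (2 * A * (1 + norm y) ^ n * (1 + norm F) ^ n) * (1 + norm z) ^ n" for z
    by (rule jump_increment_le[OF smooth_wt_bound[OF w(1)] order_refl])
qed

text \<open>The integrand is compensated by its linear part on \<open>|z| \<le> 1\<close>.  What remains is of order \<open>|z|\<^sup>2\<close> and is
  integrable uniformly in the cut-off; the compensator integrates to the derivative in the direction
  \<open>F \<gamma>\<close>.\<close>

lemma jump_op_bound:
  fixes F :: "real ^ 'm ^ 'd" and R :: real
  assumes lev: "levy_density \<nu>" and int: "integrable (levy \<nu>) (\<lambda>z. (norm z)\<^sup>2 * (1 + norm z) ^ n)"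
    and "0 < e" and w: "smooth_wt n 2 A w" and F: "norm F \<le> R"
  shows "\<bar>jump_op \<nu> e F w y\<bar>
    \<le> (((CARD('d))\<^sup>2 * R\<^sup>2 + 2) * (1 + R) ^ n * levy_moment \<nu> n + CARD('d) * R)
       * A * (1 + norm (drift_corr \<nu> e)) * (1 + norm y) ^ n"
proof -
  let ?d = "real CARD('d)" and ?S = "{z :: real ^ 'm. e < norm z}" and ?I = "indicator {z :: real ^ 'm. norm z \<le> 1}"
  let ?W = "(1 + norm y) ^ n"
  have A: "0 \<le> A" by (rule smooth_wt_nonneg[OF w])
  have R: "0 \<le> R" using F norm_ge_zero order_trans by blast
  define D where "D k = (\<Sum>i\<in>UNIV. F $ i $ k * pd i w y)" for k
  have dD: "dird (F *v z) w y = (\<Sum>k\<in>UNIV. z $ k * D k)" for z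
    unfolding dird_def D_def matrix_vector_mult_def vec_lambda_beta sum_distrib_left sum_distrib_right
    by (subst sum.swap) (simp add: mult_ac)
  have i1: "set_integrable (levy \<nu>) ?S (\<lambda>z. w (y + F *v z) - w y)"
    by (rule jump_increment_integrable[OF int \<open>0 < e\<close> w]) simp
  have i2k: "set_integrable (levy \<nu>) ?S (\<lambda>z. ?I z * z $ k)" for k
  proof (rule set_integrable_weight_away[OF int \<open>0 < e\<close>, where C = 1])
    show "\<bar>?I z * z $ k\<bar> \<le> 1 * (1 + norm z) ^ n" for z
    proof (cases "norm z \<le> 1")
      case True
      then have "\<bar>z $ k\<bar> \<le> 1" using component_le_norm_cart[of z k] by simp
      also have "1 \<le> (1 + norm z) ^ n" by (rule one_le_power) simp
      finally show ?thesis using True by simp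
    qed simp
  qed measurable
  have i2: "set_integrable (levy \<nu>) ?S (\<lambda>z. \<Sum>k\<in>UNIV. ?I z * z $ k * D k)"
    using i2k unfolding set_integrable_def scaleR_sum_right
    by (intro Bochner_Integration.integrable_sum) (simp add: mult.assoc[symmetric])
  have comp: "(LINT z:?S|levy \<nu>. (\<Sum>k\<in>UNIV. ?I z * z $ k * D k)) = dird (F *v drift_corr \<nu> e) w y"
  proof -
    have "(LINT z:?S|levy \<nu>. (\<Sum>k\<in>UNIV. ?I z * z $ k * D k)) = (\<Sum>k\<in>UNIV. LINT z:?S|levy \<nu>. ?I z * z $ k * D k)"
      using i2k unfolding set_lebesgue_integral_def set_integrable_def scaleR_sum_right
      by (intro Bochner_Integration.integral_sum) (simp add: mult.assoc[symmetric])
    then show ?thesis unfolding dD drift_corr_gt[OF lev] by simp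
  qed
  define c0 where "c0 = ((CARD('d))\<^sup>2 * R\<^sup>2 + 2) * (1 + R) ^ n"
  have main: "\<bar>w (y + F *v z) - w y - (\<Sum>k\<in>UNIV. ?I z * z $ k * D k)\<bar> \<le> A * ?W * c0 * ((norm z)\<^sup>2 * (1 + norm z) ^ n)" for z
  proof (cases "norm z \<le> 1")
    case True
    have Fz: "norm (F *v z) \<le> R * norm z"
      using norm_matrix_vector_le[of F z] mult_right_mono[OF F norm_ge_zero[of z]] by simp
    have "\<bar>w (y + F *v z) - w y - (\<Sum>k\<in>UNIV. ?I z * z $ k * D k)\<bar> = \<bar>w (y + F *v z) - w y - dird (F *v z) w y\<bar>"
      using True by (simp add: dD)
    also have "\<dots> \<le> ?d\<^sup>2 * (norm (F *v z))\<^sup>2 * A * (1 + norm (F *v z)) ^ n * ?W"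
      using smooth_wt_taylor2[OF w, of y "F *v z"] by simp
    also have "\<dots> \<le> ?d\<^sup>2 * (R * norm z)\<^sup>2 * A * ((1 + R) ^ n * (1 + norm z) ^ n) * ?W"
      using A R Fz by (intro mult_right_mono mult_mono mult_left_mono power_mono weight_jump_le F mult_nonneg_nonneg) auto
    also have "\<dots> = A * ?W * (?d\<^sup>2 * R\<^sup>2 * (1 + R) ^ n) * ((norm z)\<^sup>2 * (1 + norm z) ^ n)"
      by (simp add: power_mult_distrib mult_ac)
    also have "\<dots> \<le> A * ?W * c0 * ((norm z)\<^sup>2 * (1 + norm z) ^ n)"
      using A R unfolding c0_def by (intro mult_right_mono mult_left_mono) auto
    finally show ?thesis .
  next
    case False
    have "\<bar>w (y + F *v z) - w y - (\<Sum>k\<in>UNIV. ?I z * z $ k * D k)\<bar> = \<bar>w (y + F *v z) - w y\<bar>"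
      using False by simp
    also have "\<dots> \<le> 2 * A * ?W * (1 + R) ^ n * (1 + norm z) ^ n"
      by (rule jump_increment_le[OF smooth_wt_bound[OF w] F])
    also have "\<dots> = A * ?W * (2 * (1 + R) ^ n) * (1 * (1 + norm z) ^ n)" by simp
    also have "\<dots> \<le> A * ?W * c0 * ((norm z)\<^sup>2 * (1 + norm z) ^ n)"
      using A R False one_le_power[of "norm z" 2] unfolding c0_def
      by (intro mult_mono mult_left_mono mult_right_mono mult_nonneg_nonneg) auto
    finally show ?thesis .
  qed
  have "jump_op \<nu> e F w y = (LINT z:?S|levy \<nu>. (w (y + F *v z) - w y - (\<Sum>k\<in>UNIV. ?I z * z $ k * D k)))
      + dird (F *v drift_corr \<nu> e) w y"
    unfolding jump_op_def comp[symmetric] set_integral_diff(2)[OF i1 i2] by simp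
  moreover have "\<bar>LINT z:?S|levy \<nu>. (w (y + F *v z) - w y - (\<Sum>k\<in>UNIV. ?I z * z $ k * D k))\<bar>
      \<le> A * ?W * c0 * levy_moment \<nu> n"
  proof -
    have "\<bar>LINT z:?S|levy \<nu>. (w (y + F *v z) - w y - (\<Sum>k\<in>UNIV. ?I z * z $ k * D k))\<bar>
      \<le> (\<integral>z. A * ?W * c0 * ((norm z)\<^sup>2 * (1 + norm z) ^ n) \<partial>levy \<nu>)"
      unfolding set_lebesgue_integral_def
    proof (rule order_trans[OF integral_abs_bound], rule integral_mono')
      show "integrable (levy \<nu>) (\<lambda>z. A * ?W * c0 * ((norm z)\<^sup>2 * (1 + norm z) ^ n))" using int by simp
      have c: "0 \<le> A * ?W * c0 * ((norm z)\<^sup>2 * (1 + norm z) ^ n)" for z :: "real ^ 'm"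
        using A R by (simp add: c0_def)
      show "\<bar>indicator ?S z *\<^sub>R (w (y + F *v z) - w y - (\<Sum>k\<in>UNIV. ?I z * z $ k * D k))\<bar>
         \<le> A * ?W * c0 * ((norm z)\<^sup>2 * (1 + norm z) ^ n)" for z
        using main[of z] c[of z] by (cases "z \<in> ?S") (simp_all del: mult_eq_0_iff)
    qed (use A R in \<open>auto simp: c0_def\<close>)
    then show ?thesis by (simp add: levy_moment_def)
  qed
  moreover have "\<bar>dird (F *v drift_corr \<nu> e) w y\<bar> \<le> ?d * (R * norm (drift_corr \<nu> e)) * A * ?W"
  proof -
    have "norm (F *v drift_corr \<nu> e) \<le> R * norm (drift_corr \<nu> e)"
      using norm_matrix_vector_le[of F "drift_corr \<nu> e"] mult_right_mono[OF F norm_ge_zero[of "drift_corr \<nu> e"]] by simp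
    then have "?d * norm (F *v drift_corr \<nu> e) * A * ?W \<le> ?d * (R * norm (drift_corr \<nu> e)) * A * ?W"
      using A by (intro mult_right_mono mult_left_mono) auto
    moreover have "smooth_wt n (Suc 1) A w" using w by (simp only: Suc_1)
    ultimately show ?thesis
      using smooth_wt_bound[OF smooth_wt_dird[of n 1 A w "F *v drift_corr \<nu> e"], of y] by linarith
  qed
  ultimately have "\<bar>jump_op \<nu> e F w y\<bar> \<le> A * ?W * (c0 * levy_moment \<nu> n) + A * ?W * (?d * R) * norm (drift_corr \<nu> e)"
    by (simp add: mult_ac)
  also have "\<dots> \<le> A * ?W * (c0 * levy_moment \<nu> n + ?d * R) * (1 + norm (drift_corr \<nu> e))"
  proof -
    have "0 \<le> A * ?W * (c0 * levy_moment \<nu> n) * norm (drift_corr \<nu> e)" "0 \<le> A * ?W * (?d * R)"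
      using A R levy_moment_nonneg[of \<nu> n] by (auto simp: c0_def)
    then show ?thesis by (simp add: algebra_simps)
  qed
  finally show ?thesis by (simp add: c0_def mult_ac)
qed

lemma jump_op_add:
  assumes "integrable (levy \<nu>) (\<lambda>z. (norm z)\<^sup>2 * (1 + norm z) ^ n)" "0 < e"
    and "smooth_wt n k A w" "smooth_wt n l B v" "0 < k" "0 < l"
  shows "jump_op \<nu> e F (\<lambda>y. w y + v y) y = jump_op \<nu> e F w y + jump_op \<nu> e F v y"
proof -
  have "jump_op \<nu> e F (\<lambda>y. w y + v y) y = (LINT z:{z. e < norm z}|levy \<nu>. (w (y + F *v z) - w y) + (v (y + F *v z) - v y))"
    unfolding jump_op_def by (simp add: algebra_simps)
  also have "\<dots> = jump_op \<nu> e F w y + jump_op \<nu> e F v y"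
    unfolding jump_op_def
    by (intro set_integral_add jump_increment_integrable[OF assms(1,2)]) (rule assms)+
  finally show ?thesis .
qed

section \<open>Random signs\<close>

abbreviation "coin \<equiv> measure_pmf (pmf_of_set {-1, 1 :: real})"

lemma sets_sign_law [measurable_cong, simp]: "sets sign_law = sets borel"
  by (simp add: sign_law_def)

lemma sign_vec_measurable [measurable]:
  "(\<lambda>w. \<chi> i. w i) \<in> (\<Pi>\<^sub>M i\<in>(UNIV :: 'n::finite set). coin) \<rightarrow>\<^sub>M (borel :: (real ^ 'n) measure)"
proof -
  have [measurable]: "(\<lambda>w. w i) \<in> (\<Pi>\<^sub>M i\<in>(UNIV :: 'n set). coin) \<rightarrow>\<^sub>M borel" for i :: 'n
    by (rule measurable_compose[OF measurable_component_singleton]) auto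
  have "(\<lambda>w. \<chi> i. w i) = (\<lambda>w. \<Sum>i\<in>UNIV. w i *\<^sub>R axis i (1::real) :: real ^ 'n)"
    by (simp add: fun_eq_iff vec_eq_iff axis_def if_distrib[of "\<lambda>x. _ * x"] cong: if_cong)
  then show ?thesis by simp
qed

lemma prob_space_sign_law: "prob_space (sign_law :: (real ^ 'n) measure)"
  unfolding sign_law_def
  by (intro prob_space.prob_space_distr prob_space_PiM measure_pmf.prob_space_axioms) measurable

lemma AE_sign_law: "AE x in (sign_law :: (real ^ 'n) measure). \<forall>i. \<bar>x $ i\<bar> = 1"
proof -
  have "AE w in (\<Pi>\<^sub>M i\<in>(UNIV :: 'n set). coin). \<forall>i\<in>UNIV. \<bar>w i\<bar> = 1"
    by (intro AE_finite_allI AE_PiM_component measure_pmf.prob_space_axioms) (auto simp: AE_measure_pmf_iff)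
  then show ?thesis unfolding sign_law_def
    by (subst AE_distr_iff) (auto)
qed

lemma AE_sign_law_norm: "AE x in (sign_law :: (real ^ 'n) measure). norm x \<le> CARD('n)"
  using AE_sign_law
proof eventually_elim
  case (elim x)
  then show ?case using norm_le_l1_cart[of x] by simp
qed

lemma sign_law_uminus: "distr sign_law borel uminus = (sign_law :: (real ^ 'n) measure)"
proof -
  let ?P = "\<Pi>\<^sub>M i\<in>(UNIV :: 'n set). coin"
  let ?m = "\<lambda>w. \<lambda>i\<in>(UNIV :: 'n set). - w i :: real"
  interpret product_prob_space "\<lambda>_::'n. coin" by standard
  have flip: "emeasure coin (uminus -` A) = emeasure coin A" for A
  proof -
    have "map_pmf uminus (pmf_of_set {-1, 1 :: real}) = pmf_of_set {-1, 1}"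
      by (subst map_pmf_of_set_inj) (auto simp: insert_commute)
    then have "emeasure coin A = emeasure (measure_pmf (map_pmf uminus (pmf_of_set {-1, 1 :: real}))) A" by simp
    then show ?thesis by simp
  qed
  have m [measurable]: "?m \<in> ?P \<rightarrow>\<^sub>M ?P"
    by (rule measurable_restrict, rule measurable_compose[OF measurable_component_singleton]) auto
  have "distr ?P ?P ?m = ?P"
  proof (rule PiM_eqI)
    fix A :: "'n \<Rightarrow> real set"
    have "emeasure (distr ?P ?P ?m) (Pi\<^sub>E UNIV A) = emeasure ?P (?m -` Pi\<^sub>E UNIV A \<inter> space ?P)"
      by (rule emeasure_distr[OF m]) (auto intro!: sets_PiM_I_finite)
    also have "?m -` Pi\<^sub>E UNIV A \<inter> space ?P = Pi\<^sub>E UNIV (\<lambda>i. uminus -` A i)"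
      by (auto simp: space_PiM PiE_iff)
    also have "emeasure ?P \<dots> = (\<Prod>i\<in>UNIV. emeasure coin (uminus -` A i))"
      by (rule emeasure_PiM) auto
    finally show "emeasure (distr ?P ?P ?m) (Pi\<^sub>E UNIV A) = (\<Prod>i\<in>UNIV. emeasure coin (A i))"
      by (simp only: flip)
  qed auto
  then have "sign_law = distr (distr ?P ?P ?m) borel (\<lambda>w. \<chi> i. w i :: real ^ 'n)"
    by (simp add: sign_law_def)
  also have "\<dots> = distr ?P borel ((\<lambda>w. \<chi> i. w i) \<circ> ?m)" by (rule distr_distr) measurable
  also have "((\<lambda>w. \<chi> i. w i) \<circ> ?m) = (uminus \<circ> (\<lambda>w. \<chi> i. w i :: real ^ 'n))"
    by (auto simp: fun_eq_iff vec_eq_iff)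
  also have "distr ?P borel (uminus \<circ> (\<lambda>w. \<chi> i. w i :: real ^ 'n)) = distr sign_law borel uminus"
    unfolding sign_law_def by (rule distr_distr[symmetric]) measurable
  finally show ?thesis by simp
qed

lemma sign_law_integral_uminus:
  fixes f :: "real ^ 'n \<Rightarrow> real"
  assumes [measurable]: "f \<in> borel_measurable borel"
  shows "(\<integral>x. f (- x) \<partial>sign_law) = (\<integral>x. f x \<partial>sign_law)"
  by (subst (2) sign_law_uminus[symmetric], subst integral_distr) auto

lemma sign_law_mean: "(\<integral>x. x $ i \<partial>(sign_law :: (real ^ 'n) measure)) = 0"
proof -
  have "(\<integral>x. (- x) $ i \<partial>(sign_law :: (real ^ 'n) measure)) = (\<integral>x. x $ i \<partial>sign_law)"
    by (rule sign_law_integral_uminus) measurable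
  then show ?thesis by simp
qed

lemma sign_law_cov:
  "(\<integral>x. x $ i * x $ j \<partial>(sign_law :: (real ^ 'n) measure)) = (if i = j then 1 else 0)"
proof (cases "i = j")
  case True
  interpret prob_space "sign_law :: (real ^ 'n) measure" by (rule prob_space_sign_law)
  have "(\<integral>x. x $ i * x $ i \<partial>(sign_law :: (real ^ 'n) measure)) = (\<integral>x. 1 \<partial>(sign_law :: (real ^ 'n) measure))"
    by (rule integral_cong_AE) (use AE_sign_law in \<open>auto elim!: eventually_mono simp: abs_square_eq_1 power2_eq_square[symmetric]\<close>)
  then show ?thesis using True by (simp add: prob_space)
next
  case False
  let ?P = "\<Pi>\<^sub>M i\<in>(UNIV :: 'n set). coin"
  let ?f = "\<lambda>k::'n. if k = i \<or> k = j then (\<lambda>r. r) else (\<lambda>r. 1 :: real)"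
  interpret product_prob_space "\<lambda>_::'n. coin" by standard
  have "(\<integral>x. x $ i * x $ j \<partial>(sign_law :: (real ^ 'n) measure)) = (\<integral>w. w i * w j \<partial>?P)"
    unfolding sign_law_def by (subst integral_distr[OF sign_vec_measurable]) auto
  also have "\<dots> = (\<integral>w. (\<Prod>k\<in>UNIV. ?f k (w k)) \<partial>?P)"
  proof (rule Bochner_Integration.integral_cong[OF refl])
    fix w :: "'n \<Rightarrow> real"
    have "(\<Prod>k\<in>UNIV. ?f k (w k)) = (\<Prod>k\<in>{i, j}. ?f k (w k))"
      by (rule prod.mono_neutral_right) auto
    then show "w i * w j = (\<Prod>k\<in>UNIV. ?f k (w k))" using False by simp
  qed
  also have "\<dots> = (\<Prod>k\<in>UNIV. \<integral>r. ?f k r \<partial>coin)"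
    by (rule product_integral_prod) (auto intro!: integrable_measure_pmf_finite)
  also have "\<dots> = 0"
    by (rule prod_zero[OF _ bexI[of _ i]]) (auto simp: integral_pmf_of_set)
  finally show ?thesis using False by simp
qed

section \<open>The law of the time step\<close>

text \<open>Integration by parts against \<open>e\<^bsup>- r s\<^esup>\<close>; the left-hand side is the mean of \<open>k\<close> at the minimum of
  \<open>h\<close> and an exponential time of rate \<open>r\<close>.\<close>

lemma exp_by_parts:
  fixes k :: "real \<Rightarrow> real"
  assumes "0 \<le> h" "\<And>s. (k has_real_derivative k' s) (at s)" "continuous_on UNIV k'"
  shows "(LBINT s:{0..h}. r * exp (- r * s) * k s) + exp (- r * h) * k h
    = k 0 + (LBINT s:{0..h}. exp (- r * s) * k' s)"
proof -
  have ck: "continuous_on S k" for S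
    using assms(2) by (meson DERIV_continuous continuous_at_imp_continuous_on)
  have ck': "continuous_on S k'" for S using assms(3) continuous_on_subset by blast
  have i1: "set_integrable lborel {0..h} (\<lambda>s. r * exp (- r * s) * k s)"
    and i2: "set_integrable lborel {0..h} (\<lambda>s. exp (- r * s) * k' s)"
    unfolding set_integrable_def by (rule borel_integrable_compact; auto intro!: continuous_intros ck ck')+
  have "(LBINT s:{0..h}. r * exp (- r * s) * k s - exp (- r * s) * k' s) = - exp (- r * h) * k h - (- exp (- r * 0) * k 0)"
    unfolding set_lebesgue_integral_def
  proof (rule integral_FTC_atLeastAtMost[OF assms(1)])
    fix s
    show "((\<lambda>s. - exp (- r * s) * k s) has_vector_derivative r * exp (- r * s) * k s - exp (- r * s) * k' s) (at s within {0..h})"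
      unfolding has_real_derivative_iff_has_vector_derivative[symmetric]
      by (rule has_field_derivative_at_within) (rule derivative_eq_intros assms(2) refl | simp)+
  qed (intro continuous_intros ck ck')
  then show ?thesis using set_integral_diff(2)[OF i1 i2] by simp
qed

lemma set_integral_mono_Icc:
  fixes f g :: "real \<Rightarrow> real"
  assumes "continuous_on UNIV f" "continuous_on UNIV g" "\<And>s. 0 \<le> s \<Longrightarrow> s \<le> h \<Longrightarrow> f s \<le> g s"
  shows "(LBINT s:{0..h}. f s) \<le> (LBINT s:{0..h}. g s)"
proof (rule set_integral_mono)
  show "set_integrable lborel {0..h} f" "set_integrable lborel {0..h} g"
    using assms(1,2) by (auto intro!: borel_integrable_atLeastAtMost' intro: continuous_on_subset)
qed (use assms in auto)

text \<open>\<open>mean_step r h\<close> is the mean of this minimum, and \<open>wt_moment r h 0\<close> is half of its second moment.\<close>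

definition mean_step :: "real \<Rightarrow> real \<Rightarrow> real" where
  "mean_step r h = (1 - exp (- r * h)) / r"

definition wt_moment :: "real \<Rightarrow> real \<Rightarrow> nat \<Rightarrow> real" where
  "wt_moment r h n = (LBINT s:{0..h}. exp (- r * s) * (s * (1 + r * s) ^ n))"

lemma weight_deriv:
  "((\<lambda>s. s\<^sup>2 * (1 + r * s) ^ n) has_real_derivative 2 * s * (1 + r * s) ^ n + s\<^sup>2 * (n * (1 + r * s) ^ (n - 1) * r)) (at s)"
  by (auto intro!: derivative_eq_intros)

lemma weight_deriv_le:
  fixes r s :: real
  assumes "0 \<le> r" "0 \<le> s"
  shows "2 * s * (1 + r * s) ^ n + s\<^sup>2 * (n * (1 + r * s) ^ (n - 1) * r) \<le> (real n + 2) * (s * (1 + r * s) ^ n)"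
proof (cases n)
  case (Suc k)
  have "r * s \<le> 1 + r * s" by simp
  then have "(r * s) * (1 + r * s) ^ k \<le> (1 + r * s) * (1 + r * s) ^ k"
    using assms by (intro mult_right_mono) auto
  then have "s * (real n * ((r * s) * (1 + r * s) ^ k)) \<le> s * (real n * ((1 + r * s) * (1 + r * s) ^ k))"
    using assms by (intro mult_left_mono) auto
  then show ?thesis using Suc by (simp add: algebra_simps power2_eq_square)
qed (use assms in simp)

lemma square_weight_moment_le:
  assumes "0 < r" "0 \<le> h"
  shows "(LBINT s:{0..h}. r * exp (- r * s) * (s\<^sup>2 * (1 + r * s) ^ n)) + exp (- r * h) * (h\<^sup>2 * (1 + r * h) ^ n)
    \<le> (real n + 2) * wt_moment r h n"
proof -
  have cont: "continuous_on UNIV (\<lambda>s. 2 * s * (1 + r * s) ^ n + s\<^sup>2 * (n * (1 + r * s) ^ (n - 1) * r))"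
    by (intro continuous_intros)
  have "(LBINT s:{0..h}. r * exp (- r * s) * (s\<^sup>2 * (1 + r * s) ^ n)) + exp (- r * h) * (h\<^sup>2 * (1 + r * h) ^ n)
    = (LBINT s:{0..h}. exp (- r * s) * (2 * s * (1 + r * s) ^ n + s\<^sup>2 * (n * (1 + r * s) ^ (n - 1) * r)))"
    using exp_by_parts[where k = "\<lambda>s. s\<^sup>2 * (1 + r * s) ^ n" and r = r, OF assms(2) weight_deriv[of r n] cont]
    by (simp only: zero_power2 mult_zero_left add_0_left)
  also have "\<dots> \<le> (LBINT s:{0..h}. exp (- r * s) * ((real n + 2) * (s * (1 + r * s) ^ n)))"
  proof (rule set_integral_mono_Icc)
    fix s assume "0 \<le> s" "s \<le> h"
    then show "exp (- r * s) * (2 * s * (1 + r * s) ^ n + s\<^sup>2 * (n * (1 + r * s) ^ (n - 1) * r))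
      \<le> exp (- r * s) * ((real n + 2) * (s * (1 + r * s) ^ n))"
      using weight_deriv_le[of r s n] assms(1) by (intro mult_left_mono) (auto simp: add.commute)
  qed (intro continuous_intros)+
  also have "\<dots> = (LBINT s:{0..h}. (real n + 2) * (exp (- r * s) * (s * (1 + r * s) ^ n)))"
    by (rule set_lebesgue_integral_cong) (simp_all add: mult_ac)
  also have "\<dots> = (real n + 2) * wt_moment r h n"
    unfolding wt_moment_def by (rule set_integral_mult_right)
  finally show ?thesis .
qed

text \<open>The weights \<open>(1 + r s)\<^sup>n\<close> cost a constant only, uniformly in \<open>r\<close> and \<open>h\<close>: integration by parts removes
  one factor \<open>r s\<close> at a time.\<close>

lemma wt_moment_le:
  assumes "0 < r" "0 \<le> h"
  shows "wt_moment r h n \<le> fact (n + 2) * wt_moment r h 0"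
proof (induction n)
  case 0
  have "0 \<le> wt_moment r h 0" unfolding wt_moment_def set_lebesgue_integral_def
    by (intro integral_nonneg_AE) (auto split: split_indicator)
  then show ?case by (simp add: fact_2)
next
  case (Suc n)
  have c: "set_integrable lborel {0..h} f" if "continuous_on UNIV f" for f :: "real \<Rightarrow> real"
    using that by (auto intro!: borel_integrable_atLeastAtMost' intro: continuous_on_subset)
  have "wt_moment r h (Suc n) = (LBINT s:{0..h}. exp (- r * s) * (s * (1 + r * s) ^ n) + r * exp (- r * s) * (s\<^sup>2 * (1 + r * s) ^ n))"
    unfolding wt_moment_def by (simp add: algebra_simps power2_eq_square)
  also have "\<dots> = wt_moment r h n + (LBINT s:{0..h}. r * exp (- r * s) * (s\<^sup>2 * (1 + r * s) ^ n))"
    unfolding wt_moment_def by (intro set_integral_add c continuous_intros)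
  also have "\<dots> \<le> wt_moment r h n + (real n + 2) * wt_moment r h n"
  proof -
    have "0 \<le> exp (- r * h) * (h\<^sup>2 * (1 + r * h) ^ n)" using assms by simp
    then show ?thesis using square_weight_moment_le[OF assms, of n] by linarith
  qed
  also have "\<dots> = (real n + 3) * wt_moment r h n" by (simp add: algebra_simps)
  also have "\<dots> \<le> (real n + 3) * (fact (n + 2) * wt_moment r h 0)" by (intro mult_left_mono Suc) simp
  also have "\<dots> = fact (Suc n + 2) * wt_moment r h 0"
    by (simp add: fact_reduce[of "Suc n + 2"] algebra_simps)
  finally show ?case .
qed

lemma LBINT_exp: "0 < r \<Longrightarrow> 0 \<le> h \<Longrightarrow> (LBINT s:{0..h}. exp (- r * s)) = mean_step r h"
  using exp_by_parts[of h "\<lambda>s. s - 0" "\<lambda>_. 1" r] exp_by_parts[of h "\<lambda>s. 1" "\<lambda>_. 0" r]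
  by (simp add: mean_step_def field_simps)

lemma wt_moment_0:
  assumes "0 < r" "0 \<le> h"
  shows "wt_moment r h 0 = (mean_step r h - h * exp (- r * h)) / r"
proof -
  have "(LBINT s:{0..h}. r * exp (- r * s) * s) + exp (- r * h) * h = mean_step r h"
    using exp_by_parts[of h "\<lambda>s. s" "\<lambda>_. 1" r] assms LBINT_exp[OF assms] by simp
  moreover have "(LBINT s:{0..h}. r * exp (- r * s) * s) = r * wt_moment r h 0"
    unfolding wt_moment_def set_integral_mult_right[symmetric] by (simp add: mult.assoc)
  ultimately show ?thesis using assms by (simp add: field_simps)
qed

lemma sets_trunc_exp_law [measurable_cong, simp]: "sets (trunc_exp_law r h) = sets borel"
  by (simp add: trunc_exp_law_def)

lemma trunc_exp_integral:
  fixes k :: "real \<Rightarrow> real"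
  assumes "0 < r" "0 < h" and [measurable]: "k \<in> borel_measurable borel"
  shows "(1 - exp (- r * h)) * (\<integral>s. k s \<partial>trunc_exp_law r h) = (LBINT s:{0..h}. r * exp (- r * s) * k s)"
proof -
  define c where "c = 1 - exp (- r * h)"
  have p: "0 < c" using assms by (simp add: c_def)
  have "(\<integral>s. k s \<partial>trunc_exp_law r h)
      = (\<integral>s. (indicator {0..h} s * (r * exp (- r * s) / c)) *\<^sub>R k s \<partial>lborel)"
    unfolding trunc_exp_law_def c_def[symmetric] using assms p by (subst integral_density) auto
  also have "\<dots> = (\<integral>s. (1 / c) * (indicator {0..h} s *\<^sub>R (r * exp (- r * s) * k s)) \<partial>lborel)"
    by (rule Bochner_Integration.integral_cong) (auto)
  also have "\<dots> = (1 / c) * (LBINT s:{0..h}. r * exp (- r * s) * k s)"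
    unfolding set_lebesgue_integral_def by (rule integral_mult_right_zero)
  finally show ?thesis using p unfolding c_def[symmetric] by simp
qed

lemma prob_space_trunc_exp_law:
  assumes "0 < r" "0 < h"
  shows "prob_space (trunc_exp_law r h)"
proof
  define c where "c = 1 - exp (- r * h)"
  have p: "0 < c" using assms by (simp add: c_def)
  have i: "integrable lborel (\<lambda>s. indicator {0..h} s * (r * exp (- r * s) / c))"
    using borel_integrable_atLeastAtMost'[of 0 h "\<lambda>s. r * exp (- r * s) / c"] p
    by (simp add: set_integrable_def continuous_intros del: mult_minus_left)
  have "emeasure (trunc_exp_law r h) (space (trunc_exp_law r h))
     = (\<integral>\<^sup>+s. ennreal (indicator {0..h} s * (r * exp (- r * s) / c)) \<partial>lborel)"
    unfolding trunc_exp_law_def c_def[symmetric] by (subst emeasure_density) auto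
  also have "\<dots> = ennreal (\<integral>s. indicator {0..h} s * (r * exp (- r * s) / c) \<partial>lborel)"
    using assms p by (intro nn_integral_eq_integral i) (auto intro!: AE_I2 mult_nonneg_nonneg)
  also have "(\<integral>s. indicator {0..h} s * (r * exp (- r * s) / c) \<partial>lborel)
     = (1 / c) * (LBINT s:{0..h}. r * exp (- r * s) * 1)"
    unfolding set_lebesgue_integral_def integral_mult_right_zero[symmetric]
    by (rule Bochner_Integration.integral_cong) auto
  also have "(LBINT s:{0..h}. r * exp (- r * s) * 1) = c"
    using exp_by_parts[of h "\<lambda>s. 1" "\<lambda>_. 0" r] assms by (simp add: c_def)
  finally show "emeasure (trunc_exp_law r h) (space (trunc_exp_law r h)) = 1" using p by simp
qed

lemma AE_trunc_exp_law: "AE s in trunc_exp_law r h. 0 < s \<and> s \<le> h"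
proof -
  have "AE s in lborel. s \<noteq> (0::real)" by (rule AE_lborel_singleton)
  then show ?thesis unfolding trunc_exp_law_def
    by (subst AE_density) (auto elim!: eventually_mono simp: indicator_def order_less_le)
qed

text \<open>The flag and the candidate jump time; the actual time step is \<open>\<theta> = (if I then \<delta> else h)\<close>, the
  minimum of \<open>h\<close> and an exponential time.\<close>

definition clock :: "real \<Rightarrow> real \<Rightarrow> (bool \<times> real) measure" where
  "clock r h = measure_pmf (bernoulli_pmf (1 - exp (- r * h))) \<Otimes>\<^sub>M trunc_exp_law r h"

definition dur :: "real \<Rightarrow> bool \<times> real \<Rightarrow> real" where
  "dur h = (\<lambda>(I, \<delta>). if I then \<delta> else h)"

lemma sets_clock [measurable_cong, simp]: "sets (clock r h) = sets (count_space UNIV \<Otimes>\<^sub>M borel)"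
  unfolding clock_def by (intro sets_pair_measure_cong) auto

lemma dur_measurable [measurable]: "dur h \<in> borel_measurable (count_space UNIV \<Otimes>\<^sub>M borel)"
  unfolding dur_def by measurable

lemma prob_space_clock: "0 < r \<Longrightarrow> 0 < h \<Longrightarrow> prob_space (clock r h)"
  unfolding clock_def
  by (intro prob_space_pair measure_pmf.prob_space_axioms prob_space_trunc_exp_law)

lemma AE_clock:
  assumes "0 < r" "0 < h"
  shows "AE w in clock r h. 0 < snd w \<and> snd w \<le> h"
proof -
  interpret E: prob_space "trunc_exp_law r h" using assms by (rule prob_space_trunc_exp_law)
  interpret P: pair_sigma_finite "measure_pmf (bernoulli_pmf (1 - exp (- r * h)))" "trunc_exp_law r h" ..
  have "AE w in clock r h. (\<lambda>w. 0 < snd w \<and> snd w \<le> h) w"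
    unfolding clock_def
  proof (rule P.AE_pair_measure)
    show "{x \<in> space (measure_pmf (bernoulli_pmf (1 - exp (- r * h))) \<Otimes>\<^sub>M trunc_exp_law r h). 0 < snd x \<and> snd x \<le> h}
      \<in> sets (measure_pmf (bernoulli_pmf (1 - exp (- r * h))) \<Otimes>\<^sub>M trunc_exp_law r h)"
      by measurable
  qed (use AE_trunc_exp_law in auto)
  then show ?thesis .
qed

lemma AE_clock_dur: "0 < r \<Longrightarrow> 0 < h \<Longrightarrow> AE w in clock r h. 0 < dur h w \<and> dur h w \<le> h"
  by (rule eventually_mono[OF AE_clock]) (auto simp: dur_def split: if_splits)

lemma clock_integral:
  fixes k :: "bool \<times> real \<Rightarrow> real"
  assumes "0 < r" "0 < h" and k: "integrable (clock r h) k"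
  shows "(\<integral>w. k w \<partial>clock r h) = (LBINT s:{0..h}. r * exp (- r * s) * k (True, s))
    + exp (- r * h) * (\<integral>s. k (False, s) \<partial>trunc_exp_law r h)"
proof -
  interpret E: prob_space "trunc_exp_law r h" using assms by (intro prob_space_trunc_exp_law)
  interpret P: pair_sigma_finite "measure_pmf (bernoulli_pmf (1 - exp (- r * h)))" "trunc_exp_law r h" ..
  have [measurable]: "k \<in> borel_measurable (count_space UNIV \<Otimes>\<^sub>M borel)"
    using borel_measurable_integrable[OF k] by simp
  have "(\<integral>w. k w \<partial>clock r h) = (\<integral>I. \<integral>s. k (I, s) \<partial>trunc_exp_law r h \<partial>measure_pmf (bernoulli_pmf (1 - exp (- r * h))))"
    unfolding clock_def by (rule P.integral_fst'[symmetric]) (use k in \<open>simp add: clock_def\<close>)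
  also have "\<dots> = (1 - exp (- r * h)) * (\<integral>s. k (True, s) \<partial>trunc_exp_law r h) + exp (- r * h) * (\<integral>s. k (False, s) \<partial>trunc_exp_law r h)"
    using assms by simp
  also have "(1 - exp (- r * h)) * (\<integral>s. k (True, s) \<partial>trunc_exp_law r h) = (LBINT s:{0..h}. r * exp (- r * s) * k (True, s))"
    by (rule trunc_exp_integral[OF assms(1,2)]) measurable
  finally show ?thesis .
qed

lemma clock_bounded_integrable:
  fixes k :: "bool \<times> real \<Rightarrow> real"
  assumes "0 < r" "0 < h" "k \<in> borel_measurable (count_space UNIV \<Otimes>\<^sub>M borel)"
    "\<And>w. 0 < snd w \<Longrightarrow> snd w \<le> h \<Longrightarrow> \<bar>k w\<bar> \<le> C"
  shows "integrable (clock r h) k"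
proof -
  interpret prob_space "clock r h" using assms by (intro prob_space_clock)
  show ?thesis
    by (rule integrable_const_bound[OF eventually_mono[OF AE_clock]]) (use assms in auto)
qed

lemma clock_integral_dur:
  fixes k :: "real \<Rightarrow> real"
  assumes "0 < r" "0 < h" "k \<in> borel_measurable borel" "\<And>s. 0 < s \<Longrightarrow> s \<le> h \<Longrightarrow> \<bar>k s\<bar> \<le> C"
  shows "integrable (clock r h) (\<lambda>w. k (dur h w))"
    "(\<integral>w. k (dur h w) \<partial>clock r h) = (LBINT s:{0..h}. r * exp (- r * s) * k s) + exp (- r * h) * k h"
proof -
  note [measurable] = assms(3)
  interpret E: prob_space "trunc_exp_law r h" using assms by (intro prob_space_trunc_exp_law)
  show i: "integrable (clock r h) (\<lambda>w. k (dur h w))"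
    using assms by (intro clock_bounded_integrable[of _ _ _ C]) (auto simp: dur_def split: if_splits)
  show "(\<integral>w. k (dur h w) \<partial>clock r h) = (LBINT s:{0..h}. r * exp (- r * s) * k s) + exp (- r * h) * k h"
    using clock_integral[OF assms(1,2) i] by (simp add: dur_def E.prob_space)
qed

lemma clock_mean:
  assumes "0 < r" "0 < h"
  shows "integrable (clock r h) (dur h)" "(\<integral>w. dur h w \<partial>clock r h) = mean_step r h"
  using clock_integral_dur[OF assms, of "\<lambda>s. s" h] exp_by_parts[of h "\<lambda>s. s" "\<lambda>_. 1" r] assms
    LBINT_exp[of r h] assms by auto

lemma clock_flag:
  assumes "0 < r" "0 < h"
  shows "(\<integral>w. of_bool (fst w) \<partial>clock r h) = r * mean_step r h"
proof -
  have i: "integrable (clock r h) (\<lambda>w. of_bool (fst w) :: real)"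
    using assms by (intro clock_bounded_integrable[of _ _ _ 1]) auto
  show ?thesis
    using clock_integral[OF assms i] exp_by_parts[of h "\<lambda>s. 1" "\<lambda>_. 0" r] assms by (simp add: mean_step_def)
qed

text \<open>The integrand is the form in which the remainders of the expansion of one step appear: the first
  term belongs to the motion without a jump, the second to the jump.\<close>

lemma clock_weight_moment:
  fixes r h :: real and n :: nat
  assumes "0 < r" "0 < h"
  defines "k \<equiv> \<lambda>w. (dur h w)\<^sup>2 * (1 + r * dur h w) ^ n + of_bool (fst w) * (snd w * (1 + r * snd w) ^ n) / r"
  shows "integrable (clock r h) k" "(\<integral>w. k w \<partial>clock r h) \<le> (real n + 3) * fact (n + 2) * wt_moment r h 0"
proof -
  let ?C = "h * (1 + r * h) ^ n"
  have b: "0 \<le> s * (1 + r * s) ^ n \<and> s * (1 + r * s) ^ n \<le> ?C" if "0 < s" "s \<le> h" for s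
    using that assms by (auto intro!: mult_mono power_mono)
  have b2: "0 \<le> s\<^sup>2 * (1 + r * s) ^ n \<and> s\<^sup>2 * (1 + r * s) ^ n \<le> h * ?C" if "0 < s" "s \<le> h" for s
    using b[OF that] that assms mult_mono[of s h "s * (1 + r * s) ^ n" ?C] by (simp add: power2_eq_square mult.assoc)
  have i1: "integrable (clock r h) (\<lambda>w. (dur h w)\<^sup>2 * (1 + r * dur h w) ^ n)"
    and e1: "(\<integral>w. (dur h w)\<^sup>2 * (1 + r * dur h w) ^ n \<partial>clock r h)
      = (LBINT s:{0..h}. r * exp (- r * s) * (s\<^sup>2 * (1 + r * s) ^ n)) + exp (- r * h) * (h\<^sup>2 * (1 + r * h) ^ n)"
    using clock_integral_dur[OF assms(1,2), of "\<lambda>s. s\<^sup>2 * (1 + r * s) ^ n" "h * ?C"] b2 by auto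
  have i2: "integrable (clock r h) (\<lambda>w. of_bool (fst w) * (snd w * (1 + r * snd w) ^ n) / r)"
    using assms b by (intro clock_bounded_integrable[of _ _ _ "?C / r"]) (auto intro!: divide_right_mono)
  have e2: "(\<integral>w. of_bool (fst w) * (snd w * (1 + r * snd w) ^ n) / r \<partial>clock r h) = wt_moment r h n"
    using clock_integral[OF assms(1,2) i2] assms(1) by (simp add: wt_moment_def)
  show "integrable (clock r h) k" unfolding k_def using i1 i2 by (rule Bochner_Integration.integrable_add)
  have "(\<integral>w. k w \<partial>clock r h) \<le> (real n + 2) * wt_moment r h n + wt_moment r h n"
    unfolding k_def Bochner_Integration.integral_add[OF i1 i2] e1 e2
    using square_weight_moment_le[of r h n] assms(1,2) by linarith
  also have "\<dots> = (real n + 3) * wt_moment r h n" by (simp add: algebra_simps)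
  also have "\<dots> \<le> (real n + 3) * (fact (n + 2) * wt_moment r h 0)"
    using assms(1,2) by (intro mult_left_mono wt_moment_le) auto
  finally show "(\<integral>w. k w \<partial>clock r h) \<le> (real n + 3) * fact (n + 2) * wt_moment r h 0" by (simp only: mult.assoc)
qed

text \<open>Absence of memory: given that the step passes the level \<open>s\<close>, the excess is again a truncated
  exponential time, with the smaller truncation \<open>h - s\<close>.\<close>

lemma clock_overshoot:
  assumes "0 < r" "0 < h" "0 < s"
  shows "(\<integral>w. max 0 (dur h w - s) \<partial>clock r h) \<le> mean_step r h * (\<integral>w. indicator {s..} (dur h w) \<partial>clock r h)"
proof (cases "s \<le> h")
  case True
  have I: "(LBINT t:{0..h}. r * exp (- r * t) * max 0 (t - s)) = (LBINT t:{s..h}. r * exp (- r * t) * (t - s))"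
    "(LBINT t:{0..h}. r * exp (- r * t) * indicator {s..} t) = (LBINT t:{s..h}. r * exp (- r * t))"
    unfolding set_lebesgue_integral_def
    using assms by (auto intro!: Bochner_Integration.integral_cong split: split_indicator)
  have F1: "(LBINT t:{s..h}. r * exp (- r * t) * (t - s))
    = (- exp (- r * h) * (h - s) - exp (- r * h) / r) - (- exp (- r * s) * (s - s) - exp (- r * s) / r)"
    unfolding set_lebesgue_integral_def
  proof (rule integral_FTC_atLeastAtMost[OF True])
    fix t
    show "((\<lambda>t. - exp (- r * t) * (t - s) - exp (- r * t) / r) has_vector_derivative r * exp (- r * t) * (t - s)) (at t within {s..h})"
      unfolding has_real_derivative_iff_has_vector_derivative[symmetric]
      by (rule has_field_derivative_at_within) (use assms in \<open>auto intro!: derivative_eq_intros\<close>)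
  qed (intro continuous_intros)
  have F2: "(LBINT t:{s..h}. r * exp (- r * t)) = - exp (- r * h) - (- exp (- r * s))"
    unfolding set_lebesgue_integral_def
  proof (rule integral_FTC_atLeastAtMost[OF True])
    fix t
    show "((\<lambda>t. - exp (- r * t)) has_vector_derivative r * exp (- r * t)) (at t within {s..h})"
      unfolding has_real_derivative_iff_has_vector_derivative[symmetric]
      by (rule has_field_derivative_at_within) (use assms in \<open>auto intro!: derivative_eq_intros\<close>)
  qed (intro continuous_intros)
  have "(\<integral>w. max 0 (dur h w - s) \<partial>clock r h) = (LBINT t:{s..h}. r * exp (- r * t) * (t - s)) + exp (- r * h) * (h - s)"
    unfolding I(1)[symmetric]
    using clock_integral_dur(2)[OF assms(1,2), of "\<lambda>t. max 0 (t - s)" h] assms True by simp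
  also have "\<dots> = (exp (- r * s) - exp (- r * h)) / r"
    unfolding F1 by (simp add: diff_divide_distrib)
  also have "\<dots> \<le> (exp (- r * s) - exp (- r * h) * exp (- r * s)) / r"
    using assms by (intro divide_right_mono) auto
  also have "\<dots> = mean_step r h * exp (- r * s)" by (simp add: mean_step_def algebra_simps)
  also have "exp (- r * s) = (LBINT t:{0..h}. r * exp (- r * t) * indicator {s..} t) + exp (- r * h)"
    unfolding I(2) F2 by simp
  also have "\<dots> = (\<integral>w. indicator {s..} (dur h w) \<partial>clock r h)"
    using clock_integral_dur(2)[OF assms(1,2), of "indicator {s..}" 1] assms True by (simp add: indicator_def)
  finally show ?thesis .
next
  case False
  have "(\<integral>w. max 0 (dur h w - s) \<partial>clock r h) = (\<integral>w. 0 \<partial>clock r h)"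
  proof (rule integral_cong_AE)
    show "AE w in clock r h. max 0 (dur h w - s) = 0"
      by (rule eventually_mono[OF AE_clock_dur[OF assms(1,2)]]) (use False in auto)
  qed measurable
  then show ?thesis using assms by (simp add: mean_step_def integral_nonneg_AE)
qed

section \<open>Exit of a chain driven by independent noise\<close>

locale iid_chain = prob_space M for M :: "'w measure" +
  fixes L :: "'n measure" and N :: "nat \<Rightarrow> 'w \<Rightarrow> 'n"
    and step :: "'s::second_countable_topology \<Rightarrow> 'n \<Rightarrow> 's" and s0 :: 's and S :: "nat \<Rightarrow> 'w \<Rightarrow> 's"
  assumes indep: "indep_vars (\<lambda>_. L) N UNIV"
    and law: "\<And>k. distr M L (N k) = L"
    and step_measurable [measurable]: "case_prod step \<in> borel \<Otimes>\<^sub>M L \<rightarrow>\<^sub>M borel"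
    and S_0: "S 0 \<omega> = s0"
    and S_Suc: "S (Suc k) \<omega> = step (S k \<omega>) (N k \<omega>)"
begin

lemma N_measurable [measurable]: "N k \<in> M \<rightarrow>\<^sub>M L"
  using indep by (auto simp: indep_vars_def2)

lemma prob_space_law: "prob_space L"
  using prob_space_distr[OF N_measurable, of 0] by (simp add: law)

sublocale L: prob_space L by (rule prob_space_law)

lemma S_measurable [measurable]: "S k \<in> M \<rightarrow>\<^sub>M borel"
proof (induction k)
  case 0
  then show ?case by (simp add: S_0[abs_def])
next
  case (Suc k)
  note [measurable] = Suc
  have "(\<lambda>\<omega>. case_prod step (S k \<omega>, N k \<omega>)) \<in> M \<rightarrow>\<^sub>M borel" by measurable
  then show ?case by (simp add: S_Suc[abs_def])
qed

definition alive :: "'s set \<Rightarrow> nat \<Rightarrow> 'w \<Rightarrow> bool" where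
  "alive B k \<omega> \<longleftrightarrow> (\<forall>j\<le>k. S j \<omega> \<in> B)"

lemma alive_measurable [measurable]:
  assumes [measurable]: "B \<in> sets borel"
  shows "Measurable.pred M (alive B k)"
proof -
  have "Measurable.pred M (\<lambda>\<omega>. \<forall>j\<in>{..k}. S j \<omega> \<in> B)"
    by (intro pred_intros_finite) auto
  then show ?thesis by (simp add: alive_def[abs_def])
qed

lemma alive_0 [simp]: "alive B 0 \<omega> \<longleftrightarrow> s0 \<in> B"
  by (simp add: alive_def S_0)

lemma alive_Suc: "alive B (Suc k) \<omega> \<longleftrightarrow> alive B k \<omega> \<and> S (Suc k) \<omega> \<in> B"
  by (auto simp: alive_def le_Suc_eq)

lemma alive_in: "alive B k \<omega> \<Longrightarrow> S k \<omega> \<in> B"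
  by (simp add: alive_def)

text \<open>The state and the survival flag at time \<open>k\<close> are functions of the noise before \<open>k\<close>, so that the
  noise of the next step can be integrated out first.\<close>

lemma distr_past:
  assumes [measurable]: "B \<in> sets borel"
  shows "distr M ((count_space UNIV \<Otimes>\<^sub>M borel) \<Otimes>\<^sub>M L) (\<lambda>\<omega>. ((alive B k \<omega>, S k \<omega>), N k \<omega>))
    = distr M (count_space UNIV \<Otimes>\<^sub>M borel) (\<lambda>\<omega>. (alive B k \<omega>, S k \<omega>)) \<Otimes>\<^sub>M L"
proof -
  define path where "path n j = rec_nat s0 (\<lambda>i s. step s (n i)) j" for n :: "nat \<Rightarrow> 'n" and j
  have path_simps: "path n 0 = s0" "path n (Suc j) = step (path n j) (n j)" for n j
    by (simp_all add: path_def)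
  have S_path: "S j \<omega> = path (restrict (\<lambda>i. N i \<omega>) {..<k}) j" if "j \<le> k" for j \<omega>
    using that by (induction j) (auto simp: path_simps S_0 S_Suc)
  have path_meas: "(\<lambda>n. path n j) \<in> PiM {..<k} (\<lambda>_. L) \<rightarrow>\<^sub>M borel" if "j \<le> k" for j
    using that
  proof (induction j)
    case (Suc j)
    have [measurable]: "(\<lambda>n. path n j) \<in> PiM {..<k} (\<lambda>_. L) \<rightarrow>\<^sub>M borel" using Suc by simp
    have [measurable]: "(\<lambda>n. n j) \<in> PiM {..<k} (\<lambda>_. L) \<rightarrow>\<^sub>M L" using Suc by simp
    have "(\<lambda>n. case_prod step (path n j, n j)) \<in> PiM {..<k} (\<lambda>_. L) \<rightarrow>\<^sub>M borel" by measurable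
    then show ?case by (simp add: path_simps)
  qed (simp add: path_simps)
  let ?P = "count_space UNIV \<Otimes>\<^sub>M borel :: (bool \<times> 's) measure"
  let ?A = "PiM {..<k} (\<lambda>_. L)" and ?K = "PiM {k} (\<lambda>_. L)"
  define G where "G n = (\<forall>j\<in>{..k}. path n j \<in> B, path n k)" for n
  let ?X = "\<lambda>\<omega>. restrict (\<lambda>i. N i \<omega>) {..<k}" and ?Y = "\<lambda>\<omega>. restrict (\<lambda>i. N i \<omega>) {k}"
  have G [measurable]: "G \<in> ?A \<rightarrow>\<^sub>M ?P"
    unfolding G_def[abs_def] using path_meas by (intro measurable_Pair pred_intros_finite) auto
  have X [measurable]: "?X \<in> M \<rightarrow>\<^sub>M ?A" and Y [measurable]: "?Y \<in> M \<rightarrow>\<^sub>M ?K"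
    by (auto intro!: measurable_restrict)
  have ev [measurable]: "(\<lambda>n. n k) \<in> ?K \<rightarrow>\<^sub>M L" by simp
  have GX: "G (?X \<omega>) = (alive B k \<omega>, S k \<omega>)" for \<omega>
    by (auto simp: G_def alive_def S_path)
  have XY: "distr M ?A ?X \<Otimes>\<^sub>M distr M ?K ?Y = distr M (?A \<Otimes>\<^sub>M ?K) (\<lambda>\<omega>. (?X \<omega>, ?Y \<omega>))"
    using indep_var_restrict[OF indep, of "{..<k}" "{k}"] by (simp add: indep_var_distribution_eq)
  have "distr M (?P \<Otimes>\<^sub>M L) (\<lambda>\<omega>. ((alive B k \<omega>, S k \<omega>), N k \<omega>))
    = distr (distr M (?A \<Otimes>\<^sub>M ?K) (\<lambda>\<omega>. (?X \<omega>, ?Y \<omega>))) (?P \<Otimes>\<^sub>M L) (\<lambda>(x, y). (G x, y k))"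
    by (subst distr_distr) (auto simp: comp_def GX[symmetric])
  also have "\<dots> = distr (distr M ?A ?X \<Otimes>\<^sub>M distr M ?K ?Y) (?P \<Otimes>\<^sub>M L) (\<lambda>(x, y). (G x, y k))"
    by (simp only: XY)
  also have "\<dots> = distr (distr M ?A ?X) ?P G \<Otimes>\<^sub>M distr (distr M ?K ?Y) L (\<lambda>n. n k)"
  proof (rule pair_measure_distr[symmetric])
    have "prob_space (distr (distr M ?K ?Y) L (\<lambda>n. n k))"
      by (intro prob_space.prob_space_distr prob_space_distr) measurable
    then show "sigma_finite_measure (distr (distr M ?K ?Y) L (\<lambda>n. n k))"
      by (simp add: prob_space_imp_sigma_finite)
  qed (use G ev in simp_all)
  also have "distr (distr M ?A ?X) ?P G = distr M ?P (\<lambda>\<omega>. (alive B k \<omega>, S k \<omega>))"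
    by (subst distr_distr) (auto simp: comp_def GX)
  also have "distr (distr M ?K ?Y) L (\<lambda>n. n k) = L"
    by (subst distr_distr) (auto simp: comp_def law)
  finally show ?thesis .
qed

lemma nn_integral_step:
  fixes f :: "'s \<Rightarrow> ennreal"
  assumes B [measurable]: "B \<in> sets borel" and f [measurable]: "f \<in> borel_measurable borel"
  shows "(\<integral>\<^sup>+\<omega>. f (S (Suc k) \<omega>) * indicator {\<omega>. alive B k \<omega>} \<omega> \<partial>M)
    = (\<integral>\<^sup>+\<omega>. (\<integral>\<^sup>+n. f (step (S k \<omega>) n) \<partial>L) * indicator {\<omega>. alive B k \<omega>} \<omega> \<partial>M)"
proof -
  let ?P = "count_space UNIV \<Otimes>\<^sub>M borel :: (bool \<times> 's) measure"
  let ?X = "\<lambda>\<omega>. (alive B k \<omega>, S k \<omega>)"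
  let ?h = "\<lambda>p. case p of ((a, s), n) \<Rightarrow> f (step s n) * (if a then 1 else 0)"
  have h [measurable]: "?h \<in> borel_measurable (?P \<Otimes>\<^sub>M L)"
  proof -
    have [measurable]: "(\<lambda>p. case_prod step (snd (fst p), snd p)) \<in> ?P \<Otimes>\<^sub>M L \<rightarrow>\<^sub>M borel" by measurable
    have "(\<lambda>p. f (case_prod step (snd (fst p), snd p)) * (if fst (fst p) then 1 else 0)) \<in> borel_measurable (?P \<Otimes>\<^sub>M L)"
      by measurable
    then show ?thesis by (simp add: case_prod_beta')
  qed
  have X [measurable]: "?X \<in> M \<rightarrow>\<^sub>M ?P" by measurable
  have "(\<integral>\<^sup>+\<omega>. f (S (Suc k) \<omega>) * indicator {\<omega>. alive B k \<omega>} \<omega> \<partial>M) = (\<integral>\<^sup>+\<omega>. ?h (?X \<omega>, N k \<omega>) \<partial>M)"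
    by (auto intro!: nn_integral_cong simp: S_Suc split: split_indicator)
  also have "\<dots> = (\<integral>\<^sup>+p. ?h p \<partial>distr M (?P \<Otimes>\<^sub>M L) (\<lambda>\<omega>. (?X \<omega>, N k \<omega>)))"
    by (rule nn_integral_distr[symmetric]) measurable
  also have "\<dots> = (\<integral>\<^sup>+p. ?h p \<partial>(distr M ?P ?X \<Otimes>\<^sub>M L))"
    by (simp only: distr_past[OF B])
  also have "\<dots> = (\<integral>\<^sup>+x. \<integral>\<^sup>+n. ?h (x, n) \<partial>L \<partial>distr M ?P ?X)"
    by (rule L.nn_integral_fst[symmetric]) simp
  also have "\<dots> = (\<integral>\<^sup>+\<omega>. \<integral>\<^sup>+n. ?h (?X \<omega>, n) \<partial>L \<partial>M)"
    using L.borel_measurable_nn_integral_fst[OF h] by (intro nn_integral_distr) simp_all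
  also have "\<dots> = (\<integral>\<^sup>+\<omega>. (\<integral>\<^sup>+n. f (step (S k \<omega>) n) \<partial>L) * indicator {\<omega>. alive B k \<omega>} \<omega> \<partial>M)"
    by (auto intro!: nn_integral_cong split: split_indicator)
  finally show ?thesis .
qed

lemma nn_integral_killed_le:
  fixes f :: "'s \<Rightarrow> ennreal"
  assumes [measurable]: "B \<in> sets borel" "f \<in> borel_measurable borel"
    and "\<And>s. s \<in> B \<Longrightarrow> (\<integral>\<^sup>+n. f (step s n) \<partial>L) \<le> C"
  shows "(\<integral>\<^sup>+\<omega>. f (S (Suc k) \<omega>) * indicator {\<omega>. alive B k \<omega>} \<omega> \<partial>M)
    \<le> C * (\<integral>\<^sup>+\<omega>. indicator {\<omega>. alive B k \<omega>} \<omega> \<partial>M)"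
proof -
  have "(\<integral>\<^sup>+\<omega>. f (S (Suc k) \<omega>) * indicator {\<omega>. alive B k \<omega>} \<omega> \<partial>M)
      \<le> (\<integral>\<^sup>+\<omega>. C * indicator {\<omega>. alive B k \<omega>} \<omega> \<partial>M)"
    unfolding nn_integral_step[OF assms(1,2)]
    by (intro nn_integral_mono) (auto split: split_indicator dest!: alive_in intro!: assms)
  then show ?thesis by (simp add: nn_integral_cmult)
qed

lemma integral_step:
  fixes f :: "'s \<Rightarrow> real"
  assumes B [measurable]: "B \<in> sets borel" and f [measurable]: "f \<in> borel_measurable borel"
    and int: "integrable M (\<lambda>\<omega>. f (S (Suc k) \<omega>) * indicator {\<omega>. alive B k \<omega>} \<omega>)"
  shows "integrable M (\<lambda>\<omega>. (\<integral>n. f (step (S k \<omega>) n) \<partial>L) * indicator {\<omega>. alive B k \<omega>} \<omega>)"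
    "(\<integral>\<omega>. f (S (Suc k) \<omega>) * indicator {\<omega>. alive B k \<omega>} \<omega> \<partial>M)
    = (\<integral>\<omega>. (\<integral>n. f (step (S k \<omega>) n) \<partial>L) * indicator {\<omega>. alive B k \<omega>} \<omega> \<partial>M)"
proof -
  let ?P = "count_space UNIV \<Otimes>\<^sub>M borel :: (bool \<times> 's) measure"
  let ?X = "\<lambda>\<omega>. (alive B k \<omega>, S k \<omega>)"
  let ?h = "\<lambda>p. case p of ((a, s), n) \<Rightarrow> f (step s n) * (if a then 1 else 0)"
  have h [measurable]: "?h \<in> borel_measurable (?P \<Otimes>\<^sub>M L)"
  proof -
    have [measurable]: "(\<lambda>p. case_prod step (snd (fst p), snd p)) \<in> ?P \<Otimes>\<^sub>M L \<rightarrow>\<^sub>M borel" by measurable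
    have "(\<lambda>p. f (case_prod step (snd (fst p), snd p)) * (if fst (fst p) then 1 else 0)) \<in> borel_measurable (?P \<Otimes>\<^sub>M L)"
      by measurable
    then show ?thesis by (simp add: case_prod_beta')
  qed
  have X [measurable]: "?X \<in> M \<rightarrow>\<^sub>M ?P" by measurable
  interpret X: prob_space "distr M ?P ?X" by (rule prob_space_distr) measurable
  interpret XL: pair_sigma_finite "distr M ?P ?X" L ..
  have e1: "(\<lambda>\<omega>. f (S (Suc k) \<omega>) * indicator {\<omega>. alive B k \<omega>} \<omega>) = (\<lambda>\<omega>. ?h (?X \<omega>, N k \<omega>))"
    by (auto simp: S_Suc fun_eq_iff split: split_indicator)
  have i1: "integrable (distr M (?P \<Otimes>\<^sub>M L) (\<lambda>\<omega>. (?X \<omega>, N k \<omega>))) ?h"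
    using int unfolding e1 by (subst integrable_distr_eq) measurable
  then have i2: "integrable (distr M ?P ?X \<Otimes>\<^sub>M L) ?h"
    by (simp only: distr_past[OF B])
  have e2: "(\<lambda>\<omega>. (\<integral>n. f (step (S k \<omega>) n) \<partial>L) * indicator {\<omega>. alive B k \<omega>} \<omega>) = (\<lambda>\<omega>. \<integral>n. ?h (?X \<omega>, n) \<partial>L)"
    by (auto simp: fun_eq_iff split: split_indicator)
  have m: "(\<lambda>x. \<integral>n. ?h (x, n) \<partial>L) \<in> borel_measurable ?P"
    by (rule L.borel_measurable_lebesgue_integral) (use h in \<open>simp add: case_prod_beta'\<close>)
  have "integrable (distr M ?P ?X) (\<lambda>x. \<integral>n. ?h (x, n) \<partial>L)"
    by (rule XL.integrable_fst'[OF i2])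
  then show "integrable M (\<lambda>\<omega>. (\<integral>n. f (step (S k \<omega>) n) \<partial>L) * indicator {\<omega>. alive B k \<omega>} \<omega>)"
    unfolding e2 by (subst (asm) integrable_distr_eq) (use m in measurable)
  have "(\<integral>\<omega>. ?h (?X \<omega>, N k \<omega>) \<partial>M) = (\<integral>p. ?h p \<partial>distr M (?P \<Otimes>\<^sub>M L) (\<lambda>\<omega>. (?X \<omega>, N k \<omega>)))"
    by (rule integral_distr[symmetric]) measurable
  also have "\<dots> = (\<integral>p. ?h p \<partial>(distr M ?P ?X \<Otimes>\<^sub>M L))"
    by (simp only: distr_past[OF B])
  also have "\<dots> = (\<integral>x. \<integral>n. ?h (x, n) \<partial>L \<partial>distr M ?P ?X)"
    by (rule XL.integral_fst'[symmetric, OF i2])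
  also have "\<dots> = (\<integral>\<omega>. \<integral>n. ?h (?X \<omega>, n) \<partial>L \<partial>M)"
    by (rule integral_distr) (use m in measurable)
  finally show "(\<integral>\<omega>. f (S (Suc k) \<omega>) * indicator {\<omega>. alive B k \<omega>} \<omega> \<partial>M)
    = (\<integral>\<omega>. (\<integral>n. f (step (S k \<omega>) n) \<partial>L) * indicator {\<omega>. alive B k \<omega>} \<omega> \<partial>M)"
    unfolding e1 e2 .
qed

text \<open>The mean of \<open>\<Psi>\<close> on the surviving paths loses at least the mean of \<open>r\<close> at every step and stays
  nonnegative.\<close>

lemma sum_killed_le_potential:
  fixes \<Psi> r :: "'s \<Rightarrow> ennreal"
  assumes B [measurable]: "B \<in> sets borel" and [measurable]: "\<Psi> \<in> borel_measurable borel" "r \<in> borel_measurable borel"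
    and "s0 \<in> B"
    and drop: "\<And>s. s \<in> B \<Longrightarrow> (\<integral>\<^sup>+n. \<Psi> (step s n) * indicator B (step s n) \<partial>L) + r s \<le> \<Psi> s"
  shows "(\<Sum>k<n. \<integral>\<^sup>+\<omega>. r (S k \<omega>) * indicator {\<omega>. alive B k \<omega>} \<omega> \<partial>M)
    + (\<integral>\<^sup>+\<omega>. \<Psi> (S n \<omega>) * indicator {\<omega>. alive B n \<omega>} \<omega> \<partial>M) \<le> \<Psi> s0"
proof (induction n)
  case 0
  then show ?case using \<open>s0 \<in> B\<close> by (simp add: S_0 emeasure_space_1)
next
  case (Suc n)
  have "(\<integral>\<^sup>+\<omega>. \<Psi> (S (Suc n) \<omega>) * indicator {\<omega>. alive B (Suc n) \<omega>} \<omega> \<partial>M)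
      = (\<integral>\<^sup>+\<omega>. (\<lambda>s. \<Psi> s * indicator B s) (S (Suc n) \<omega>) * indicator {\<omega>. alive B n \<omega>} \<omega> \<partial>M)"
    by (auto intro!: nn_integral_cong simp: alive_Suc split: split_indicator)
  also have "\<dots> = (\<integral>\<^sup>+\<omega>. (\<integral>\<^sup>+x. \<Psi> (step (S n \<omega>) x) * indicator B (step (S n \<omega>) x) \<partial>L) * indicator {\<omega>. alive B n \<omega>} \<omega> \<partial>M)"
    by (rule nn_integral_step) measurable
  finally have e: "(\<integral>\<^sup>+\<omega>. \<Psi> (S (Suc n) \<omega>) * indicator {\<omega>. alive B (Suc n) \<omega>} \<omega> \<partial>M) = \<dots>" .
  have "(\<integral>\<^sup>+\<omega>. r (S n \<omega>) * indicator {\<omega>. alive B n \<omega>} \<omega> \<partial>M)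
      + (\<integral>\<^sup>+\<omega>. \<Psi> (S (Suc n) \<omega>) * indicator {\<omega>. alive B (Suc n) \<omega>} \<omega> \<partial>M)
    = (\<integral>\<^sup>+\<omega>. r (S n \<omega>) * indicator {\<omega>. alive B n \<omega>} \<omega>
      + (\<integral>\<^sup>+x. \<Psi> (step (S n \<omega>) x) * indicator B (step (S n \<omega>) x) \<partial>L) * indicator {\<omega>. alive B n \<omega>} \<omega> \<partial>M)"
    unfolding e
  proof (rule nn_integral_add[symmetric])
    have "(\<lambda>p. \<Psi> (case_prod step p) * indicator B (case_prod step p)) \<in> borel_measurable (borel \<Otimes>\<^sub>M L)" by measurable
    then have [measurable]: "(\<lambda>s. \<integral>\<^sup>+x. \<Psi> (step s x) * indicator B (step s x) \<partial>L) \<in> borel_measurable borel"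
      using L.borel_measurable_nn_integral_fst[of "\<lambda>p. \<Psi> (case_prod step p) * indicator B (case_prod step p)" borel] by simp
    show "(\<lambda>\<omega>. (\<integral>\<^sup>+x. \<Psi> (step (S n \<omega>) x) * indicator B (step (S n \<omega>) x) \<partial>L) * indicator {\<omega>. alive B n \<omega>} \<omega>) \<in> borel_measurable M"
      by measurable
  qed measurable
  also have "\<dots> \<le> (\<integral>\<^sup>+\<omega>. \<Psi> (S n \<omega>) * indicator {\<omega>. alive B n \<omega>} \<omega> \<partial>M)"
    by (intro nn_integral_mono) (auto split: split_indicator dest!: alive_in drop simp: add.commute)
  finally show ?case
    using Suc by (simp add: add.assoc) (meson add_left_mono order_trans)
qed

text \<open>Telescoping along the killed chain.  The potential \<open>\<Psi>\<close> pays for the one-step defect \<open>r\<close> of \<open>V\<close>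
  at every step spent in \<open>B\<close>; as \<open>r\<close> is bounded away from \<open>0\<close>, it also bounds the expected number of
  such steps, which makes the exit time finite and provides an integrable majorant.\<close>

theorem killed_chain_defect:
  fixes V \<Psi> r :: "'s \<Rightarrow> real"
  assumes B [measurable]: "B \<in> sets borel" and V [measurable]: "V \<in> borel_measurable borel"
    and [measurable]: "\<Psi> \<in> borel_measurable borel" "r \<in> borel_measurable borel" and "s0 \<in> B"
    and nonneg: "\<And>s. s \<in> B \<Longrightarrow> 0 \<le> \<Psi> s" and r0: "0 < r0" "\<And>s. s \<in> B \<Longrightarrow> r0 \<le> r s"
    and drop: "\<And>s. s \<in> B \<Longrightarrow> (\<integral>\<^sup>+n. ennreal (\<Psi> (step s n)) * indicator B (step s n) \<partial>L) + ennreal (r s) \<le> ennreal (\<Psi> s)"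
    and VB: "\<And>s. s \<in> B \<Longrightarrow> \<bar>V s\<bar> \<le> C"
    and PV: "\<And>s. s \<in> B \<Longrightarrow> (\<integral>\<^sup>+n. ennreal \<bar>V (step s n)\<bar> \<partial>L) \<le> ennreal C"
    and defect: "\<And>s. s \<in> B \<Longrightarrow> \<bar>(\<integral>n. V (step s n) \<partial>L) - V s\<bar> \<le> r s"
  defines "\<kappa> \<equiv> \<lambda>\<omega>. LEAST k. S k \<omega> \<notin> B"
  shows "AE \<omega> in M. S (\<kappa> \<omega>) \<omega> \<notin> B" (is ?exits)
    and "integrable M (\<lambda>\<omega>. V (S (\<kappa> \<omega>) \<omega>))" (is ?int)
    and "\<bar>(\<integral>\<omega>. V (S (\<kappa> \<omega>) \<omega>) \<partial>M) - V s0\<bar> \<le> \<Psi> s0" (is ?bound)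
proof -
  define A where "A k \<omega> = (indicator {\<omega>. alive B k \<omega>} \<omega> :: ennreal)" for k \<omega>
  define R where "R k \<omega> = (indicator {\<omega>. alive B k \<omega>} \<omega> :: real)" for k \<omega>
  have AR: "A k \<omega> = ennreal (R k \<omega>)" for k \<omega> by (auto simp: A_def R_def split: split_indicator)
  have [measurable]: "A k \<in> borel_measurable M" "R k \<in> borel_measurable M" for k
    unfolding A_def[abs_def] R_def[abs_def] by measurable
  have R_le: "0 \<le> R k \<omega>" "R k \<omega> \<le> 1" for k \<omega> by (auto simp: R_def split: split_indicator)
  have C0: "0 \<le> C" using VB[OF \<open>s0 \<in> B\<close>] by linarith
  have r_nonneg: "0 \<le> r s" if "s \<in> B" for s using r0(1) r0(2)[OF that] by linarith
  have pot: "(\<Sum>k<n. \<integral>\<^sup>+\<omega>. ennreal (r (S k \<omega>)) * A k \<omega> \<partial>M) \<le> ennreal (\<Psi> s0)" for n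
    using sum_killed_le_potential[of B "\<lambda>s. ennreal (\<Psi> s)" "\<lambda>s. ennreal (r s)" n] drop \<open>s0 \<in> B\<close>
    unfolding A_def by (simp add: order_trans[OF add_increasing2[OF zero_le order_refl]])
  have time: "(\<Sum>k<n. \<integral>\<^sup>+\<omega>. A k \<omega> \<partial>M) \<le> ennreal (\<Psi> s0 / r0)" for n
  proof -
    have "ennreal r0 * (\<Sum>k<n. \<integral>\<^sup>+\<omega>. A k \<omega> \<partial>M) = (\<Sum>k<n. \<integral>\<^sup>+\<omega>. ennreal r0 * A k \<omega> \<partial>M)"
      by (simp add: sum_distrib_left nn_integral_cmult)
    also have "\<dots> \<le> (\<Sum>k<n. \<integral>\<^sup>+\<omega>. ennreal (r (S k \<omega>)) * A k \<omega> \<partial>M)"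
      by (intro sum_mono nn_integral_mono)
         (auto simp: A_def split: split_indicator dest!: alive_in intro!: ennreal_leI r0)
    also have "\<dots> \<le> ennreal (\<Psi> s0)" by (rule pot)
    finally have "ennreal r0 * (\<Sum>k<n. \<integral>\<^sup>+\<omega>. A k \<omega> \<partial>M) \<le> ennreal r0 * ennreal (\<Psi> s0 / r0)"
      using r0(1) nonneg[OF \<open>s0 \<in> B\<close>] by (simp add: ennreal_mult[symmetric])
    then show ?thesis using r0(1) by (subst (asm) ennreal_mult_le_mult_iff) auto
  qed
  \<comment> \<open>The sum of the survival flags is the exit time.\<close>
  have total: "(\<integral>\<^sup>+\<omega>. (\<Sum>k. A k \<omega>) \<partial>M) \<le> ennreal (\<Psi> s0 / r0)"
    using time by (subst nn_integral_suminf) (auto intro!: suminf_le_const summableI simp: ennreal_suminf_bound_add)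
  have "AE \<omega> in M. (\<Sum>k. A k \<omega>) \<noteq> \<infinity>"
    using total by (intro nn_integral_PInf_AE) (auto simp: top_unique)
  then have dies: "AE \<omega> in M. \<exists>k. \<not> alive B k \<omega>"
  proof eventually_elim
    case (elim \<omega>)
    show ?case
    proof (rule ccontr)
      assume "\<nexists>k. \<not> alive B k \<omega>"
      then have "A k \<omega> = 1" for k by (simp add: A_def)
      then have "of_nat n \<le> (\<Sum>k. A k \<omega>)" for n
        using sum_le_suminf[of "\<lambda>k. A k \<omega>" "{..<n}"] by (simp add: summableI)
      with elim show False
        using ennreal_Ex_less_of_nat[of "\<Sum>k. A k \<omega>"] by (auto simp: less_top[symmetric] not_less[symmetric])
    qed
  qed
  show ?exits
    using dies
  proof eventually_elim
    case (elim \<omega>)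
    then obtain k where "S k \<omega> \<notin> B" by (auto simp: alive_def)
    then show ?case unfolding \<kappa>_def by (rule LeastI)
  qed
  have alive_iff: "alive B k \<omega> \<longleftrightarrow> k < \<kappa> \<omega>" if "\<exists>k. \<not> alive B k \<omega>" for k \<omega>
  proof -
    from that obtain j where "S j \<omega> \<notin> B" by (auto simp: alive_def)
    then have a: "S (\<kappa> \<omega>) \<omega> \<notin> B" unfolding \<kappa>_def by (rule LeastI)
    have b: "S i \<omega> \<in> B" if "i < \<kappa> \<omega>" for i
      using not_less_Least[of i "\<lambda>k. S k \<omega> \<notin> B"] that unfolding \<kappa>_def by blast
    show ?thesis unfolding alive_def
    proof
      assume "\<forall>j\<le>k. S j \<omega> \<in> B"
      then show "k < \<kappa> \<omega>" using a not_less by blast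
    next
      assume "k < \<kappa> \<omega>"
      then show "\<forall>j\<le>k. S j \<omega> \<in> B" using b le_less_trans by blast
    qed
  qed
  define W where "W k \<omega> = (V (S (Suc k) \<omega>) - V (S k \<omega>)) * R k \<omega>" for k \<omega>
  define D where "D \<omega> = (\<Sum>k. ennreal (\<bar>V (S (Suc k) \<omega>)\<bar> + \<bar>V (S k \<omega>)\<bar>) * A k \<omega>)" for \<omega>
  have VS [measurable]: "(\<lambda>\<omega>. V (S k \<omega>)) \<in> borel_measurable M" for k
    by (rule measurable_compose[OF S_measurable V])
  have [measurable]: "W k \<in> borel_measurable M" for k
    unfolding W_def[abs_def] by (intro borel_measurable_times borel_measurable_diff VS) measurable
  have Dk: "(\<integral>\<^sup>+\<omega>. ennreal (\<bar>V (S (Suc k) \<omega>)\<bar> + \<bar>V (S k \<omega>)\<bar>) * A k \<omega> \<partial>M) \<le> ennreal (2 * C) * (\<integral>\<^sup>+\<omega>. A k \<omega> \<partial>M)" for k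
  proof -
    have "(\<integral>\<^sup>+\<omega>. ennreal (\<bar>V (S (Suc k) \<omega>)\<bar> + \<bar>V (S k \<omega>)\<bar>) * A k \<omega> \<partial>M)
      = (\<integral>\<^sup>+\<omega>. ennreal \<bar>V (S (Suc k) \<omega>)\<bar> * A k \<omega> + ennreal \<bar>V (S k \<omega>)\<bar> * A k \<omega> \<partial>M)"
      by (simp add: distrib_right ennreal_plus)
    also have "\<dots> = (\<integral>\<^sup>+\<omega>. ennreal \<bar>V (S (Suc k) \<omega>)\<bar> * A k \<omega> \<partial>M) + (\<integral>\<^sup>+\<omega>. ennreal \<bar>V (S k \<omega>)\<bar> * A k \<omega> \<partial>M)"
      by (rule nn_integral_add) measurable
    also have "\<dots> \<le> ennreal C * (\<integral>\<^sup>+\<omega>. A k \<omega> \<partial>M) + ennreal C * (\<integral>\<^sup>+\<omega>. A k \<omega> \<partial>M)"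
    proof (rule add_mono)
      show "(\<integral>\<^sup>+\<omega>. ennreal \<bar>V (S (Suc k) \<omega>)\<bar> * A k \<omega> \<partial>M) \<le> ennreal C * (\<integral>\<^sup>+\<omega>. A k \<omega> \<partial>M)"
        unfolding A_def using nn_integral_killed_le[of B "\<lambda>s. ennreal \<bar>V s\<bar>" "ennreal C" k] PV by simp
      have "(\<integral>\<^sup>+\<omega>. ennreal \<bar>V (S k \<omega>)\<bar> * A k \<omega> \<partial>M) \<le> (\<integral>\<^sup>+\<omega>. ennreal C * A k \<omega> \<partial>M)"
        by (intro nn_integral_mono) (auto simp: A_def split: split_indicator dest!: alive_in intro!: ennreal_leI VB)
      then show "(\<integral>\<^sup>+\<omega>. ennreal \<bar>V (S k \<omega>)\<bar> * A k \<omega> \<partial>M) \<le> ennreal C * (\<integral>\<^sup>+\<omega>. A k \<omega> \<partial>M)"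
        by (simp add: nn_integral_cmult)
    qed
    also have "\<dots> = ennreal (2 * C) * (\<integral>\<^sup>+\<omega>. A k \<omega> \<partial>M)"
      using C0 by (simp add: distrib_right[symmetric] ennreal_plus[symmetric] del: ennreal_plus)
    finally show ?thesis .
  qed
  have Dm [measurable]: "D \<in> borel_measurable M" unfolding D_def[abs_def] by measurable
  have Dint: "(\<integral>\<^sup>+\<omega>. D \<omega> \<partial>M) \<le> ennreal (2 * C) * ennreal (\<Psi> s0 / r0)"
  proof -
    have "(\<integral>\<^sup>+\<omega>. D \<omega> \<partial>M) = (\<Sum>k. \<integral>\<^sup>+\<omega>. ennreal (\<bar>V (S (Suc k) \<omega>)\<bar> + \<bar>V (S k \<omega>)\<bar>) * A k \<omega> \<partial>M)"
      unfolding D_def by (rule nn_integral_suminf) measurable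
    also have "\<dots> \<le> (\<Sum>k. ennreal (2 * C) * (\<integral>\<^sup>+\<omega>. A k \<omega> \<partial>M))"
      by (intro suminf_le Dk summableI)
    also have "\<dots> = ennreal (2 * C) * (\<integral>\<^sup>+\<omega>. (\<Sum>k. A k \<omega>) \<partial>M)"
      by (simp add: ennreal_suminf_cmult nn_integral_suminf)
    also have "\<dots> \<le> ennreal (2 * C) * ennreal (\<Psi> s0 / r0)" by (intro mult_left_mono total) simp
    finally show ?thesis .
  qed
  then have Dfin: "AE \<omega> in M. D \<omega> \<noteq> \<infinity>"
    by (intro nn_integral_PInf_AE) (auto simp: ennreal_mult[symmetric] top_unique ennreal_mult_eq_top_iff)
  define d where "d \<omega> = enn2real (D \<omega>)" for \<omega>
  have [measurable]: "d \<in> borel_measurable M" unfolding d_def[abs_def] by measurable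
  have d_int: "integrable M d"
  proof (rule integrableI_nonneg)
    have "(\<integral>\<^sup>+\<omega>. ennreal (d \<omega>) \<partial>M) = (\<integral>\<^sup>+\<omega>. D \<omega> \<partial>M)"
      using Dfin by (intro nn_integral_cong_AE) (auto simp: d_def less_top)
    then show "(\<integral>\<^sup>+\<omega>. ennreal (d \<omega>) \<partial>M) < \<infinity>"
      using Dint by (auto simp: ennreal_mult_less_top intro: le_less_trans)
  qed (auto simp: d_def)
  have W_le: "\<bar>W k \<omega>\<bar> \<le> (\<bar>V (S (Suc k) \<omega>)\<bar> + \<bar>V (S k \<omega>)\<bar>) * R k \<omega>" for k \<omega>
    using R_le[of k \<omega>] by (simp add: W_def abs_mult mult_right_mono abs_triangle_ineq4)
  have sum_le_d: "(\<Sum>k<n. \<bar>W k \<omega>\<bar>) \<le> d \<omega>" if "D \<omega> \<noteq> \<infinity>" for n \<omega>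
  proof -
    have "ennreal (\<Sum>k<n. \<bar>W k \<omega>\<bar>) \<le> (\<Sum>k<n. ennreal (\<bar>V (S (Suc k) \<omega>)\<bar> + \<bar>V (S k \<omega>)\<bar>) * A k \<omega>)"
      unfolding sum_ennreal[symmetric, OF abs_ge_zero] AR
    proof (rule sum_mono)
      fix k
      have "ennreal \<bar>W k \<omega>\<bar> \<le> ennreal ((\<bar>V (S (Suc k) \<omega>)\<bar> + \<bar>V (S k \<omega>)\<bar>) * R k \<omega>)"
        by (rule ennreal_leI[OF W_le])
      then show "ennreal \<bar>W k \<omega>\<bar> \<le> ennreal (\<bar>V (S (Suc k) \<omega>)\<bar> + \<bar>V (S k \<omega>)\<bar>) * ennreal (R k \<omega>)"
        using R_le[of k \<omega>] by (simp add: ennreal_mult del: ennreal_plus)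
    qed
    also have "\<dots> \<le> D \<omega>" unfolding D_def by (intro sum_le_suminf summableI) auto
    also have "\<dots> = ennreal (d \<omega>)" using that by (simp add: d_def less_top)
    finally show ?thesis by (simp add: d_def)
  qed
  have Wint: "integrable M (W k)" for k
  proof (rule Bochner_Integration.integrable_bound[OF d_int])
    show "AE \<omega> in M. norm (W k \<omega>) \<le> norm (d \<omega>)"
      using Dfin
    proof eventually_elim
      case (elim \<omega>)
      have "\<bar>W k \<omega>\<bar> \<le> (\<Sum>j<Suc k. \<bar>W j \<omega>\<bar>)" by (simp add: sum_nonneg)
      also have "\<dots> \<le> d \<omega>" by (rule sum_le_d[OF elim])
      finally show ?case by simp
    qed
  qed simp
  have EW: "\<bar>\<integral>\<omega>. W k \<omega> \<partial>M\<bar> \<le> (\<integral>\<omega>. r (S k \<omega>) * R k \<omega> \<partial>M)"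
    and rint: "integrable M (\<lambda>\<omega>. r (S k \<omega>) * R k \<omega>)" for k
  proof -
    have b: "AE \<omega> in M. norm (V (S k \<omega>) * R k \<omega>) \<le> C"
      using VB C0 by (auto simp: R_def split: split_indicator dest!: alive_in)
    have i0: "integrable M (\<lambda>\<omega>. V (S k \<omega>) * R k \<omega>)"
      by (rule integrable_const_bound[OF b]) measurable
    have i1: "integrable M (\<lambda>\<omega>. V (S (Suc k) \<omega>) * R k \<omega>)"
      using Bochner_Integration.integrable_add[OF Wint[of k] i0] by (simp add: W_def algebra_simps)
    note i2 = integral_step[OF B V i1[unfolded R_def]]
    have fin: "(\<integral>\<^sup>+\<omega>. ennreal (r (S k \<omega>)) * A k \<omega> \<partial>M) \<le> ennreal (\<Psi> s0)"
      using order_trans[OF member_le_sum[of k "{..<Suc k}" "\<lambda>k. \<integral>\<^sup>+\<omega>. ennreal (r (S k \<omega>)) * A k \<omega> \<partial>M"] pot[of "Suc k"]] by simp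
    show rint: "integrable M (\<lambda>\<omega>. r (S k \<omega>) * R k \<omega>)"
    proof (rule integrableI_nonneg)
      have "(\<integral>\<^sup>+\<omega>. ennreal (r (S k \<omega>) * R k \<omega>) \<partial>M) = (\<integral>\<^sup>+\<omega>. ennreal (r (S k \<omega>)) * A k \<omega> \<partial>M)"
        by (intro nn_integral_cong) (auto simp: A_def R_def split: split_indicator)
      then show "(\<integral>\<^sup>+\<omega>. ennreal (r (S k \<omega>) * R k \<omega>) \<partial>M) < \<infinity>"
        using fin by (auto intro: le_less_trans)
      show "AE \<omega> in M. 0 \<le> r (S k \<omega>) * R k \<omega>"
        using r_nonneg by (auto simp: R_def split: split_indicator dest!: alive_in)
    qed measurable
    have "(\<integral>\<omega>. W k \<omega> \<partial>M) = (\<integral>\<omega>. V (S (Suc k) \<omega>) * R k \<omega> \<partial>M) - (\<integral>\<omega>. V (S k \<omega>) * R k \<omega> \<partial>M)"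
      unfolding W_def left_diff_distrib using i1 i0 by (rule Bochner_Integration.integral_diff)
    also have "\<dots> = (\<integral>\<omega>. (\<integral>n. V (step (S k \<omega>) n) \<partial>L) * R k \<omega> \<partial>M) - (\<integral>\<omega>. V (S k \<omega>) * R k \<omega> \<partial>M)"
      unfolding R_def i2(2) ..
    also have "\<dots> = (\<integral>\<omega>. ((\<integral>n. V (step (S k \<omega>) n) \<partial>L) - V (S k \<omega>)) * R k \<omega> \<partial>M)"
      unfolding left_diff_distrib using i2(1) i0 unfolding R_def by (rule Bochner_Integration.integral_diff[symmetric])
    also have "\<bar>\<dots>\<bar> \<le> (\<integral>\<omega>. r (S k \<omega>) * R k \<omega> \<partial>M)"
    proof (rule order_trans[OF integral_abs_bound] integral_mono)+
      show "integrable M (\<lambda>\<omega>. \<bar>((\<integral>n. V (step (S k \<omega>) n) \<partial>L) - V (S k \<omega>)) * R k \<omega>\<bar>)"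
        unfolding left_diff_distrib using i2(1) i0 unfolding R_def by (intro integrable_abs Bochner_Integration.integrable_diff)
      show "integrable M (\<lambda>\<omega>. r (S k \<omega>) * R k \<omega>)" by (rule rint)
      show "\<bar>((\<integral>n. V (step (S k \<omega>) n) \<partial>L) - V (S k \<omega>)) * R k \<omega>\<bar> \<le> r (S k \<omega>) * R k \<omega>" for \<omega>
        using defect by (auto simp: R_def split: split_indicator dest!: alive_in)
    qed
    finally show "\<bar>\<integral>\<omega>. W k \<omega> \<partial>M\<bar> \<le> (\<integral>\<omega>. r (S k \<omega>) * R k \<omega> \<partial>M)" .
  qed
  \<comment> \<open>The increments stopped at the exit telescope; \<open>d\<close> dominates all their partial sums.\<close>
  have part: "\<bar>\<integral>\<omega>. (\<Sum>k<n. W k \<omega>) \<partial>M\<bar> \<le> \<Psi> s0" for n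
  proof -
    have "\<bar>\<integral>\<omega>. (\<Sum>k<n. W k \<omega>) \<partial>M\<bar> = \<bar>\<Sum>k<n. \<integral>\<omega>. W k \<omega> \<partial>M\<bar>"
      by (simp add: Bochner_Integration.integral_sum Wint)
    also have "\<dots> \<le> (\<Sum>k<n. \<integral>\<omega>. r (S k \<omega>) * R k \<omega> \<partial>M)"
      by (rule order_trans[OF sum_abs sum_mono]) (rule EW)
    finally have *: "\<bar>\<integral>\<omega>. (\<Sum>k<n. W k \<omega>) \<partial>M\<bar> \<le> (\<Sum>k<n. \<integral>\<omega>. r (S k \<omega>) * R k \<omega> \<partial>M)" .
    have nn: "0 \<le> r (S k \<omega>) * R k \<omega>" for k \<omega>
      using r_nonneg by (auto simp: R_def split: split_indicator dest!: alive_in)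
    have "ennreal (\<Sum>k<n. \<integral>\<omega>. r (S k \<omega>) * R k \<omega> \<partial>M) = (\<Sum>k<n. ennreal (\<integral>\<omega>. r (S k \<omega>) * R k \<omega> \<partial>M))"
      by (rule sum_ennreal[symmetric]) (simp add: nn)
    also have "\<dots> = (\<Sum>k<n. \<integral>\<^sup>+\<omega>. ennreal (r (S k \<omega>) * R k \<omega>) \<partial>M)"
      by (intro sum.cong refl nn_integral_eq_integral[symmetric] rint AE_I2 nn)
    also have "\<dots> = (\<Sum>k<n. \<integral>\<^sup>+\<omega>. ennreal (r (S k \<omega>)) * A k \<omega> \<partial>M)"
      by (intro sum.cong refl nn_integral_cong) (auto simp: A_def R_def split: split_indicator)
    also have "\<dots> \<le> ennreal (\<Psi> s0)" by (rule pot)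
    finally show ?thesis using * nonneg[OF \<open>s0 \<in> B\<close>] by simp
  qed
  have tele: "(\<Sum>k<n. W k \<omega>) = V (S (min n (\<kappa> \<omega>)) \<omega>) - V s0" if "\<exists>k. \<not> alive B k \<omega>" for n \<omega>
  proof (induction n)
    case (Suc n)
    then show ?case using alive_iff[OF that, of n]
      by (cases "n < \<kappa> \<omega>") (auto simp: W_def R_def min_def not_less split: split_indicator)
  qed (simp add: S_0)
  have \<kappa>m [measurable]: "\<kappa> \<in> M \<rightarrow>\<^sub>M count_space UNIV" unfolding \<kappa>_def by measurable
  have Vm: "(\<lambda>\<omega>. V (S (\<kappa> \<omega>) \<omega>)) \<in> borel_measurable M"
    using measurable_compose_countable[of "\<lambda>k \<omega>. V (S k \<omega>)" M borel \<kappa>] by measurable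
  have lim: "AE \<omega> in M. (\<lambda>n. \<Sum>k<n. W k \<omega>) \<longlonglongrightarrow> V (S (\<kappa> \<omega>) \<omega>) - V s0"
    using dies
  proof eventually_elim
    case (elim \<omega>)
    have "eventually (\<lambda>n. (\<Sum>k<n. W k \<omega>) = V (S (\<kappa> \<omega>) \<omega>) - V s0) sequentially"
      using eventually_ge_at_top[of "\<kappa> \<omega>"] by eventually_elim (simp add: tele[OF elim] min_def)
    then show ?case by (rule tendsto_eventually)
  qed
  have dom: "AE \<omega> in M. norm (\<Sum>k<n. W k \<omega>) \<le> d \<omega>" for n
    using Dfin
  proof eventually_elim
    case (elim \<omega>)
    then show ?case using order_trans[OF sum_abs sum_le_d[OF elim]] by (simp add: real_norm_def)
  qed
  have m1: "(\<lambda>\<omega>. V (S (\<kappa> \<omega>) \<omega>) - V s0) \<in> borel_measurable M" using Vm by measurable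
  have m2: "(\<lambda>\<omega>. \<Sum>k<n. W k \<omega>) \<in> borel_measurable M" for n by measurable
  note dc = m1 m2 d_int lim dom
  have i: "integrable M (\<lambda>\<omega>. V (S (\<kappa> \<omega>) \<omega>) - V s0)"
    by (rule integrable_dominated_convergence[OF dc])
  then show i': ?int using Bochner_Integration.integrable_add[OF i, of "\<lambda>_. V s0"] by simp
  have "(\<lambda>n. \<integral>\<omega>. (\<Sum>k<n. W k \<omega>) \<partial>M) \<longlonglongrightarrow> (\<integral>\<omega>. V (S (\<kappa> \<omega>) \<omega>) - V s0 \<partial>M)"
    by (rule integral_dominated_convergence[OF dc])
  then have "\<bar>\<integral>\<omega>. V (S (\<kappa> \<omega>) \<omega>) - V s0 \<partial>M\<bar> \<le> \<Psi> s0"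
    using part by (intro LIMSEQ_le_const2[OF tendsto_rabs]) auto
  then show ?bound using i' by (simp add: prob_space)
qed

end

section \<open>Taylor expansion of one step\<close>

lemma jump_op_shift: "jump_op \<nu> e F (\<lambda>y. w (y + v)) y = jump_op \<nu> e F w (y + v)"
  by (simp add: jump_op_def add_ac)

lemma jump_op_cmult: "jump_op \<nu> e F (\<lambda>y. r * w y) y = r * jump_op \<nu> e F w y"
  unfolding jump_op_def by (simp add: right_diff_distrib[symmetric])

lemma half_sum_bound:
  fixes a b c e :: real
  shows "\<bar>a + b - 2 * c\<bar> \<le> X \<Longrightarrow> \<bar>c - e\<bar> \<le> Y \<Longrightarrow> \<bar>(a + b) / 2 - e\<bar> \<le> X + Y"
  by argo

lemma half_sum_bound3:
  fixes a b c e :: real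
  shows "\<bar>a + b - 2 * c - D\<bar> \<le> X \<Longrightarrow> \<bar>c - e - m\<bar> \<le> Y \<Longrightarrow> \<bar>D - D'\<bar> \<le> Z \<Longrightarrow>
    \<bar>(a + b) / 2 - (e + m + D' / 2)\<bar> \<le> X + Y + Z"
  by argo

lemma half_sum_abs: "\<bar>a\<bar> \<le> X \<Longrightarrow> \<bar>b\<bar> \<le> X \<Longrightarrow> \<bar>(a + b) / 2\<bar> \<le> X" for a b :: real
  by argo

text \<open>One step from \<open>x\<close> with fixed duration \<open>\<theta>\<close> and fixed signs; \<open>S\<close> is the combined noise
  \<open>\<sigma> \<xi> + F \<beta> \<eta>\<close>.  All data are bounded by one constant \<open>R\<close> except the drift correction, which is of
  the order of the intensity \<open>lam\<close>; accordingly the remainders below carry explicit powers of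
  \<open>g = 1 + |\<gamma>|\<close> and of \<open>L = 1 + lam \<theta>\<close>, and constants that depend on \<open>n\<close>, \<open>R\<close>, the dimension and, with jumps,
  a moment of the Levy measure only.\<close>

locale euler_step =
  fixes n :: nat and R lam \<theta> :: real and x b S :: "real ^ 'd" and F :: "real ^ 'm ^ 'd" and \<gamma> :: "real ^ 'm"
  assumes R: "1 \<le> R" and lam: "0 \<le> lam" and \<theta>: "0 \<le> \<theta>" "\<theta> \<le> R"
    and x: "norm x \<le> R" and b: "norm b \<le> R" and S: "norm S \<le> R" and F: "norm F \<le> R"
    and \<gamma>: "norm \<gamma> \<le> R * lam"
begin

definition "\<mu> = b - F *v \<gamma>"
definition "s = sqrt \<theta> *\<^sub>R S"
definition "p = x + \<theta> *\<^sub>R \<mu>"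
definition "g = 1 + norm \<gamma>"
definition "L = 1 + lam * \<theta>"
text \<open>At every point that the step can reach before the jump, the weight is at most a power of
  \<open>c1 L\<close>.\<close>

definition "c1 = 2 * R\<^sup>2"

lemma g1: "1 \<le> g" by (simp add: g_def)

lemma L1: "1 \<le> L" using lam \<theta> by (simp add: L_def)

lemma R_sq: "R \<le> R\<^sup>2" "1 \<le> R\<^sup>2"
  using R mult_left_mono[of 1 R R] one_le_power[of R 2] by (auto simp: power2_eq_square)

lemma c1_double: "c1 ^ (2 * k) = c1 ^ k * c1 ^ k"
  by (metis mult_2 power_add)

lemma c1: "1 \<le> c1" "0 \<le> c1" using R_sq by (auto simp: c1_def)

lemma norm_\<mu>: "norm \<mu> \<le> R * g"
proof -
  have "norm (F *v \<gamma>) \<le> R * norm \<gamma>"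
    using norm_matrix_vector_le[of F \<gamma>] mult_right_mono[OF F norm_ge_zero[of \<gamma>]] by linarith
  then show ?thesis using norm_triangle_ineq4[of b "F *v \<gamma>"] b by (simp add: \<mu>_def g_def algebra_simps)
qed

lemma norm_\<theta>\<mu>: "norm (\<theta> *\<^sub>R \<mu>) \<le> \<theta> * (R * g)"
  using mult_left_mono[OF norm_\<mu> \<theta>(1)] \<theta>(1) by simp

lemma weight_\<theta>\<mu>: "(1 + norm (\<theta> *\<^sub>R \<mu>)) ^ k \<le> c1 ^ k * L ^ k"
proof -
  have "\<theta> * (R * g) \<le> \<theta> * (R * (1 + R * lam))"
    using \<theta> R \<gamma> by (intro mult_left_mono) (auto simp: g_def)
  also have "\<dots> = R * \<theta> + R\<^sup>2 * (lam * \<theta>)" by (simp add: algebra_simps power2_eq_square)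
  also have "\<dots> \<le> R\<^sup>2 * L"
    using mult_left_mono[OF \<theta>(2), of R] R by (simp add: L_def algebra_simps power2_eq_square)
  finally have "norm (\<theta> *\<^sub>R \<mu>) \<le> R\<^sup>2 * L" using norm_\<theta>\<mu> by linarith
  moreover have "1 \<le> R\<^sup>2 * L" using R_sq(2) L1 mult_mono[of 1 "R\<^sup>2" 1 L] by simp
  ultimately have "1 + norm (\<theta> *\<^sub>R \<mu>) \<le> c1 * L" by (simp add: c1_def)
  then show ?thesis unfolding power_mult_distrib[symmetric] by (intro power_mono) auto
qed

lemma norm_s: "(norm s)\<^sup>2 \<le> \<theta> * R\<^sup>2" "norm s ^ 4 \<le> \<theta>\<^sup>2 * R ^ 4"
proof -
  have "(norm s)\<^sup>2 = \<theta> * (norm S)\<^sup>2" using \<theta> by (simp add: s_def power_mult_distrib)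
  then show 1: "(norm s)\<^sup>2 \<le> \<theta> * R\<^sup>2" using \<theta> S by (simp add: mult_left_mono power_mono)
  have "norm s ^ 4 = ((norm s)\<^sup>2)\<^sup>2" by simp
  also have "\<dots> \<le> (\<theta> * R\<^sup>2)\<^sup>2" by (intro power_mono 1) simp
  finally show "norm s ^ 4 \<le> \<theta>\<^sup>2 * R ^ 4" by (simp add: power_mult_distrib)
qed

lemma weight_s: "(1 + norm s) ^ k \<le> c1 ^ k"
proof -
  have "(norm s)\<^sup>2 \<le> (R\<^sup>2)\<^sup>2"
  proof -
    have "\<theta> * R\<^sup>2 \<le> R\<^sup>2 * R\<^sup>2" using \<theta> R_sq by (intro mult_right_mono) auto
    then show ?thesis using norm_s(1) by (simp add: power2_eq_square)
  qed
  then have "norm s \<le> R\<^sup>2" by (rule power2_le_imp_le) simp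
  then have "1 + norm s \<le> c1" using R_sq by (simp add: c1_def)
  then show ?thesis by (intro power_mono) auto
qed

lemma weight_x: "(1 + norm x) ^ k \<le> c1 ^ k"
  using x R_sq R by (intro power_mono) (auto simp: c1_def)

lemma weight_p: "(1 + norm p) ^ k \<le> c1 ^ (2 * k) * L ^ k"
proof -
  have "(1 + norm p) ^ k \<le> (1 + norm x) ^ k * (1 + norm (\<theta> *\<^sub>R \<mu>)) ^ k"
    unfolding p_def by (rule weight_add_le)
  also have "\<dots> \<le> c1 ^ k * (c1 ^ k * L ^ k)"
    using c1 by (intro mult_mono weight_x weight_\<theta>\<mu>) auto
  finally show ?thesis unfolding c1_double by (simp add: mult_ac)
qed

lemma weight_ps: "(1 + norm (p + s)) ^ k \<le> c1 ^ (3 * k) * L ^ k" "(1 + norm (p - s)) ^ k \<le> c1 ^ (3 * k) * L ^ k"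
proof -
  have e: "c1 ^ (2 * k) * L ^ k * c1 ^ k = c1 ^ (3 * k) * L ^ k"
    by (simp add: power_add[symmetric] mult_ac)
  have "(1 + norm p) ^ k * (1 + norm s) ^ k \<le> c1 ^ (2 * k) * L ^ k * c1 ^ k"
    using c1 L1 by (intro mult_mono weight_p weight_s) auto
  then have *: "(1 + norm p) ^ k * (1 + norm s) ^ k \<le> c1 ^ (3 * k) * L ^ k" by (simp only: e)
  show "(1 + norm (p + s)) ^ k \<le> c1 ^ (3 * k) * L ^ k" using weight_add_le[of p s k] * by linarith
  show "(1 + norm (p - s)) ^ k \<le> c1 ^ (3 * k) * L ^ k" using weight_add_le[of p "- s" k] * by simp
qed

lemma L_nonneg: "0 \<le> L ^ k" using L1 by simp

definition "d = real CARD('d)"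
definition "cA = d\<^sup>2 * R\<^sup>2 * c1 ^ (5 * n) + d * R * c1 ^ (2 * n)"

lemma d0: "0 \<le> d" by (simp add: d_def)

lemma increment_\<mu>:
  assumes "smooth_wt n (Suc k) A w"
  shows "\<bar>w p - w x\<bar> \<le> d * R * c1 ^ (2 * n) * A * \<theta> * g * L ^ n"
proof -
  note A = smooth_wt_nonneg[OF assms]
  have "\<bar>w p - w x\<bar> \<le> d * norm (\<theta> *\<^sub>R \<mu>) * A * (1 + norm (\<theta> *\<^sub>R \<mu>)) ^ n * (1 + norm x) ^ n"
    unfolding p_def d_def by (rule smooth_wt_increment[OF assms])
  also have "\<dots> \<le> d * (\<theta> * (R * g)) * A * (c1 ^ n * L ^ n) * c1 ^ n"
    using A d0 c1 L_nonneg \<theta> R g1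
    by (intro mult_mono mult_right_mono mult_left_mono norm_\<theta>\<mu> weight_\<theta>\<mu> weight_x mult_nonneg_nonneg) auto
  finally show ?thesis unfolding c1_double by (simp add: mult_ac)
qed

text \<open>The odd moments of the noise vanish, so that the mean of a symmetric pair of steps moves by
  \<open>O(\<theta>)\<close> only, although each step has length of order \<open>sqrt \<theta>\<close>.\<close>

lemma symmetric_increment:
  assumes "smooth_wt n 2 A w"
  shows "\<bar>(w (p + s) + w (p - s)) / 2 - w x\<bar> \<le> cA * A * \<theta> * g * L ^ n"
proof -
  note A = smooth_wt_nonneg[OF assms]
  have w: "smooth_wt n (Suc (Suc 0)) A w" using assms by (simp only: numeral_2_eq_2)
  have "\<bar>w (p + s) + w (p - s) - 2 * w p\<bar> \<le> d\<^sup>2 * (norm s)\<^sup>2 * A * (1 + norm s) ^ (3 * n) * (1 + norm p) ^ n"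
    using smooth_wt_bound[OF smooth_wt_delta2[OF w, of s], of p] by (simp add: d_def)
  also have "\<dots> \<le> d\<^sup>2 * (\<theta> * R\<^sup>2) * A * c1 ^ (3 * n) * (c1 ^ (2 * n) * L ^ n)"
    using A d0 c1 L_nonneg \<theta> R
    by (intro mult_mono mult_right_mono mult_left_mono norm_s weight_s weight_p mult_nonneg_nonneg) auto
  also have "\<dots> = d\<^sup>2 * R\<^sup>2 * c1 ^ (3 * n + 2 * n) * A * \<theta> * 1 * L ^ n" by (simp only: power_add mult_ac mult_1_right)
  also have "\<dots> \<le> d\<^sup>2 * R\<^sup>2 * c1 ^ (3 * n + 2 * n) * A * \<theta> * g * L ^ n"
    using A d0 c1 L_nonneg \<theta> R g1 by (intro mult_right_mono mult_left_mono mult_nonneg_nonneg) auto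
  finally have "\<bar>w (p + s) + w (p - s) - 2 * w p\<bar> \<le> d\<^sup>2 * R\<^sup>2 * c1 ^ (5 * n) * A * \<theta> * g * L ^ n" by simp
  moreover note increment_\<mu>[OF w]
  moreover have "cA * A * \<theta> * g * L ^ n = d\<^sup>2 * R\<^sup>2 * c1 ^ (5 * n) * A * \<theta> * g * L ^ n + d * R * c1 ^ (2 * n) * A * \<theta> * g * L ^ n"
    by (simp add: cA_def algebra_simps)
  ultimately show ?thesis using half_sum_bound by presburger
qed

definition "cB = d ^ 4 * R ^ 4 * c1 ^ (5 * n) + d\<^sup>2 * R\<^sup>2 * c1 ^ (2 * n) + d ^ 3 * R ^ 3 * c1 ^ (2 * n)"

lemma g_sq: "g \<le> g\<^sup>2" "1 \<le> g\<^sup>2"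
  using g1 mult_left_mono[of 1 g g] one_le_power[of g 2] by (auto simp: power2_eq_square)

text \<open>One order further, with the terms of first order made explicit.\<close>

lemma symmetric_expansion:
  assumes "smooth_wt n 4 A f"
  shows "\<bar>(f (p + s) + f (p - s)) / 2 - (f x + \<theta> * dird \<mu> f x + \<theta> * (dird S (dird S f) x / 2))\<bar>
    \<le> cB * A * \<theta>\<^sup>2 * g\<^sup>2 * L ^ n"
proof -
  note A = smooth_wt_nonneg[OF assms]
  note nonneg = A d0 c1 L_nonneg \<theta> R g1
  define X where "X = A * \<theta>\<^sup>2 * g\<^sup>2 * L ^ n"
  have f: "smooth_wt n (Suc (Suc (Suc (Suc 0)))) A f" using assms by (simp only: numeral_eq_Suc pred_numeral_simps BitM.simps)
  have f1: "smooth_wt n (Suc (Suc (Suc 0))) (CARD('d) * norm s * A) (dird s f)" by (rule smooth_wt_dird[OF f])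
  have f2: "smooth_wt n (Suc (Suc 0)) (CARD('d) * norm s * (CARD('d) * norm s * A)) (dird s (dird s f))"
    by (rule smooth_wt_dird[OF f1])
  have "\<bar>f (p + s) + f (p - s) - 2 * f p - dird s (dird s f) p\<bar> \<le> d ^ 4 * norm s ^ 4 * A * (1 + norm s) ^ (3 * n) * (1 + norm p) ^ n"
    using smooth_wt_sym_taylor4[OF assms, of p s] by (simp add: d_def)
  also have "\<dots> \<le> d ^ 4 * (\<theta>\<^sup>2 * R ^ 4) * A * c1 ^ (3 * n) * (c1 ^ (2 * n) * L ^ n)"
    using nonneg by (intro mult_mono mult_right_mono mult_left_mono norm_s weight_s weight_p mult_nonneg_nonneg) auto
  also have "\<dots> = d ^ 4 * R ^ 4 * c1 ^ (3 * n + 2 * n) * (A * \<theta>\<^sup>2 * 1 * L ^ n)" by (simp only: power_add mult_ac mult_1_right)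
  also have "\<dots> \<le> d ^ 4 * R ^ 4 * c1 ^ (3 * n + 2 * n) * X"
    unfolding X_def using nonneg g_sq by (intro mult_right_mono mult_left_mono mult_nonneg_nonneg) auto
  finally have 1: "\<bar>f (p + s) + f (p - s) - 2 * f p - dird s (dird s f) p\<bar> \<le> d ^ 4 * R ^ 4 * c1 ^ (5 * n) * X" by simp
  have "smooth_wt n 2 A f" using smooth_wt_antimono[OF assms, of 2] by simp
  from smooth_wt_taylor2[OF this, of x "\<theta> *\<^sub>R \<mu>"]
  have "\<bar>f p - f x - dird (\<theta> *\<^sub>R \<mu>) f x\<bar> \<le> d\<^sup>2 * (norm (\<theta> *\<^sub>R \<mu>))\<^sup>2 * A * (1 + norm (\<theta> *\<^sub>R \<mu>)) ^ n * (1 + norm x) ^ n"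
    by (simp add: p_def d_def)
  also have "\<dots> \<le> d\<^sup>2 * (\<theta> * (R * g))\<^sup>2 * A * (c1 ^ n * L ^ n) * c1 ^ n"
    using nonneg by (intro mult_mono mult_right_mono mult_left_mono norm_\<theta>\<mu> weight_\<theta>\<mu> weight_x mult_nonneg_nonneg power_mono) auto
  also have "\<dots> = d\<^sup>2 * R\<^sup>2 * c1 ^ (2 * n) * X"
    unfolding c1_double by (simp add: X_def power_mult_distrib mult_ac)
  finally have 2: "\<bar>f p - f x - dird (\<theta> *\<^sub>R \<mu>) f x\<bar> \<le> d\<^sup>2 * R\<^sup>2 * c1 ^ (2 * n) * X" .
  have "\<bar>dird s (dird s f) p - dird s (dird s f) x\<bar> \<le> d * R * c1 ^ (2 * n) * (CARD('d) * norm s * (CARD('d) * norm s * A)) * \<theta> * g * L ^ n"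
    by (rule increment_\<mu>[OF f2])
  also have "\<dots> = d ^ 3 * R * c1 ^ (2 * n) * (A * \<theta> * g * L ^ n) * (norm s)\<^sup>2"
    by (simp add: d_def power2_eq_square power3_eq_cube mult_ac)
  also have "\<dots> \<le> d ^ 3 * R * c1 ^ (2 * n) * (A * \<theta> * g * L ^ n) * (\<theta> * R\<^sup>2)"
    using nonneg by (intro mult_left_mono norm_s mult_nonneg_nonneg) auto
  also have "\<dots> = d ^ 3 * R ^ 3 * c1 ^ (2 * n) * (A * \<theta>\<^sup>2 * g * L ^ n)"
    by (simp add: power2_eq_square power3_eq_cube mult_ac)
  also have "\<dots> \<le> d ^ 3 * R ^ 3 * c1 ^ (2 * n) * X"
    unfolding X_def using nonneg g_sq by (intro mult_right_mono mult_left_mono mult_nonneg_nonneg) auto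
  finally have 3: "\<bar>dird s (dird s f) p - dird s (dird s f) x\<bar> \<le> d ^ 3 * R ^ 3 * c1 ^ (2 * n) * X" .
  have "s $ i * s $ j = \<theta> * (S $ i * S $ j)" for i j
  proof -
    have "s $ i * s $ j = sqrt \<theta> * sqrt \<theta> * (S $ i * S $ j)" by (simp add: s_def mult_ac)
    then show ?thesis using \<theta> by simp
  qed
  then have ss: "dird s (dird s f) x = \<theta> * dird S (dird S f) x"
    by (simp add: dird_dird[OF f] sum_distrib_left mult_ac)
  have mm: "dird (\<theta> *\<^sub>R \<mu>) f x = \<theta> * dird \<mu> f x"
    by (simp add: dird_def sum_distrib_left mult_ac)
  have "cB * X = d ^ 4 * R ^ 4 * c1 ^ (5 * n) * X + d\<^sup>2 * R\<^sup>2 * c1 ^ (2 * n) * X + d ^ 3 * R ^ 3 * c1 ^ (2 * n) * X"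
    by (simp add: cB_def algebra_simps)
  then have "\<bar>(f (p + s) + f (p - s)) / 2 - (f x + \<theta> * dird \<mu> f x + \<theta> * (dird S (dird S f) x / 2))\<bar> \<le> cB * X"
    
    using half_sum_bound3[OF 1 2 3] unfolding ss mm by (simp only: times_divide_eq_right)
  then show ?thesis by (simp add: X_def mult_ac)
qed

definition "cP K = cB * K + cA * K + R * cA * K + R * K * (c1 ^ n + cA * R)"

lemma cP_nonneg: "0 \<le> K \<Longrightarrow> 0 \<le> cP K"
  using R d0 c1 by (simp add: cP_def cB_def cA_def)

text \<open>Here \<open>f\<close> is the solution at the current time and \<open>w\<close> its increment over the step; the factor
  \<open>1 + \<theta> c\<close> is that of the functional \<open>Y\<close>.\<close>

lemma step_without_jump:
  assumes f: "smooth_wt n 4 K f" and w: "smooth_wt n 2 (K * \<theta>) w" and c: "\<bar>c\<bar> \<le> R"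
  shows "\<bar>((1 + \<theta> * c) * (f (p + s) + w (p + s)) + (1 + \<theta> * c) * (f (p - s) + w (p - s))) / 2
      - (f x + w x + \<theta> * (dird \<mu> f x + dird S (dird S f) x / 2 + c * f x))\<bar> \<le> cP K * (\<theta>\<^sup>2 * g\<^sup>2 * L ^ n)"
proof -
  note K = smooth_wt_nonneg[OF f]
  note nonneg = K d0 c1 L_nonneg \<theta> R g1
  have cA0: "0 \<le> cA" using nonneg by (simp add: cA_def)
  define X where "X = \<theta>\<^sup>2 * g\<^sup>2 * L ^ n"
  have gL: "\<theta>\<^sup>2 * g * L ^ n \<le> X" "\<theta>\<^sup>2 \<le> X"
  proof -
    show "\<theta>\<^sup>2 * g * L ^ n \<le> X" unfolding X_def using nonneg g_sq by (intro mult_right_mono mult_left_mono) auto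
    have "1 * 1 \<le> g\<^sup>2 * L ^ n" using g_sq one_le_power[OF L1, of n] by (intro mult_mono) auto
    then have "\<theta>\<^sup>2 * 1 \<le> \<theta>\<^sup>2 * (g\<^sup>2 * L ^ n)" by (intro mult_left_mono) auto
    then show "\<theta>\<^sup>2 \<le> X" by (simp add: X_def mult.assoc)
  qed
  define a where "a = (f (p + s) + f (p - s)) / 2"
  define v where "v = (w (p + s) + w (p - s)) / 2"
  have 1: "\<bar>a - (f x + \<theta> * dird \<mu> f x + \<theta> * (dird S (dird S f) x / 2))\<bar> \<le> cB * K * X"
    using symmetric_expansion[OF f] by (simp add: a_def X_def mult_ac)
  have "\<bar>v - w x\<bar> \<le> cA * (K * \<theta>) * \<theta> * g * L ^ n"
    using symmetric_increment[OF w] by (simp add: v_def)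
  also have "\<dots> = cA * K * (\<theta>\<^sup>2 * g * L ^ n)" by (simp add: power2_eq_square mult_ac)
  also have "\<dots> \<le> cA * K * X" using nonneg cA0 by (intro mult_left_mono gL) auto
  finally have 2: "\<bar>v - w x\<bar> \<le> cA * K * X" .
  have \<theta>c: "\<bar>\<theta> * c\<bar> \<le> R * \<theta>" using mult_mono[of \<theta> \<theta> "\<bar>c\<bar>" R] c \<theta> by (simp add: abs_mult mult.commute)
  have "\<bar>\<theta> * c * (a - f x)\<bar> \<le> (R * \<theta>) * (cA * K * \<theta> * g * L ^ n)"
  proof -
    have "smooth_wt n 2 K f" using smooth_wt_antimono[OF f, of 2] by simp
    then have "\<bar>a - f x\<bar> \<le> cA * K * \<theta> * g * L ^ n"
      unfolding a_def by (rule symmetric_increment)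
    then show ?thesis unfolding abs_mult[of _ "a - f x"] using \<theta>c nonneg by (intro mult_mono) auto
  qed
  also have "\<dots> = R * cA * K * (\<theta>\<^sup>2 * g * L ^ n)" by (simp add: power2_eq_square mult_ac)
  also have "\<dots> \<le> R * cA * K * X" using nonneg cA0 by (intro mult_left_mono gL) auto
  finally have 3: "\<bar>\<theta> * c * (a - f x)\<bar> \<le> R * cA * K * X" .
  have "\<bar>w x\<bar> \<le> K * \<theta> * c1 ^ n"
    using smooth_wt_bound[OF w, of x] mult_left_mono[OF weight_x[of n] smooth_wt_nonneg[OF w]] by linarith
  then have "\<bar>v\<bar> \<le> K * \<theta> * c1 ^ n + cA * K * X" using 2 by linarith
  then have "\<bar>\<theta> * c * v\<bar> \<le> (R * \<theta>) * (K * \<theta> * c1 ^ n + cA * K * X)"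
    unfolding abs_mult[of _ v] using \<theta>c nonneg by (intro mult_mono) auto
  also have "\<dots> = R * K * c1 ^ n * \<theta>\<^sup>2 + R * cA * K * X * \<theta>" by (simp add: power2_eq_square algebra_simps)
  also have "\<dots> \<le> R * K * c1 ^ n * X + R * cA * K * X * R"
    using nonneg cA0 gL order_trans[OF zero_le_power2 gL(2)] by (intro add_mono mult_left_mono) auto
  finally have 4: "\<bar>\<theta> * c * v\<bar> \<le> R * K * c1 ^ n * X + R * cA * K * X * R" .
  have "cP K * X = cB * K * X + cA * K * X + R * cA * K * X + (R * K * c1 ^ n * X + R * cA * K * X * R)"
    by (simp add: cP_def algebra_simps)
  moreover have "((1 + \<theta> * c) * (f (p + s) + w (p + s)) + (1 + \<theta> * c) * (f (p - s) + w (p - s))) / 2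
      - (f x + w x + \<theta> * (dird \<mu> f x + dird S (dird S f) x / 2 + c * f x))
    = (a - (f x + \<theta> * dird \<mu> f x + \<theta> * (dird S (dird S f) x / 2))) + (v - w x) + \<theta> * c * (a - f x) + \<theta> * c * v"
    by (simp add: a_def v_def field_simps)
  ultimately show ?thesis using 1 2 3 4 unfolding X_def[symmetric] by linarith
qed

end

text \<open>The same step, at the end of which a jump may occur.\<close>

locale euler_jump_step = euler_step n R lam \<theta> x b S F \<gamma>
  for n R lam \<theta> and x b S :: "real ^ 'd" and F :: "real ^ 'm ^ 'd" and \<gamma> +
  fixes \<nu> :: "real ^ 'm \<Rightarrow> real" and e :: real
  assumes lev: "levy_density \<nu>" and int: "integrable (levy \<nu>) (\<lambda>z. (norm z)\<^sup>2 * (1 + norm z) ^ n)"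
    and e: "0 < e" and drift: "\<gamma> = drift_corr \<nu> e"
begin

definition "cJ = (d\<^sup>2 * R\<^sup>2 + 2) * (1 + R) ^ n * levy_moment \<nu> n + d * R"

lemma cJ_nonneg: "0 \<le> cJ"
  using d0 R levy_moment_nonneg[of \<nu> n] by (simp add: cJ_def)

abbreviation "J \<equiv> jump_op \<nu> e F"

lemma J_bound: "smooth_wt n 2 A w \<Longrightarrow> \<bar>J w y\<bar> \<le> cJ * A * g * (1 + norm y) ^ n"
  using jump_op_bound[OF lev int e _ F] unfolding cJ_def g_def d_def drift[symmetric] of_nat_power .

lemma J_bound_ps:
  assumes "smooth_wt n 2 A w"
  shows "\<bar>(J w (p + s) + J w (p - s)) / 2\<bar> \<le> cJ * A * g * (c1 ^ (3 * n) * L ^ n)"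
proof -
  have "0 \<le> cJ * A * g" using cJ_nonneg smooth_wt_nonneg[OF assms] g1 by simp
  from mult_left_mono[OF weight_ps(1)[of n] this] mult_left_mono[OF weight_ps(2)[of n] this]
  show ?thesis using J_bound[OF assms, of "p + s"] J_bound[OF assms, of "p - s"]
    by (intro half_sum_abs) (auto intro: order_trans)
qed

lemma J_add:
  assumes "smooth_wt n (Suc k) A v" "smooth_wt n (Suc l) B w"
  shows "J (\<lambda>y. v y + w y) y = J v y + J w y"
  using jump_op_add[OF int e assms] by simp

definition "cC = cJ * (d\<^sup>2 * R\<^sup>2 * c1 ^ (5 * n) + d * R * c1 ^ (2 * n))"

text \<open>The jump operator commutes with translations, so the differences may be taken on \<open>f\<close>.  Two derivatives
  are used by the difference and two by the jump operator, which is why \<open>u\<close> needs four.\<close>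

lemma J_symmetric_increment:
  assumes "smooth_wt n 4 A f"
  shows "\<bar>(J f (p + s) + J f (p - s)) / 2 - J f x\<bar> \<le> cC * A * (\<theta> * g\<^sup>2 * L ^ n)"
proof -
  note A = smooth_wt_nonneg[OF assms]
  note nonneg = A d0 c1 L_nonneg \<theta> R g1 cJ_nonneg
  define X where "X = \<theta> * g\<^sup>2 * L ^ n"
  have f: "smooth_wt n (Suc (Suc 2)) A f" using assms by (simp only: Suc_numeral Num.add_num_simps)
  have f2: "smooth_wt n (Suc 2) A f" using smooth_wt_antimono[OF assms, of "Suc 2"] by simp
  have sh: "smooth_wt n (Suc 3) (A * (1 + norm v) ^ n) (\<lambda>y. f (y + v))" for v
    by (rule smooth_wt_shift) (use assms in \<open>simp only: Suc_numeral Num.add_num_simps\<close>)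
  have f4: "smooth_wt n (Suc 3) A f" using assms by (simp only: Suc_numeral Num.add_num_simps)
  have cm: "smooth_wt n (Suc 3) (\<bar>r\<bar> * A) (\<lambda>y. r * f y)" for r
    by (rule smooth_wt_cmult[OF f4])
  have J2: "J (\<lambda>y. f (y + s) + f (y - s) - 2 * f y) p = J f (p + s) + J f (p - s) - 2 * J f p"
  proof -
    have "J (\<lambda>y. f (y + s) + f (y - s) - 2 * f y) p = J (\<lambda>y. (f (y + s) + f (y + - s)) + (- 2) * f y) p"
      by simp
    also have "\<dots> = J (\<lambda>y. f (y + s) + f (y + - s)) p + J (\<lambda>y. (- 2) * f y) p"
      by (rule J_add[OF smooth_wt_add[OF sh sh] cm])
    also have "J (\<lambda>y. f (y + s) + f (y + - s)) p = J (\<lambda>y. f (y + s)) p + J (\<lambda>y. f (y + - s)) p"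
      by (rule J_add[OF sh sh])
    finally show ?thesis unfolding jump_op_shift jump_op_cmult by simp
  qed
  have J1: "J (\<lambda>y. f (y + \<theta> *\<^sub>R \<mu>) - f y) x = J f p - J f x"
  proof -
    have "J (\<lambda>y. f (y + \<theta> *\<^sub>R \<mu>) - f y) x = J (\<lambda>y. f (y + \<theta> *\<^sub>R \<mu>) + (- 1) * f y) x" by simp
    also have "\<dots> = J (\<lambda>y. f (y + \<theta> *\<^sub>R \<mu>)) x + J (\<lambda>y. (- 1) * f y) x"
      by (rule J_add[OF sh cm])
    finally show ?thesis unfolding jump_op_shift jump_op_cmult by (simp add: p_def)
  qed
  have "\<bar>J f (p + s) + J f (p - s) - 2 * J f p\<bar>
      \<le> cJ * (d\<^sup>2 * (norm s)\<^sup>2 * A * (1 + norm s) ^ (3 * n)) * g * (1 + norm p) ^ n"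
    using J_bound[OF smooth_wt_delta2[OF f, of s], of p] by (simp add: J2 d_def)
  also have "\<dots> \<le> cJ * (d\<^sup>2 * (\<theta> * R\<^sup>2) * A * c1 ^ (3 * n)) * g * (c1 ^ (2 * n) * L ^ n)"
    using nonneg by (intro mult_mono mult_right_mono mult_left_mono norm_s weight_s weight_p mult_nonneg_nonneg) auto
  also have "\<dots> = cJ * (d\<^sup>2 * R\<^sup>2 * c1 ^ (3 * n + 2 * n)) * A * (\<theta> * g * L ^ n)" by (simp only: power_add mult_ac)
  also have "\<dots> \<le> cJ * (d\<^sup>2 * R\<^sup>2 * c1 ^ (3 * n + 2 * n)) * A * X"
    unfolding X_def using nonneg g_sq by (intro mult_right_mono mult_left_mono mult_nonneg_nonneg) auto
  finally have 1: "\<bar>J f (p + s) + J f (p - s) - 2 * J f p\<bar> \<le> cJ * (d\<^sup>2 * R\<^sup>2 * c1 ^ (5 * n)) * A * X" by simp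
  have "\<bar>J f p - J f x\<bar> \<le> cJ * (d * norm (\<theta> *\<^sub>R \<mu>) * A * (1 + norm (\<theta> *\<^sub>R \<mu>)) ^ n) * g * (1 + norm x) ^ n"
    using J_bound[OF smooth_wt_delta[OF f2, of "\<theta> *\<^sub>R \<mu>"], of x] unfolding J1 d_def .
  also have "\<dots> \<le> cJ * (d * (\<theta> * (R * g)) * A * (c1 ^ n * L ^ n)) * g * c1 ^ n"
    using nonneg by (intro mult_mono mult_right_mono mult_left_mono norm_\<theta>\<mu> weight_\<theta>\<mu> weight_x mult_nonneg_nonneg) auto
  also have "\<dots> = cJ * (d * R * c1 ^ (2 * n)) * A * X"
    unfolding c1_double by (simp add: X_def power2_eq_square mult_ac)
  finally have 2: "\<bar>J f p - J f x\<bar> \<le> cJ * (d * R * c1 ^ (2 * n)) * A * X" .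
  have "cC * A * X = cJ * (d\<^sup>2 * R\<^sup>2 * c1 ^ (5 * n)) * A * X + cJ * (d * R * c1 ^ (2 * n)) * A * X"
    by (simp add: cC_def algebra_simps)
  then show ?thesis using half_sum_bound[OF 1 2] unfolding X_def[symmetric] by (simp only:)
qed

definition "cQ K = cC * K + (R + (1 + R\<^sup>2)) * cJ * K * c1 ^ (3 * n)"

lemma cQ_nonneg: "0 \<le> K \<Longrightarrow> 0 \<le> cQ K"
  using R d0 c1 cJ_nonneg by (simp add: cQ_def cC_def)

lemma step_with_jump:
  assumes f: "smooth_wt n 4 K f" and w: "smooth_wt n 2 (K * \<theta>) w" and c: "\<bar>c\<bar> \<le> R"
  shows "\<bar>((1 + \<theta> * c) * J (\<lambda>y. f y + w y) (p + s) + (1 + \<theta> * c) * J (\<lambda>y. f y + w y) (p - s)) / 2 - J f x\<bar>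
    \<le> cQ K * (\<theta> * g\<^sup>2 * L ^ n)"
proof -
  note K = smooth_wt_nonneg[OF f]
  note nonneg = K d0 c1 L_nonneg \<theta> R g1 cJ_nonneg
  define X where "X = \<theta> * g\<^sup>2 * L ^ n"
  have f2: "smooth_wt n 2 K f" using smooth_wt_antimono[OF f, of 2] by simp
  have Jadd: "J (\<lambda>y. f y + w y) y = J f y + J w y" for y
    by (rule J_add[where k = 1 and l = 1]) (use f2 w in \<open>simp_all only: Suc_1\<close>)
  define a where "a = (J f (p + s) + J f (p - s)) / 2"
  define v where "v = (J w (p + s) + J w (p - s)) / 2"
  have X: "\<theta> * g * L ^ n \<le> X" unfolding X_def using nonneg g_sq by (intro mult_right_mono mult_left_mono) auto
  have \<theta>c: "\<bar>\<theta> * c\<bar> \<le> R * \<theta>" using mult_mono[of \<theta> \<theta> "\<bar>c\<bar>" R] c \<theta> by (simp add: abs_mult mult.commute)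
  have 1: "\<bar>a - J f x\<bar> \<le> cC * K * X"
    unfolding a_def X_def by (rule J_symmetric_increment[OF f])
  have "\<bar>\<theta> * c * a\<bar> \<le> (R * \<theta>) * (cJ * K * g * (c1 ^ (3 * n) * L ^ n))"
    unfolding abs_mult[of _ a] using \<theta>c nonneg J_bound_ps[OF f2] by (intro mult_mono) (auto simp: a_def)
  also have "\<dots> = R * cJ * K * c1 ^ (3 * n) * (\<theta> * g * L ^ n)" by (simp add: mult_ac)
  also have "\<dots> \<le> R * cJ * K * c1 ^ (3 * n) * X" using nonneg by (intro mult_left_mono X) auto
  finally have 2: "\<bar>\<theta> * c * a\<bar> \<le> R * cJ * K * c1 ^ (3 * n) * X" .
  have "\<bar>1 + \<theta> * c\<bar> \<le> 1 + R\<^sup>2"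
  proof -
    have "R * \<theta> \<le> R\<^sup>2" using mult_left_mono[OF \<theta>(2), of R] R by (simp add: power2_eq_square)
    with \<theta>c show ?thesis by argo
  qed
  then have "\<bar>(1 + \<theta> * c) * v\<bar> \<le> (1 + R\<^sup>2) * (cJ * (K * \<theta>) * g * (c1 ^ (3 * n) * L ^ n))"
    unfolding abs_mult[of _ v] using nonneg J_bound_ps[OF w] by (intro mult_mono) (auto simp: v_def)
  also have "\<dots> = (1 + R\<^sup>2) * cJ * K * c1 ^ (3 * n) * (\<theta> * g * L ^ n)" by (simp add: mult_ac)
  also have "\<dots> \<le> (1 + R\<^sup>2) * cJ * K * c1 ^ (3 * n) * X" using nonneg by (intro mult_left_mono X) auto
  finally have 3: "\<bar>(1 + \<theta> * c) * v\<bar> \<le> (1 + R\<^sup>2) * cJ * K * c1 ^ (3 * n) * X" .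
  have "cQ K * X = cC * K * X + R * cJ * K * c1 ^ (3 * n) * X + (1 + R\<^sup>2) * cJ * K * c1 ^ (3 * n) * X"
    by (simp add: cQ_def algebra_simps)
  moreover have "((1 + \<theta> * c) * J (\<lambda>y. f y + w y) (p + s) + (1 + \<theta> * c) * J (\<lambda>y. f y + w y) (p - s)) / 2 - J f x
    = (a - J f x) + \<theta> * c * a + (1 + \<theta> * c) * v"
    unfolding Jadd by (simp add: a_def v_def field_simps)
  ultimately show ?thesis using 1 2 3 unfolding X_def[symmetric] by linarith
qed

end

section \<open>Integration against the law of one step\<close>

lemma distr_snd_pair:
  assumes "prob_space A" "sigma_finite_measure B"
  shows "distr (A \<Otimes>\<^sub>M B) B snd = B"
proof (rule measure_eqI)
  interpret A: prob_space A by fact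
  interpret B: sigma_finite_measure B by fact
  fix X assume "X \<in> sets (distr (A \<Otimes>\<^sub>M B) B snd)"
  then have X: "X \<in> sets B" by simp
  have "snd -` X \<inter> space (A \<Otimes>\<^sub>M B) = space A \<times> X"
    using sets.sets_into_space[OF X] by (auto simp: space_pair_measure)
  then show "emeasure (distr (A \<Otimes>\<^sub>M B) B snd) X = emeasure B X"
    using X by (simp add: emeasure_distr B.emeasure_pair_measure_Times A.emeasure_space_1)
qed simp

lemma integrable_snd_pair:
  fixes f :: "'b \<Rightarrow> real"
  assumes "prob_space A" "sigma_finite_measure B" "integrable B f"
  shows "integrable (A \<Otimes>\<^sub>M B) (\<lambda>p. f (snd p))"
  using assms(3) borel_measurable_integrable[OF assms(3)]
  by (subst integrable_distr_eq[symmetric, of snd _ B]) (simp_all add: distr_snd_pair[OF assms(1,2)])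

lemma AE_snd_pair:
  assumes "prob_space A" "sigma_finite_measure B" "AE b in B. P b"
  shows "AE p in A \<Otimes>\<^sub>M B. P (snd p)"
proof -
  have "AE b in distr (A \<Otimes>\<^sub>M B) B snd. P b" unfolding distr_snd_pair[OF assms(1,2)] by (rule assms)
  then show ?thesis by (rule AE_distrD[rotated]) simp
qed

lemma AE_fst_pair:
  assumes "prob_space B" "AE a in A. P a"
  shows "AE p in A \<Otimes>\<^sub>M B. P (fst p)"
proof -
  interpret B: prob_space B by fact
  have "AE a in distr (A \<Otimes>\<^sub>M B) A fst. P a" unfolding B.distr_pair_fst by (rule assms)
  then show ?thesis by (rule AE_distrD[rotated]) simp
qed

abbreviation sign_pair :: "((real ^ 'd) \<times> (real ^ 'm)) measure" where
  "sign_pair \<equiv> sign_law \<Otimes>\<^sub>M sign_law"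

lemma sets_sign_pair: "sets sign_pair = sets (borel \<Otimes>\<^sub>M borel)"
  by (rule sets_pair_measure_cong) simp_all

lemma prob_space_sign_pair: "prob_space sign_pair"
  by (intro prob_space_pair prob_space_sign_law)

text \<open>A bounded set that carries the sign laws; the Euclidean norm of a sign vector is at most its
  number of entries.\<close>

definition sign_bounded :: "(real ^ 'd) \<times> (real ^ 'm) \<Rightarrow> bool" where
  "sign_bounded \<zeta> \<longleftrightarrow> norm (fst \<zeta>) \<le> CARD('d) \<and> norm (snd \<zeta>) \<le> CARD('m)"

lemma AE_sign_pair: "AE \<zeta> in sign_pair. sign_bounded \<zeta>"
  using AE_fst_pair[OF prob_space_sign_law AE_sign_law_norm]
    AE_snd_pair[OF prob_space_sign_law prob_space_imp_sigma_finite[OF prob_space_sign_law] AE_sign_law_norm]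
  by eventually_elim (auto simp: sign_bounded_def)

lemma sign_pair_integrable:
  fixes q :: "(real ^ 'd) \<times> (real ^ 'm) \<Rightarrow> real"
  assumes "q \<in> borel_measurable (borel \<Otimes>\<^sub>M borel)" "\<And>\<zeta>. sign_bounded \<zeta> \<Longrightarrow> \<bar>q \<zeta>\<bar> \<le> C"
  shows "integrable sign_pair q"
proof -
  interpret prob_space "sign_pair :: ((real ^ 'd) \<times> (real ^ 'm)) measure" by (rule prob_space_sign_pair)
  show ?thesis
    by (rule integrable_const_bound[OF eventually_mono[OF AE_sign_pair]])
       (use assms in \<open>auto cong: measurable_cong_sets simp: sets_sign_pair\<close>)
qed

lemma sign_pair_uminus: "distr sign_pair (borel \<Otimes>\<^sub>M borel) (\<lambda>\<zeta>. - \<zeta>) = (sign_pair :: ((real ^ 'd) \<times> (real ^ 'm)) measure)"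
proof -
  have "sign_pair = distr (sign_law :: (real ^ 'd) measure) borel uminus \<Otimes>\<^sub>M distr (sign_law :: (real ^ 'm) measure) borel uminus"
    by (simp only: sign_law_uminus)
  also have "\<dots> = distr sign_pair (borel \<Otimes>\<^sub>M borel) (\<lambda>(x, y). (- x, - y))"
    by (rule pair_measure_distr)
       (simp_all add: sign_law_uminus prob_space_imp_sigma_finite prob_space_sign_law)
  also have "(\<lambda>(x, y). (- x, - y)) = (\<lambda>\<zeta> :: (real ^ 'd) \<times> (real ^ 'm). - \<zeta>)" by (auto simp: fun_eq_iff)
  finally show ?thesis by simp
qed

lemma sign_pair_integral_symmetrize:
  fixes q :: "(real ^ 'd) \<times> (real ^ 'm) \<Rightarrow> real"
  assumes [measurable]: "q \<in> borel_measurable (borel \<Otimes>\<^sub>M borel)" and b: "\<And>\<zeta>. sign_bounded \<zeta> \<Longrightarrow> \<bar>q \<zeta>\<bar> \<le> C"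
  shows "(\<integral>\<zeta>. q \<zeta> \<partial>sign_pair) = (\<integral>\<zeta>. (q \<zeta> + q (- \<zeta>)) / 2 \<partial>sign_pair)"
proof -
  note [measurable_cong] = sets_sign_pair
  have m: "(\<lambda>\<zeta> :: (real ^ 'd) \<times> (real ^ 'm). - \<zeta>) \<in> sign_pair \<rightarrow>\<^sub>M borel \<Otimes>\<^sub>M borel"
    unfolding uminus_prod_def by measurable
  have e: "(\<integral>\<zeta>. q (- \<zeta>) \<partial>sign_pair) = (\<integral>\<zeta>. q \<zeta> \<partial>sign_pair)"
    by (subst (2) sign_pair_uminus[symmetric], subst integral_distr[OF m]) auto
  have i: "integrable sign_pair q" by (rule sign_pair_integrable[OF assms])
  have "integrable sign_pair (\<lambda>\<zeta>. q (- \<zeta>))"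
    by (rule sign_pair_integrable[of _ C])
       (use measurable_compose[OF m, of q] b in \<open>auto simp: sign_bounded_def cong: measurable_cong_sets\<close>)
  with i e show ?thesis by simp
qed

lemma component_bound: "norm x \<le> C \<Longrightarrow> \<bar>x $ k\<bar> \<le> C" for x :: "real ^ 'a"
  using component_le_norm_cart[of x k] by linarith

lemma component_product_bound: "norm x \<le> C \<Longrightarrow> \<bar>x $ k * x $ l\<bar> \<le> C * C" for x :: "real ^ 'a"
  unfolding abs_mult using order_trans[OF norm_ge_zero[of x], of C]
  by (intro mult_mono component_bound) auto

lemma sign_pair_product:
  fixes f :: "real ^ 'd \<Rightarrow> real" and g :: "real ^ 'm \<Rightarrow> real"
  assumes "f \<in> borel_measurable borel" "g \<in> borel_measurable borel"
    "\<And>x. norm x \<le> CARD('d) \<Longrightarrow> \<bar>f x\<bar> \<le> A" "\<And>y. norm y \<le> CARD('m) \<Longrightarrow> \<bar>g y\<bar> \<le> B"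
  shows "integrable sign_pair (\<lambda>\<zeta>. f (fst \<zeta>) * g (snd \<zeta>))"
    "(\<integral>\<zeta>. f (fst \<zeta>) * g (snd \<zeta>) \<partial>sign_pair) = (\<integral>x. f x \<partial>(sign_law :: (real ^ 'd) measure)) * (\<integral>y. g y \<partial>(sign_law :: (real ^ 'm) measure))"
proof -
  note [measurable] = assms(1,2)
  interpret A: prob_space "sign_law :: (real ^ 'd) measure" by (rule prob_space_sign_law)
  interpret B: prob_space "sign_law :: (real ^ 'm) measure" by (rule prob_space_sign_law)
  interpret P: pair_sigma_finite "sign_law :: (real ^ 'd) measure" "sign_law :: (real ^ 'm) measure" ..
  have "\<bar>f x * g y\<bar> \<le> A * B" if "norm x \<le> CARD('d)" "norm y \<le> CARD('m)" for x y
    unfolding abs_mult using assms(3)[OF that(1)] assms(4)[OF that(2)] by (intro mult_mono) auto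
  then show i: "integrable sign_pair (\<lambda>\<zeta>. f (fst \<zeta>) * g (snd \<zeta>))"
    by (intro sign_pair_integrable[of _ "A * B"]) (auto simp: sign_bounded_def)
  show "(\<integral>\<zeta>. f (fst \<zeta>) * g (snd \<zeta>) \<partial>sign_pair) = (\<integral>x. f x \<partial>(sign_law :: (real ^ 'd) measure)) * (\<integral>y. g y \<partial>(sign_law :: (real ^ 'm) measure))"
    using P.integral_fst'[OF i] by simp
qed

lemma sign_pair_cov:
  fixes \<sigma> :: "real ^ 'd ^ 'k" and G :: "real ^ 'm ^ 'k"
  defines "S \<equiv> \<lambda>\<zeta>. \<sigma> *v fst \<zeta> + G *v snd \<zeta>"
  shows "integrable sign_pair (\<lambda>\<zeta>. S \<zeta> $ i * S \<zeta> $ j)"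
    "(\<integral>\<zeta>. S \<zeta> $ i * S \<zeta> $ j \<partial>sign_pair) = (\<sigma> ** transpose \<sigma> + G ** transpose G) $ i $ j"
proof -
  let ?SP = "sign_pair :: ((real ^ 'd) \<times> (real ^ 'm)) measure"
  interpret A: prob_space "sign_law :: (real ^ 'd) measure" by (rule prob_space_sign_law)
  interpret B: prob_space "sign_law :: (real ^ 'm) measure" by (rule prob_space_sign_law)
  have xx: "integrable ?SP (\<lambda>\<zeta>. fst \<zeta> $ k * fst \<zeta> $ l)" "(\<integral>\<zeta>. fst \<zeta> $ k * fst \<zeta> $ l \<partial>?SP) = (if k = l then 1 else 0)" for k l
    using sign_pair_product[where 'm = 'm and 'd = 'd, of "\<lambda>x. x $ k * x $ l" "\<lambda>_. 1" "real CARD('d) * real CARD('d)" 1] component_product_bound[where 'a = 'd]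
    by (auto simp: sign_law_cov A.prob_space B.prob_space)
  have yy: "integrable ?SP (\<lambda>\<zeta>. snd \<zeta> $ k * snd \<zeta> $ l)" "(\<integral>\<zeta>. snd \<zeta> $ k * snd \<zeta> $ l \<partial>?SP) = (if k = l then 1 else 0)" for k l
    using sign_pair_product[where 'm = 'm and 'd = 'd, of "\<lambda>_. 1" "\<lambda>x. x $ k * x $ l" 1 "real CARD('m) * real CARD('m)"] component_product_bound[where 'a = 'm]
    by (auto simp: sign_law_cov A.prob_space B.prob_space)
  have xy: "integrable ?SP (\<lambda>\<zeta>. fst \<zeta> $ k * snd \<zeta> $ l)" "(\<integral>\<zeta>. fst \<zeta> $ k * snd \<zeta> $ l \<partial>?SP) = 0" for k l
    using sign_pair_product[where 'm = 'm and 'd = 'd, of "\<lambda>x. x $ k" "\<lambda>x. x $ l" "real CARD('d)" "real CARD('m)"] component_bound[where 'a = 'd] component_bound[where 'a = 'm]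
    by (auto simp: sign_law_mean)
  have expand: "S \<zeta> $ i * S \<zeta> $ j
    = (\<Sum>k\<in>UNIV. \<Sum>l\<in>UNIV. \<sigma> $ i $ k * \<sigma> $ j $ l * (fst \<zeta> $ k * fst \<zeta> $ l))
    + (\<Sum>k\<in>UNIV. \<Sum>l\<in>UNIV. \<sigma> $ i $ k * G $ j $ l * (fst \<zeta> $ k * snd \<zeta> $ l))
    + (\<Sum>k\<in>UNIV. \<Sum>l\<in>UNIV. \<sigma> $ j $ k * G $ i $ l * (fst \<zeta> $ k * snd \<zeta> $ l))
    + (\<Sum>k\<in>UNIV. \<Sum>l\<in>UNIV. G $ i $ k * G $ j $ l * (snd \<zeta> $ k * snd \<zeta> $ l))" for \<zeta>
  proof -
    have "S \<zeta> $ i * S \<zeta> $ j = ((\<Sum>k\<in>UNIV. \<sigma> $ i $ k * fst \<zeta> $ k) + (\<Sum>l\<in>UNIV. G $ i $ l * snd \<zeta> $ l))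
       * ((\<Sum>k\<in>UNIV. \<sigma> $ j $ k * fst \<zeta> $ k) + (\<Sum>l\<in>UNIV. G $ j $ l * snd \<zeta> $ l))"
      by (simp add: S_def matrix_vector_mult_def)
    also have "\<dots> = (\<Sum>k\<in>UNIV. \<sigma> $ i $ k * fst \<zeta> $ k) * (\<Sum>k\<in>UNIV. \<sigma> $ j $ k * fst \<zeta> $ k)
      + (\<Sum>k\<in>UNIV. \<sigma> $ i $ k * fst \<zeta> $ k) * (\<Sum>l\<in>UNIV. G $ j $ l * snd \<zeta> $ l)
      + (\<Sum>k\<in>UNIV. \<sigma> $ j $ k * fst \<zeta> $ k) * (\<Sum>l\<in>UNIV. G $ i $ l * snd \<zeta> $ l)
      + (\<Sum>l\<in>UNIV. G $ i $ l * snd \<zeta> $ l) * (\<Sum>l\<in>UNIV. G $ j $ l * snd \<zeta> $ l)"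
      by (simp only: distrib_left distrib_right mult.commute add_ac)
    finally show ?thesis unfolding sum_product by (simp only: mult_ac)
  qed
  show "integrable sign_pair (\<lambda>\<zeta>. S \<zeta> $ i * S \<zeta> $ j)"
    unfolding expand
    by (intro Bochner_Integration.integrable_add Bochner_Integration.integrable_sum integrable_mult_right xx yy xy)
  have "(\<integral>\<zeta>. S \<zeta> $ i * S \<zeta> $ j \<partial>?SP)
    = (\<Sum>k\<in>UNIV. \<Sum>l\<in>UNIV. \<sigma> $ i $ k * \<sigma> $ j $ l * (if k = l then 1 else 0))
    + (\<Sum>k\<in>UNIV. \<Sum>l\<in>UNIV. G $ i $ k * G $ j $ l * (if k = l then 1 else 0))"
    unfolding expand
    by (simp add: Bochner_Integration.integral_add Bochner_Integration.integral_sum xx yy xy)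
  then show "(\<integral>\<zeta>. S \<zeta> $ i * S \<zeta> $ j \<partial>?SP) = (\<sigma> ** transpose \<sigma> + G ** transpose G) $ i $ j"
    by (simp add: matrix_matrix_mult_def transpose_def if_distrib[of "\<lambda>x. _ * x"] cong: if_cong)
qed

abbreviation "noise_space \<equiv> borel \<Otimes>\<^sub>M borel \<Otimes>\<^sub>M count_space (UNIV :: bool set) \<Otimes>\<^sub>M (borel :: real measure) \<Otimes>\<^sub>M borel"

lemma sets_step_law: "sets (step_law \<nu> e h) = sets noise_space"
  unfolding step_law_def by (intro sets_pair_measure_cong) simp_all

lemma prob_space_step_law:
  assumes "levy_density \<nu>" "0 < e" "0 < intensity \<nu> e" "0 < h"
  shows "prob_space (step_law \<nu> e h)"
  unfolding step_law_def
  by (intro prob_space_pair prob_space_sign_law measure_pmf.prob_space_axioms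
      prob_space_trunc_exp_law prob_space_jump_law assms)

text \<open>The order of integration chosen here, first the jump size, then the clock, then the signs, is the one
  in which the expansion proceeds.\<close>

lemma step_law_integral:
  fixes k :: "('d::finite, 'm::finite) noise \<Rightarrow> real"
  assumes lev: "levy_density \<nu>" and e: "0 < e" and lam: "0 < intensity \<nu> e" and h: "0 < h"
    and int: "integrable (jump_law \<nu> e) (\<lambda>z. (1 + norm z) ^ n)"
    and k: "k \<in> borel_measurable noise_space"
    and bound: "\<And>r. \<exists>C. \<forall>\<xi> \<eta> I \<delta> z. norm \<xi> \<le> r \<longrightarrow> norm \<eta> \<le> r \<longrightarrow> 0 < \<delta> \<longrightarrow> \<delta> \<le> h \<longrightarrow>
      \<bar>k (\<xi>, \<eta>, I, \<delta>, z)\<bar> \<le> C * (1 + norm z) ^ n"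
  shows "integrable (step_law \<nu> e h) k"
    and "(\<integral>w. k w \<partial>step_law \<nu> e h)
      = (\<integral>\<zeta>. \<integral>w. \<integral>z. k (fst \<zeta>, snd \<zeta>, fst w, snd w, z) \<partial>jump_law \<nu> e \<partial>clock (intensity \<nu> e) h \<partial>sign_pair)"
proof -
  let ?r = "intensity \<nu> e"
  let ?B = "measure_pmf (bernoulli_pmf (1 - exp (- ?r * h)))" and ?E = "trunc_exp_law ?r h" and ?J = "jump_law \<nu> e"
  let ?S = "sign_law :: (real ^ 'd) measure" and ?T = "sign_law :: (real ^ 'm) measure"
  interpret E: prob_space ?E by (rule prob_space_trunc_exp_law[OF lam h])
  interpret J: prob_space ?J by (rule prob_space_jump_law[OF lev e lam])
  interpret S: prob_space ?S by (rule prob_space_sign_law)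
  interpret T: prob_space ?T by (rule prob_space_sign_law)
  interpret C: prob_space "clock ?r h" by (rule prob_space_clock[OF lam h])
  have pEJ: "prob_space (?E \<Otimes>\<^sub>M ?J)" and pBEJ: "prob_space (?B \<Otimes>\<^sub>M ?E \<Otimes>\<^sub>M ?J)"
    and pTBEJ: "prob_space (?T \<Otimes>\<^sub>M ?B \<Otimes>\<^sub>M ?E \<Otimes>\<^sub>M ?J)"
    by (intro prob_space_pair measure_pmf.prob_space_axioms E.prob_space_axioms J.prob_space_axioms T.prob_space_axioms)+
  interpret EJ: prob_space "?E \<Otimes>\<^sub>M ?J" by (rule pEJ)
  interpret BEJ: prob_space "?B \<Otimes>\<^sub>M ?E \<Otimes>\<^sub>M ?J" by (rule pBEJ)
  interpret TBEJ: prob_space "?T \<Otimes>\<^sub>M ?B \<Otimes>\<^sub>M ?E \<Otimes>\<^sub>M ?J" by (rule pTBEJ)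
  interpret P1: pair_sigma_finite ?S "?T \<Otimes>\<^sub>M ?B \<Otimes>\<^sub>M ?E \<Otimes>\<^sub>M ?J" ..
  interpret P2: pair_sigma_finite ?T "?B \<Otimes>\<^sub>M ?E \<Otimes>\<^sub>M ?J" ..
  interpret P3: pair_sigma_finite ?B "?E \<Otimes>\<^sub>M ?J" ..
  interpret P4: pair_sigma_finite ?E ?J ..
  interpret P5: pair_sigma_finite ?B ?E ..
  interpret P6: pair_sigma_finite ?S ?T ..
  have sEJ: "sets (?E \<Otimes>\<^sub>M ?J) = sets (borel \<Otimes>\<^sub>M borel)" by (intro sets_pair_measure_cong) simp_all
  have sBEJ: "sets (?B \<Otimes>\<^sub>M ?E \<Otimes>\<^sub>M ?J) = sets (count_space UNIV \<Otimes>\<^sub>M borel \<Otimes>\<^sub>M borel)" by (intro sets_pair_measure_cong) simp_all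
  have sTBEJ: "sets (?T \<Otimes>\<^sub>M ?B \<Otimes>\<^sub>M ?E \<Otimes>\<^sub>M ?J) = sets (borel \<Otimes>\<^sub>M count_space UNIV \<Otimes>\<^sub>M borel \<Otimes>\<^sub>M borel)"
    by (intro sets_pair_measure_cong) simp_all
  note [measurable] = k
  have "\<forall>r. \<exists>C. \<forall>\<xi> \<eta> I \<delta> z. norm \<xi> \<le> r \<longrightarrow> norm \<eta> \<le> r \<longrightarrow> 0 < \<delta> \<longrightarrow> \<delta> \<le> h \<longrightarrow>
      \<bar>k (\<xi>, \<eta>, I, \<delta>, z)\<bar> \<le> C * (1 + norm z) ^ n" using bound by blast
  from choice[OF this] obtain C where C: "\<And>r \<xi> \<eta> I \<delta> z. norm \<xi> \<le> r \<Longrightarrow> norm \<eta> \<le> r \<Longrightarrow> 0 < \<delta> \<Longrightarrow> \<delta> \<le> h \<Longrightarrow>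
      \<bar>k (\<xi>, \<eta>, I, \<delta>, z)\<bar> \<le> C r * (1 + norm z) ^ n" by blast
  have k1: "(\<lambda>w. k (\<xi>, w)) \<in> borel_measurable (borel \<Otimes>\<^sub>M count_space UNIV \<Otimes>\<^sub>M borel \<Otimes>\<^sub>M borel)" for \<xi> by measurable
  have k2: "(\<lambda>w. k (\<xi>, \<eta>, w)) \<in> borel_measurable (count_space UNIV \<Otimes>\<^sub>M borel \<Otimes>\<^sub>M borel)" for \<xi> \<eta> by measurable
  have k3: "(\<lambda>w. k (\<xi>, \<eta>, I, w)) \<in> borel_measurable (borel \<Otimes>\<^sub>M borel)" for \<xi> \<eta> I by measurable
  let ?W = "\<lambda>z. (1 + norm z) ^ n"
  have W4: "integrable (?E \<Otimes>\<^sub>M ?J) (\<lambda>p. ?W (snd p))"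
    by (rule integrable_snd_pair[OF E.prob_space_axioms J.sigma_finite_measure_axioms int])
  have W3: "integrable (?B \<Otimes>\<^sub>M ?E \<Otimes>\<^sub>M ?J) (\<lambda>p. ?W (snd (snd p)))"
    by (rule integrable_snd_pair[OF measure_pmf.prob_space_axioms EJ.sigma_finite_measure_axioms W4])
  have W2: "integrable (?T \<Otimes>\<^sub>M ?B \<Otimes>\<^sub>M ?E \<Otimes>\<^sub>M ?J) (\<lambda>p. ?W (snd (snd (snd p))))"
    by (rule integrable_snd_pair[OF T.prob_space_axioms BEJ.sigma_finite_measure_axioms W3])
  have W1: "integrable (?S \<Otimes>\<^sub>M ?T \<Otimes>\<^sub>M ?B \<Otimes>\<^sub>M ?E \<Otimes>\<^sub>M ?J) (\<lambda>p. ?W (snd (snd (snd (snd p)))))"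
    by (rule integrable_snd_pair[OF S.prob_space_axioms TBEJ.sigma_finite_measure_axioms W2])
  have A4: "AE p in ?E \<Otimes>\<^sub>M ?J. 0 < fst p \<and> fst p \<le> h"
    by (rule AE_fst_pair[OF J.prob_space_axioms AE_trunc_exp_law])
  have A3: "AE p in ?B \<Otimes>\<^sub>M ?E \<Otimes>\<^sub>M ?J. 0 < fst (snd p) \<and> fst (snd p) \<le> h"
    by (rule AE_snd_pair[OF measure_pmf.prob_space_axioms EJ.sigma_finite_measure_axioms A4])
  have A2: "AE p in ?T \<Otimes>\<^sub>M ?B \<Otimes>\<^sub>M ?E \<Otimes>\<^sub>M ?J. norm (fst p) \<le> CARD('m) \<and> 0 < fst (snd (snd p)) \<and> fst (snd (snd p)) \<le> h"
    using AE_fst_pair[OF BEJ.prob_space_axioms AE_sign_law_norm] AE_snd_pair[OF T.prob_space_axioms BEJ.sigma_finite_measure_axioms A3]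
    by eventually_elim auto
  have A1: "AE p in ?S \<Otimes>\<^sub>M ?T \<Otimes>\<^sub>M ?B \<Otimes>\<^sub>M ?E \<Otimes>\<^sub>M ?J. norm (fst p) \<le> CARD('d) \<and> norm (fst (snd p)) \<le> CARD('m)
      \<and> 0 < fst (snd (snd (snd p))) \<and> fst (snd (snd (snd p))) \<le> h"
    using AE_fst_pair[OF TBEJ.prob_space_axioms AE_sign_law_norm] AE_snd_pair[OF S.prob_space_axioms TBEJ.sigma_finite_measure_axioms A2]
    by eventually_elim auto
  have i4: "integrable (?E \<Otimes>\<^sub>M ?J) (\<lambda>p. k (\<xi>, \<eta>, I, p))" for \<xi> \<eta> I
  proof -
    let ?C = "C (max (norm \<xi>) (norm \<eta>))"
    show ?thesis
    proof (rule Bochner_Integration.integrable_bound[OF integrable_mult_right[OF W4, of ?C]])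
      show "AE p in ?E \<Otimes>\<^sub>M ?J. norm (k (\<xi>, \<eta>, I, p)) \<le> norm (?C * ?W (snd p))"
        using A4 by eventually_elim (auto intro!: order_trans[OF C abs_ge_self] simp: case_prod_beta)
    qed (use k3 in \<open>simp cong: measurable_cong_sets add: sEJ\<close>)
  qed
  have i3: "integrable (?B \<Otimes>\<^sub>M ?E \<Otimes>\<^sub>M ?J) (\<lambda>p. k (\<xi>, \<eta>, p))" for \<xi> \<eta>
  proof -
    let ?C = "C (max (norm \<xi>) (norm \<eta>))"
    show ?thesis
    proof (rule Bochner_Integration.integrable_bound[OF integrable_mult_right[OF W3, of ?C]])
      show "AE p in ?B \<Otimes>\<^sub>M ?E \<Otimes>\<^sub>M ?J. norm (k (\<xi>, \<eta>, p)) \<le> norm (?C * ?W (snd (snd p)))"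
        using A3 by eventually_elim (auto intro!: order_trans[OF C abs_ge_self] simp: case_prod_beta)
    qed (use k2 in \<open>simp cong: measurable_cong_sets add: sBEJ\<close>)
  qed
  have i2: "integrable (?T \<Otimes>\<^sub>M ?B \<Otimes>\<^sub>M ?E \<Otimes>\<^sub>M ?J) (\<lambda>p. k (\<xi>, p))" for \<xi>
  proof -
    let ?C = "C (max (norm \<xi>) (CARD('m)))"
    show ?thesis
    proof (rule Bochner_Integration.integrable_bound[OF integrable_mult_right[OF W2, of ?C]])
      show "AE p in ?T \<Otimes>\<^sub>M ?B \<Otimes>\<^sub>M ?E \<Otimes>\<^sub>M ?J. norm (k (\<xi>, p)) \<le> norm (?C * ?W (snd (snd (snd p))))"
        using A2 by eventually_elim (auto intro!: order_trans[OF C abs_ge_self] simp: case_prod_beta)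
    qed (use k1 in \<open>simp cong: measurable_cong_sets add: sTBEJ\<close>)
  qed
  show i1: "integrable (step_law \<nu> e h) k"
  proof -
    let ?C = "C (max (CARD('d)) (CARD('m)))"
    show ?thesis unfolding step_law_def
    proof (rule Bochner_Integration.integrable_bound[OF integrable_mult_right[OF W1, of ?C]])
      show "AE p in ?S \<Otimes>\<^sub>M ?T \<Otimes>\<^sub>M ?B \<Otimes>\<^sub>M ?E \<Otimes>\<^sub>M ?J. norm (k p) \<le> norm (?C * ?W (snd (snd (snd (snd p)))))"
        using A1 by eventually_elim (auto intro!: order_trans[OF C abs_ge_self] simp: case_prod_beta)
    qed (use k sets_step_law[of \<nu> e h] in \<open>simp cong: measurable_cong_sets add: step_law_def\<close>)
  qed
  have clk: "(\<integral>p. k (\<xi>, \<eta>, p) \<partial>(?B \<Otimes>\<^sub>M ?E \<Otimes>\<^sub>M ?J)) = (\<integral>w. \<integral>z. k (\<xi>, \<eta>, fst w, snd w, z) \<partial>?J \<partial>clock ?r h)" for \<xi> \<eta>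
  proof -
    let ?q = "\<lambda>w. \<integral>z. k (\<xi>, \<eta>, fst w, snd w, z) \<partial>?J"
    let ?C = "C (max (norm \<xi>) (norm \<eta>))"
    have "\<bar>k (0, 0, True, h, 0)\<bar> \<le> ?C * (1 + norm (0 :: real ^ 'm)) ^ n"
      by (rule C) (use h in \<open>auto simp: le_max_iff_disj\<close>)
    then have C0: "0 \<le> ?C" by simp
    have qm: "?q \<in> borel_measurable (count_space UNIV \<Otimes>\<^sub>M borel)"
      by (rule J.borel_measurable_lebesgue_integral) measurable
    have qb: "\<bar>?q w\<bar> \<le> (\<integral>z. ?C * ?W z \<partial>?J)" if "0 < snd w" "snd w \<le> h" for w
    proof (rule order_trans[OF integral_abs_bound], rule integral_mono')
      show "integrable ?J (\<lambda>z. ?C * ?W z)" using int by simp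
    qed (use C C0 that in auto)
    have qi: "integrable (clock ?r h) ?q"
      by (rule clock_bounded_integrable[OF lam h qm qb])
    have "(\<integral>p. k (\<xi>, \<eta>, p) \<partial>(?B \<Otimes>\<^sub>M ?E \<Otimes>\<^sub>M ?J)) = (\<integral>I. \<integral>p. k (\<xi>, \<eta>, I, p) \<partial>(?E \<Otimes>\<^sub>M ?J) \<partial>?B)"
      by (rule P3.integral_fst'[symmetric, OF i3])
    also have "\<dots> = (\<integral>I. \<integral>\<delta>. \<integral>z. k (\<xi>, \<eta>, I, \<delta>, z) \<partial>?J \<partial>?E \<partial>?B)"
      by (subst P4.integral_fst'[symmetric, OF i4]) simp
    also have "\<dots> = (\<integral>w. ?q w \<partial>clock ?r h)"
      using P5.integral_fst'[of ?q] qi by (simp add: clock_def)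
    finally show ?thesis .
  qed
  let ?Q = "\<lambda>\<zeta>. \<integral>w. \<integral>z. k (fst \<zeta>, snd \<zeta>, fst w, snd w, z) \<partial>?J \<partial>clock ?r h"
  have Qi: "integrable sign_pair ?Q"
  proof -
    let ?C = "C (max (CARD('d)) (CARD('m)))"
    have "\<bar>k (0, 0, True, h, 0)\<bar> \<le> ?C * (1 + norm (0 :: real ^ 'm)) ^ n"
      by (rule C) (use h in \<open>auto simp: le_max_iff_disj\<close>)
    then have C0: "0 \<le> ?C" by simp
    have qm: "(\<lambda>p. \<integral>z. k (fst (fst p), snd (fst p), fst (snd p), snd (snd p), z) \<partial>?J)
      \<in> borel_measurable ((borel \<Otimes>\<^sub>M borel) \<Otimes>\<^sub>M (count_space UNIV \<Otimes>\<^sub>M borel))"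
      by (rule J.borel_measurable_lebesgue_integral) measurable
    have Qm: "?Q \<in> borel_measurable (borel \<Otimes>\<^sub>M borel)"
      by (rule C.borel_measurable_lebesgue_integral) (use qm in \<open>simp add: case_prod_beta' cong: measurable_cong_sets add: sets_pair_measure_cong[OF refl sets_clock]\<close>)
    show ?thesis
    proof (rule sign_pair_integrable[OF Qm])
      fix \<zeta> :: "(real ^ 'd) \<times> (real ^ 'm)" assume "sign_bounded \<zeta>"
      then have \<zeta>: "norm (fst \<zeta>) \<le> max (CARD('d)) (CARD('m))" "norm (snd \<zeta>) \<le> max (CARD('d)) (CARD('m))"
        by (auto simp: sign_bounded_def)
      have qb: "\<bar>\<integral>z. k (fst \<zeta>, snd \<zeta>, fst w, snd w, z) \<partial>?J\<bar> \<le> (\<integral>z. ?C * ?W z \<partial>?J)" if "0 < snd w" "snd w \<le> h" for w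
      proof (rule order_trans[OF integral_abs_bound], rule integral_mono')
        show "integrable ?J (\<lambda>z. ?C * ?W z)" using int by simp
      qed (use C C0 \<zeta> that in auto)
      have "\<bar>?Q \<zeta>\<bar> \<le> (\<integral>w. \<bar>\<integral>z. k (fst \<zeta>, snd \<zeta>, fst w, snd w, z) \<partial>?J\<bar> \<partial>clock ?r h)" by (rule integral_abs_bound)
      also have "\<dots> \<le> (\<integral>w. (\<integral>z. ?C * ?W z \<partial>?J) \<partial>clock ?r h)"
      proof (rule integral_mono_AE')
        show "AE w in clock ?r h. \<bar>\<integral>z. k (fst \<zeta>, snd \<zeta>, fst w, snd w, z) \<partial>?J\<bar> \<le> (\<integral>z. ?C * ?W z \<partial>?J)"
          by (rule eventually_mono[OF AE_clock[OF lam h]]) (use qb in blast)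
      qed (use C0 in \<open>auto intro!: mult_nonneg_nonneg integral_nonneg_AE\<close>)
      finally show "\<bar>?Q \<zeta>\<bar> \<le> (\<integral>z. ?C * ?W z \<partial>?J)" by (simp add: C.prob_space)
    qed
  qed
  have "(\<integral>w. k w \<partial>step_law \<nu> e h) = (\<integral>\<xi>. \<integral>p. k (\<xi>, p) \<partial>(?T \<Otimes>\<^sub>M ?B \<Otimes>\<^sub>M ?E \<Otimes>\<^sub>M ?J) \<partial>?S)"
    unfolding step_law_def by (rule P1.integral_fst'[symmetric]) (use i1 in \<open>simp add: step_law_def\<close>)
  also have "\<dots> = (\<integral>\<xi>. \<integral>\<eta>. \<integral>p. k (\<xi>, \<eta>, p) \<partial>(?B \<Otimes>\<^sub>M ?E \<Otimes>\<^sub>M ?J) \<partial>?T \<partial>?S)"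
    by (subst P2.integral_fst'[symmetric, OF i2]) simp
  also have "\<dots> = (\<integral>\<zeta>. ?Q \<zeta> \<partial>sign_pair)"
    unfolding clk using P6.integral_fst'[OF Qi] by simp
  finally show "(\<integral>w. k w \<partial>step_law \<nu> e h) = (\<integral>\<zeta>. ?Q \<zeta> \<partial>sign_pair)" .
qed

section \<open>The expected value after one step\<close>

text \<open>The step starts at \<open>x\<close>, and \<open>V \<theta>\<close> is the solution a time \<open>\<theta>\<close> later.  Its increments \<open>V \<theta> - V 0\<close> are
  of order \<open>\<theta>\<close> together with their first two space derivatives.\<close>

locale one_step =
  fixes n :: nat and R h :: real and \<nu> :: "real ^ 'm \<Rightarrow> real" and e :: real
    and x b :: "real ^ 'd" and \<sigma> :: "real ^ 'd ^ 'd" and \<beta> :: "real ^ 'm ^ 'm" and F :: "real ^ 'm ^ 'd"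
    and c K :: real and V :: "real \<Rightarrow> real ^ 'd \<Rightarrow> real"
  assumes R: "1 \<le> R" and lev: "levy_density \<nu>"
    and int: "integrable (levy \<nu>) (\<lambda>z. (norm z)\<^sup>2 * (1 + norm z) ^ n)"
    and e: "0 < e" and lam: "0 < intensity \<nu> e" and h: "0 < h" "h \<le> R"
    and x: "norm x \<le> R" and b: "norm b \<le> R" and F: "norm F \<le> R" and c: "\<bar>c\<bar> \<le> R"
    and drift: "norm (drift_corr \<nu> e) \<le> R * intensity \<nu> e"
    and noise: "\<And>\<zeta>. sign_bounded \<zeta> \<Longrightarrow> norm (\<sigma> *v fst \<zeta> + F *v (\<beta> *v snd \<zeta>)) \<le> R"
    and V_measurable: "case_prod V \<in> borel_measurable (borel \<Otimes>\<^sub>M borel)"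
    and V0: "smooth_wt n 4 K (V 0)"
    and V_incr: "\<And>\<theta>. 0 \<le> \<theta> \<Longrightarrow> \<theta> \<le> h \<Longrightarrow> smooth_wt n 2 (K * \<theta>) (\<lambda>y. V \<theta> y - V 0 y)"
begin

definition "lam = intensity \<nu> e"
definition "\<gamma> = drift_corr \<nu> e"
definition "S \<zeta> = \<sigma> *v fst \<zeta> + F *v (\<beta> *v snd \<zeta>)"
definition "pre \<theta> \<zeta> = x + \<theta> *\<^sub>R (b - F *v \<gamma>) + sqrt \<theta> *\<^sub>R S \<zeta>"
definition "w \<theta> y = V \<theta> y - V 0 y"
text \<open>The value after the step, per unit of the functional \<open>Y\<close> and without the source term.\<close>

definition "H N = (case N of (\<xi>, \<eta>, I, \<delta>, z) \<Rightarrow> let \<theta> = (if I then \<delta> else h) in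
  (1 + \<theta> * c) * V \<theta> (pre \<theta> (\<xi>, \<eta>) + (if I then F *v z else 0)))"

lemma lam_pos: "0 < lam" using lam by (simp add: lam_def)

lemma K: "0 \<le> K" by (rule smooth_wt_nonneg[OF V0])

lemma S_uminus: "S (- \<zeta>) = - S \<zeta>"
  by (simp add: S_def linear_neg[OF matrix_vector_mul_linear])

lemma S_measurable [measurable]: "S \<in> borel_measurable (borel \<Otimes>\<^sub>M borel)"
proof -
  have "continuous_on UNIV S"
    unfolding S_def by (intro continuous_intros matrix_vector_mult_linear_continuous_on[THEN continuous_on_compose2])
       auto
  then show ?thesis unfolding borel_prod by (rule borel_measurable_continuous_onI)
qed

lemma pre_measurable [measurable]: "(\<lambda>(\<theta>, \<zeta>). pre \<theta> \<zeta>) \<in> borel_measurable (borel \<Otimes>\<^sub>M (borel \<Otimes>\<^sub>M borel))"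
  unfolding pre_def by measurable

lemma V_comp [measurable (raw)]:
  assumes "f \<in> borel_measurable M" "g \<in> borel_measurable M"
  shows "(\<lambda>w. V (f w) (g w)) \<in> borel_measurable M"
  using measurable_compose[OF measurable_Pair[OF assms] V_measurable] by simp

lemma pre_comp [measurable (raw)]:
  assumes "f \<in> borel_measurable M" "g \<in> M \<rightarrow>\<^sub>M (borel \<Otimes>\<^sub>M borel)"
  shows "(\<lambda>w. pre (f w) (g w)) \<in> borel_measurable M"
  using measurable_compose[OF measurable_Pair[OF assms] pre_measurable] by simp

lemma F_measurable [measurable]: "(\<lambda>z. F *v z) \<in> borel_measurable borel"
  by (intro borel_measurable_continuous_onI matrix_vector_mult_linear_continuous_on)

lemma H_measurable: "H \<in> borel_measurable noise_space"
  unfolding H_def[abs_def] Let_def case_prod_beta' by measurable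

lemma V_bound:
  assumes "0 \<le> \<theta>" "\<theta> \<le> h"
  shows "\<bar>V \<theta> y\<bar> \<le> K * (1 + R) * (1 + norm y) ^ n"
proof -
  have "\<bar>w \<theta> y\<bar> \<le> K * \<theta> * (1 + norm y) ^ n"
    using smooth_wt_bound[OF V_incr[OF assms], of y] by (simp add: w_def)
  also have "\<dots> \<le> K * R * (1 + norm y) ^ n"
    using assms h K by (intro mult_right_mono mult_left_mono) auto
  finally have "\<bar>V \<theta> y - V 0 y\<bar> \<le> K * R * (1 + norm y) ^ n" by (simp add: w_def)
  then show ?thesis using smooth_wt_bound[OF V0, of y] by (simp add: algebra_simps)
qed

lemma V_smooth: "0 \<le> \<theta> \<Longrightarrow> \<theta> \<le> h \<Longrightarrow> smooth_wt n 2 (K + K * \<theta>) (V \<theta>)"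
  using smooth_wt_add[OF smooth_wt_antimono[OF V0, of 2] V_incr[of \<theta>]] by simp

lemma norm_S_le: "norm (S (\<xi>, \<eta>)) \<le> norm \<sigma> * norm \<xi> + norm F * (norm \<beta> * norm \<eta>)"
proof -
  have "norm (F *v (\<beta> *v \<eta>)) \<le> norm F * (norm \<beta> * norm \<eta>)"
    using norm_matrix_vector_le[of F "\<beta> *v \<eta>"] mult_left_mono[OF norm_matrix_vector_le[of \<beta> \<eta>] norm_ge_zero[of F]] by linarith
  then show ?thesis
    using norm_triangle_ineq[of "\<sigma> *v \<xi>" "F *v (\<beta> *v \<eta>)"] norm_matrix_vector_le[of \<sigma> \<xi>] by (simp add: S_def)
qed

definition "H_const s = (1 + R\<^sup>2) * (K * (1 + R) * ((1 + (R + R * (R + R * (R * lam)) + R * s)) ^ n * (1 + R) ^ n))"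

text \<open>The constant does not involve the starting point, which is needed for a majorant that is uniform
  over \<open>G\<close>.\<close>

lemma H_bound_S:
  assumes S: "norm (S (\<xi>, \<eta>)) \<le> s" and \<delta>: "0 < \<delta>" "\<delta> \<le> h"
  shows "\<bar>H (\<xi>, \<eta>, I, \<delta>, z)\<bar> \<le> H_const s * (1 + norm z) ^ n"
proof -
  define q where "q = R + R * (R + R * (R * lam)) + R * s"
  define \<theta> where "\<theta> = (if I then \<delta> else h)"
  have \<theta>: "0 \<le> \<theta>" "\<theta> \<le> h" using \<delta> h by (auto simp: \<theta>_def)
  define y where "y = (if I then F *v z else 0)"
  have "norm (F *v \<gamma>) \<le> R * (R * lam)"
    using norm_matrix_vector_le[of F \<gamma>] mult_mono[OF F drift] R by (simp add: \<gamma>_def lam_def)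
  then have \<mu>: "norm (b - F *v \<gamma>) \<le> R + R * (R * lam)"
    using norm_triangle_ineq4[of b "F *v \<gamma>"] b by linarith
  have sq: "sqrt \<theta> \<le> R"
  proof -
    have "sqrt \<theta> \<le> sqrt (R * R)" using \<theta> h R mult_left_mono[of 1 R R] by (intro real_sqrt_le_mono) linarith
    then show ?thesis using R by simp
  qed
  have "norm (pre \<theta> (\<xi>, \<eta>)) \<le> norm x + norm (\<theta> *\<^sub>R (b - F *v \<gamma>)) + norm (sqrt \<theta> *\<^sub>R S (\<xi>, \<eta>))"
    unfolding pre_def using norm_triangle_ineq[of "x + \<theta> *\<^sub>R (b - F *v \<gamma>)" "sqrt \<theta> *\<^sub>R S (\<xi>, \<eta>)"]
      norm_triangle_ineq[of x "\<theta> *\<^sub>R (b - F *v \<gamma>)"] by linarith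
  also have "\<dots> \<le> q"
    unfolding q_def norm_scaleR using \<theta> S \<mu> sq x h R by (intro add_mono mult_mono) auto
  finally have p: "norm (pre \<theta> (\<xi>, \<eta>)) \<le> q" .
  have q: "0 \<le> q" using p norm_ge_zero order_trans by blast
  have W: "(1 + norm (pre \<theta> (\<xi>, \<eta>) + y)) ^ n \<le> (1 + q) ^ n * ((1 + R) ^ n * (1 + norm z) ^ n)"
  proof -
    have "(1 + norm y) ^ n \<le> (1 + R) ^ n * (1 + norm z) ^ n"
    proof (cases I)
      case False
      have "1 * 1 \<le> (1 + R) ^ n * (1 + norm z) ^ n" using R by (intro mult_mono one_le_power) auto
      then show ?thesis using False by (simp add: y_def)
    qed (simp add: y_def weight_jump_le[OF F])
    moreover have "(1 + norm (pre \<theta> (\<xi>, \<eta>))) ^ n \<le> (1 + q) ^ n" using p by (intro power_mono) auto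
    ultimately have "(1 + norm (pre \<theta> (\<xi>, \<eta>))) ^ n * (1 + norm y) ^ n \<le> (1 + q) ^ n * ((1 + R) ^ n * (1 + norm z) ^ n)"
      using q by (intro mult_mono) auto
    then show ?thesis using weight_add_le[of "pre \<theta> (\<xi>, \<eta>)" y n] by linarith
  qed
  have "\<bar>\<theta> * c\<bar> \<le> R * R" unfolding abs_mult using \<theta> h c R by (intro mult_mono) auto
  then have A: "\<bar>1 + \<theta> * c\<bar> \<le> 1 + R\<^sup>2" by (simp add: power2_eq_square)
  have "\<bar>H (\<xi>, \<eta>, I, \<delta>, z)\<bar> = \<bar>1 + \<theta> * c\<bar> * \<bar>V \<theta> (pre \<theta> (\<xi>, \<eta>) + y)\<bar>"
    by (simp add: H_def \<theta>_def y_def Let_def abs_mult)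
  also have "\<dots> \<le> (1 + R\<^sup>2) * (K * (1 + R) * (1 + norm (pre \<theta> (\<xi>, \<eta>) + y)) ^ n)"
    by (intro mult_mono A V_bound \<theta>) auto
  also have "\<dots> \<le> (1 + R\<^sup>2) * (K * (1 + R) * ((1 + q) ^ n * ((1 + R) ^ n * (1 + norm z) ^ n)))"
    using K R by (intro mult_left_mono W) auto
  finally show ?thesis by (simp add: H_const_def q_def mult_ac)
qed

lemma H_bound: "\<exists>C. \<forall>\<xi> \<eta> I \<delta> z. norm \<xi> \<le> r \<longrightarrow> norm \<eta> \<le> r \<longrightarrow> 0 < \<delta> \<longrightarrow> \<delta> \<le> h \<longrightarrow>
      \<bar>H (\<xi>, \<eta>, I, \<delta>, z)\<bar> \<le> C * (1 + norm z) ^ n"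
proof -
  let ?s = "norm \<sigma> * \<bar>r\<bar> + norm F * (norm \<beta> * \<bar>r\<bar>)"
  have "norm (S (\<xi>, \<eta>)) \<le> ?s" if "norm \<xi> \<le> r" "norm \<eta> \<le> r" for \<xi> \<eta>
    using that by (intro order_trans[OF norm_S_le] add_mono mult_left_mono) auto
  then show ?thesis using H_bound_S[where s = ?s] by blast
qed

lemma W_jump_integrable: "integrable (jump_law \<nu> e) (\<lambda>z. (1 + norm z) ^ n)"
  unfolding jump_law_integral(1)[OF lev _ lam, of "\<lambda>z. (1 + norm z) ^ n", simplified]
  by (rule set_integrable_weight_away[OF int e, of _ 1]) auto

text \<open>The mean of \<open>H\<close> over the jump size, in terms of the jump operator.\<close>

definition "A \<zeta> c' = (let \<theta> = dur h c' in (1 + \<theta> * c) * V \<theta> (pre \<theta> \<zeta>))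
  + of_bool (fst c') / lam * ((1 + snd c' * c) * jump_op \<nu> e F (V (snd c')) (pre (snd c') \<zeta>))"

lemma integrate_jump:
  assumes "0 < snd c'" "snd c' \<le> h"
  shows "(\<integral>z. H (fst \<zeta>, snd \<zeta>, fst c', snd c', z) \<partial>jump_law \<nu> e) = A \<zeta> c'"
proof (cases "fst c'")
  case False
  interpret J: prob_space "jump_law \<nu> e" by (rule prob_space_jump_law[OF lev e lam])
  show ?thesis using False by (simp add: H_def A_def dur_def case_prod_beta Let_def J.prob_space)
next
  case True
  interpret J: prob_space "jump_law \<nu> e" by (rule prob_space_jump_law[OF lev e lam])
  define \<theta> where "\<theta> = snd c'"
  define y where "y = pre \<theta> \<zeta>"
  have v: "smooth_wt n 2 (K + K * \<theta>) (V \<theta>)" using assms by (intro V_smooth) (auto simp: \<theta>_def)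
  have m [measurable]: "(\<lambda>z. V \<theta> (y + F *v z) - V \<theta> y) \<in> borel_measurable borel" by measurable
  have i: "integrable (jump_law \<nu> e) (\<lambda>z. V \<theta> (y + F *v z) - V \<theta> y)"
    unfolding jump_law_integral(1)[OF lev m lam] by (rule jump_increment_integrable[OF int e v]) simp
  have "(\<integral>z. H (fst \<zeta>, snd \<zeta>, fst c', snd c', z) \<partial>jump_law \<nu> e)
    = (\<integral>z. (1 + \<theta> * c) * (V \<theta> y + (V \<theta> (y + F *v z) - V \<theta> y)) \<partial>jump_law \<nu> e)"
    using True by (simp add: H_def \<theta>_def y_def Let_def)
  also have "\<dots> = (1 + \<theta> * c) * (V \<theta> y + (\<integral>z. V \<theta> (y + F *v z) - V \<theta> y \<partial>jump_law \<nu> e))"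
    by (subst integral_mult_right_zero, subst Bochner_Integration.integral_add)
       (use i in \<open>simp_all add: J.prob_space\<close>)
  also have "(\<integral>z. V \<theta> (y + F *v z) - V \<theta> y \<partial>jump_law \<nu> e) = jump_op \<nu> e F (V \<theta>) y / lam"
    unfolding jump_law_integral(2)[OF lev m] by (simp add: jump_op_def lam_def)
  finally show ?thesis using True by (simp add: A_def dur_def case_prod_beta Let_def \<theta>_def y_def algebra_simps add_divide_distrib)
qed

text \<open>The integral itself agrees with \<open>A\<close> for admissible clock values only, but it is measurable in all its
  arguments by Fubini's theorem.\<close>

definition "A0 \<zeta> c' = (\<integral>z. H (fst \<zeta>, snd \<zeta>, fst c', snd c', z) \<partial>jump_law \<nu> e)"

lemma A0_eq: "0 < snd c' \<Longrightarrow> snd c' \<le> h \<Longrightarrow> A0 \<zeta> c' = A \<zeta> c'"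
  unfolding A0_def by (rule integrate_jump)

lemma A0_measurable [measurable]:
  "(\<lambda>p. A0 (fst p) (snd p)) \<in> borel_measurable ((borel \<Otimes>\<^sub>M borel) \<Otimes>\<^sub>M (count_space UNIV \<Otimes>\<^sub>M borel))"
proof -
  interpret J: prob_space "jump_law \<nu> e" by (rule prob_space_jump_law[OF lev e lam])
  note [measurable] = H_measurable
  show ?thesis unfolding A0_def
    by (rule J.borel_measurable_lebesgue_integral) measurable
qed

lemma A0_bound: "\<exists>C. \<forall>\<zeta> c'. norm (fst \<zeta>) \<le> r \<longrightarrow> norm (snd \<zeta>) \<le> r \<longrightarrow> 0 < snd c' \<longrightarrow> snd c' \<le> h \<longrightarrow> \<bar>A0 \<zeta> c'\<bar> \<le> C"
proof -
  obtain C where C: "\<And>\<xi> \<eta> I \<delta> z. norm \<xi> \<le> r \<Longrightarrow> norm \<eta> \<le> r \<Longrightarrow> 0 < \<delta> \<Longrightarrow> \<delta> \<le> h \<Longrightarrow>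
      \<bar>H (\<xi>, \<eta>, I, \<delta>, z)\<bar> \<le> C * (1 + norm z) ^ n" using H_bound[of r] by blast
  have "\<bar>A0 \<zeta> c'\<bar> \<le> (\<integral>z. \<bar>C\<bar> * (1 + norm z) ^ n \<partial>jump_law \<nu> e)"
    if "norm (fst \<zeta>) \<le> r" "norm (snd \<zeta>) \<le> r" "0 < snd c'" "snd c' \<le> h" for \<zeta> c'
    unfolding A0_def
  proof (rule order_trans[OF integral_abs_bound], rule integral_mono')
    show "integrable (jump_law \<nu> e) (\<lambda>z. \<bar>C\<bar> * (1 + norm z) ^ n)" using W_jump_integrable by simp
    show "\<bar>H (fst \<zeta>, snd \<zeta>, fst c', snd c', z)\<bar> \<le> \<bar>C\<bar> * (1 + norm z) ^ n" for z
      using C[OF that, of "fst c'" z] mult_right_mono[OF abs_ge_self[of C], of "(1 + norm z) ^ n"] by simp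
  qed auto
  then show ?thesis by blast
qed

lemma A0_integrable: "integrable (clock lam h) (A0 \<zeta>)"
proof -
  obtain C where C: "\<And>\<zeta>' c'. norm (fst \<zeta>') \<le> max (norm (fst \<zeta>)) (norm (snd \<zeta>)) \<Longrightarrow>
    norm (snd \<zeta>') \<le> max (norm (fst \<zeta>)) (norm (snd \<zeta>)) \<Longrightarrow> 0 < snd c' \<Longrightarrow> snd c' \<le> h \<Longrightarrow> \<bar>A0 \<zeta>' c'\<bar> \<le> C"
    using A0_bound[of "max (norm (fst \<zeta>)) (norm (snd \<zeta>))"] by blast
  have "(\<lambda>c'. A0 (fst (\<zeta>, c')) (snd (\<zeta>, c'))) \<in> borel_measurable (count_space UNIV \<Otimes>\<^sub>M borel)"
    by (rule measurable_compose[OF measurable_Pair1' A0_measurable]) (simp add: space_pair_measure)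
  then show ?thesis
    by (intro clock_bounded_integrable[OF lam_pos h(1), of _ C]) (auto intro!: C)
qed

definition "mean_clock \<zeta> = (\<integral>c'. A0 \<zeta> c' \<partial>clock lam h)"

lemma mean_clock_measurable: "mean_clock \<in> borel_measurable (borel \<Otimes>\<^sub>M borel)"
proof -
  interpret C: prob_space "clock lam h" by (rule prob_space_clock[OF lam_pos h(1)])
  show ?thesis unfolding mean_clock_def
    by (rule C.borel_measurable_lebesgue_integral)
       (use A0_measurable in \<open>simp add: case_prod_beta' cong: measurable_cong_sets add: sets_pair_measure_cong[OF refl sets_clock]\<close>)
qed

lemma mean_clock_bound: "\<exists>C. \<forall>\<zeta>. sign_bounded \<zeta> \<longrightarrow> \<bar>mean_clock \<zeta>\<bar> \<le> C"
proof -
  interpret C: prob_space "clock lam h" by (rule prob_space_clock[OF lam_pos h(1)])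
  let ?r = "max (CARD('d)) (CARD('m))"
  obtain C where C: "\<And>\<zeta>' c'. norm (fst \<zeta>') \<le> ?r \<Longrightarrow> norm (snd \<zeta>') \<le> ?r \<Longrightarrow> 0 < snd c' \<Longrightarrow> snd c' \<le> h \<Longrightarrow> \<bar>A0 \<zeta>' c'\<bar> \<le> C"
    using A0_bound[of ?r] by blast
  have "\<bar>mean_clock \<zeta>\<bar> \<le> C" if "sign_bounded \<zeta>" for \<zeta>
  proof -
    have "\<bar>mean_clock \<zeta>\<bar> \<le> (\<integral>c'. \<bar>A0 \<zeta> c'\<bar> \<partial>clock lam h)" unfolding mean_clock_def by (rule integral_abs_bound)
    also have "\<dots> \<le> (\<integral>c'. C \<partial>clock lam h)"
    proof (rule integral_mono_AE)
      show "AE c' in clock lam h. \<bar>A0 \<zeta> c'\<bar> \<le> C"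
        by (rule eventually_mono[OF AE_clock[OF lam_pos h(1)]])
           (use that in \<open>auto intro!: C simp: sign_bounded_def le_max_iff_disj\<close>)
    qed (use A0_integrable in auto)
    finally show ?thesis by (simp add: C.prob_space)
  qed
  then show ?thesis by blast
qed

definition "g = 1 + norm \<gamma>"
text \<open>The expansion of the mean over the clock, and the constant in its remainder.\<close>

definition "E0 \<zeta> = V 0 x + (\<integral>c'. w (dur h c') x \<partial>clock lam h)
  + mean_step lam h * (dird (b - F *v \<gamma>) (V 0) x + dird (S \<zeta>) (dird (S \<zeta>) (V 0)) x / 2 + c * V 0 x)
  + mean_step lam h * jump_op \<nu> e F (V 0) x"
definition "cT = (euler_step.cP TYPE('d) n R K + euler_jump_step.cQ TYPE('d) n R \<nu> K) * ((real n + 3) * fact (n + 2))"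

lemma euler_jump_step_at:
  assumes "sign_bounded \<zeta>" "0 \<le> \<theta>" "\<theta> \<le> h"
  shows "euler_jump_step n R lam \<theta> x b (S \<zeta>) F \<gamma> \<nu> e"
  by unfold_locales
    (use assms R lam_pos h x b F noise[OF assms(1)] drift lev int e in \<open>auto simp: S_def lam_def \<gamma>_def\<close>)

lemma symmetric_pair_expansion:
  assumes \<zeta>: "sign_bounded \<zeta>" and c': "0 < snd c'" "snd c' \<le> h"
  shows "\<bar>(A \<zeta> c' + A (- \<zeta>) c') / 2
    - (V 0 x + w (dur h c') x + dur h c' * (dird (b - F *v \<gamma>) (V 0) x + dird (S \<zeta>) (dird (S \<zeta>) (V 0)) x / 2 + c * V 0 x)
      + of_bool (fst c') / lam * jump_op \<nu> e F (V 0) x)\<bar>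
    \<le> (euler_step.cP TYPE('d) n R K + euler_jump_step.cQ TYPE('d) n R \<nu> K) * g\<^sup>2
      * ((dur h c')\<^sup>2 * (1 + lam * dur h c') ^ n + of_bool (fst c') * (snd c' * (1 + lam * snd c') ^ n) / lam)"
proof -
  define \<theta> \<delta> where "\<theta> = dur h c'" and "\<delta> = snd c'"
  define I :: real where "I = of_bool (fst c') / lam"
  have I0: "0 \<le> I" using lam_pos by (simp add: I_def)
  have \<theta>: "0 \<le> \<theta>" "\<theta> \<le> h" using c' h by (auto simp: \<theta>_def dur_def case_prod_beta split: if_splits)
  have \<delta>: "0 \<le> \<delta>" "\<delta> \<le> h" using c' by (auto simp: \<delta>_def)
  interpret T: euler_jump_step n R lam \<theta> x b "S \<zeta>" F \<gamma> \<nu> e by (rule euler_jump_step_at[OF \<zeta> \<theta>])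
  interpret D: euler_jump_step n R lam \<delta> x b "S \<zeta>" F \<gamma> \<nu> e by (rule euler_jump_step_at[OF \<zeta> \<delta>])
  have preT: "pre \<theta> \<zeta> = T.p + T.s" "pre \<theta> (- \<zeta>) = T.p - T.s"
    by (simp_all add: pre_def T.p_def T.s_def T.\<mu>_def S_uminus)
  have preD: "pre \<delta> \<zeta> = D.p + D.s" "pre \<delta> (- \<zeta>) = D.p - D.s"
    by (simp_all add: pre_def D.p_def D.s_def D.\<mu>_def S_uminus)
  have V: "V r = (\<lambda>y. V 0 y + w r y)" for r by (simp add: w_def fun_eq_iff)
  have wT: "smooth_wt n 2 (K * \<theta>) (w \<theta>)" using V_incr[OF \<theta>] by (simp add: w_def[abs_def])
  have wD: "smooth_wt n 2 (K * \<delta>) (w \<delta>)" using V_incr[OF \<delta>] by (simp add: w_def[abs_def])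
  define XT where "XT = ((1 + \<theta> * c) * V \<theta> (pre \<theta> \<zeta>) + (1 + \<theta> * c) * V \<theta> (pre \<theta> (- \<zeta>))) / 2
    - (V 0 x + w \<theta> x + \<theta> * (dird T.\<mu> (V 0) x + dird (S \<zeta>) (dird (S \<zeta>) (V 0)) x / 2 + c * V 0 x))"
  define XD where "XD = ((1 + \<delta> * c) * jump_op \<nu> e F (V \<delta>) (pre \<delta> \<zeta>) + (1 + \<delta> * c) * jump_op \<nu> e F (V \<delta>) (pre \<delta> (- \<zeta>))) / 2
    - jump_op \<nu> e F (V 0) x"
  have gT: "T.g = g" "D.g = g" by (simp_all add: g_def T.g_def D.g_def)
  have 1: "\<bar>XT\<bar> \<le> T.cP K * (\<theta>\<^sup>2 * g\<^sup>2 * (1 + lam * \<theta>) ^ n)"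
    unfolding XT_def preT V[of \<theta>] gT[symmetric] T.L_def[symmetric] by (rule T.step_without_jump[OF V0 wT c])
  have 2: "\<bar>XD\<bar> \<le> T.cQ K * (\<delta> * g\<^sup>2 * (1 + lam * \<delta>) ^ n)"
    unfolding XD_def preD V[of \<delta>] gT(2)[symmetric] D.L_def[symmetric] by (rule D.step_with_jump[OF V0 wD c])
  note cP0 = T.cP_nonneg[OF K] and cQ0 = T.cQ_nonneg[OF K]
  have eq: "(A \<zeta> c' + A (- \<zeta>) c') / 2
    - (V 0 x + w \<theta> x + \<theta> * (dird T.\<mu> (V 0) x + dird (S \<zeta>) (dird (S \<zeta>) (V 0)) x / 2 + c * V 0 x)
      + I * jump_op \<nu> e F (V 0) x) = XT + I * XD"
    unfolding A_def XT_def XD_def Let_def \<theta>_def[symmetric] \<delta>_def[symmetric] I_def[symmetric]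
    by (simp add: field_simps)
  have "\<bar>I * XD\<bar> \<le> I * (T.cQ K * (\<delta> * g\<^sup>2 * (1 + lam * \<delta>) ^ n))"
    using 2 I0 by (simp add: abs_mult mult_left_mono)
  then have "\<bar>XT + I * XD\<bar> \<le> T.cP K * g\<^sup>2 * (\<theta>\<^sup>2 * (1 + lam * \<theta>) ^ n) + T.cQ K * g\<^sup>2 * (I * (\<delta> * (1 + lam * \<delta>) ^ n))"
    using 1 by (simp add: mult_ac)
  also have "\<dots> \<le> (T.cP K + T.cQ K) * g\<^sup>2 * (\<theta>\<^sup>2 * (1 + lam * \<theta>) ^ n + I * (\<delta> * (1 + lam * \<delta>) ^ n))"
  proof -
    have "0 \<le> T.cQ K * g\<^sup>2 * (\<theta>\<^sup>2 * (1 + lam * \<theta>) ^ n)" "0 \<le> T.cP K * g\<^sup>2 * (I * (\<delta> * (1 + lam * \<delta>) ^ n))"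
      using cP0 cQ0 I0 \<theta> \<delta> lam_pos by auto
    then show ?thesis by (simp add: algebra_simps)
  qed
  finally show ?thesis
    unfolding eq[symmetric] unfolding \<theta>_def \<delta>_def I_def T.\<mu>_def by (simp add: mult_ac)
qed

lemma w_dur_integrable: "integrable (clock lam h) (\<lambda>c'. w (dur h c') x)"
proof (rule clock_integral_dur(1)[OF lam_pos h(1)])
  show "(\<lambda>s. w s x) \<in> borel_measurable borel" unfolding w_def by measurable
  show "\<bar>w s x\<bar> \<le> K * h * (1 + norm x) ^ n" if "0 < s" "s \<le> h" for s
  proof -
    have "\<bar>w s x\<bar> \<le> K * s * (1 + norm x) ^ n"
      using smooth_wt_bound[OF V_incr[of s], of x] that by (simp add: w_def)
    also have "\<dots> \<le> K * h * (1 + norm x) ^ n" using that K by (intro mult_right_mono mult_left_mono) auto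
    finally show ?thesis .
  qed
qed

lemma mean_clock_symmetric:
  assumes \<zeta>: "sign_bounded \<zeta>"
  shows "\<bar>(mean_clock \<zeta> + mean_clock (- \<zeta>)) / 2 - E0 \<zeta>\<bar> \<le> cT * g\<^sup>2 * wt_moment lam h 0"
proof -
  interpret C: prob_space "clock lam h" by (rule prob_space_clock[OF lam_pos h(1)])
  let ?k = "\<lambda>c'. (dur h c')\<^sup>2 * (1 + lam * dur h c') ^ n + of_bool (fst c') * (snd c' * (1 + lam * snd c') ^ n) / lam"
  let ?c = "euler_step.cP TYPE('d) n R K + euler_jump_step.cQ TYPE('d) n R \<nu> K"
  define D where "D = dird (b - F *v \<gamma>) (V 0) x + dird (S \<zeta>) (dird (S \<zeta>) (V 0)) x / 2 + c * V 0 x"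
  define j where "j = jump_op \<nu> e F (V 0) x"
  let ?E = "\<lambda>c'. V 0 x + w (dur h c') x + dur h c' * D + of_bool (fst c') / lam * j"
  have flag: "integrable (clock lam h) (\<lambda>c'. of_bool (fst c') :: real)"
    by (intro clock_bounded_integrable[OF lam_pos h(1), of _ 1]) auto
  note mean = clock_mean[OF lam_pos h(1)]
  have iE: "integrable (clock lam h) ?E"
    using w_dur_integrable mean(1) flag
    by (intro Bochner_Integration.integrable_add integrable_mult_left Bochner_Integration.integrable_divide) auto
  have EE: "(\<integral>c'. ?E c' \<partial>clock lam h) = E0 \<zeta>"
    using w_dur_integrable mean flag lam_pos clock_flag[OF lam_pos h(1)]
    by (simp add: E0_def D_def[symmetric] j_def[symmetric] C.prob_space)
  have iA: "integrable (clock lam h) (\<lambda>c'. (A0 \<zeta> c' + A0 (- \<zeta>) c') / 2)"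
    using A0_integrable by auto
  have "(mean_clock \<zeta> + mean_clock (- \<zeta>)) / 2 = (\<integral>c'. (A0 \<zeta> c' + A0 (- \<zeta>) c') / 2 \<partial>clock lam h)"
    using A0_integrable by (simp add: mean_clock_def)
  then have "(mean_clock \<zeta> + mean_clock (- \<zeta>)) / 2 - E0 \<zeta> = (\<integral>c'. (A0 \<zeta> c' + A0 (- \<zeta>) c') / 2 \<partial>clock lam h) - (\<integral>c'. ?E c' \<partial>clock lam h)"
    by (simp only: EE)
  also have "\<dots> = (\<integral>c'. (A0 \<zeta> c' + A0 (- \<zeta>) c') / 2 - ?E c' \<partial>clock lam h)"
    using iA iE by (rule Bochner_Integration.integral_diff[symmetric])
  finally have "\<bar>(mean_clock \<zeta> + mean_clock (- \<zeta>)) / 2 - E0 \<zeta>\<bar>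
      \<le> (\<integral>c'. \<bar>(A0 \<zeta> c' + A0 (- \<zeta>) c') / 2 - ?E c'\<bar> \<partial>clock lam h)"
    by (simp only: integral_abs_bound)
  also have "\<dots> \<le> (\<integral>c'. ?c * g\<^sup>2 * ?k c' \<partial>clock lam h)"
  proof (rule integral_mono_AE)
    show "integrable (clock lam h) (\<lambda>c'. \<bar>(A0 \<zeta> c' + A0 (- \<zeta>) c') / 2 - ?E c'\<bar>)"
      using iA iE by (intro integrable_abs Bochner_Integration.integrable_diff)
    show "integrable (clock lam h) (\<lambda>c'. ?c * g\<^sup>2 * ?k c')"
      by (rule integrable_mult_right[OF clock_weight_moment(1)[OF lam_pos h(1)]])
    show "AE c' in clock lam h. \<bar>(A0 \<zeta> c' + A0 (- \<zeta>) c') / 2 - ?E c'\<bar> \<le> ?c * g\<^sup>2 * ?k c'"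
      by (rule eventually_mono[OF AE_clock[OF lam_pos h(1)]])
         (use symmetric_pair_expansion[OF \<zeta>] in \<open>simp add: A0_eq D_def j_def\<close>)
  qed
  also have "\<dots> = ?c * g\<^sup>2 * (\<integral>c'. ?k c' \<partial>clock lam h)" by (rule integral_mult_right_zero)
  also have "\<dots> \<le> ?c * g\<^sup>2 * ((real n + 3) * fact (n + 2) * wt_moment lam h 0)"
  proof (rule mult_left_mono[OF clock_weight_moment(2)[OF lam_pos h(1)]])
    interpret T: euler_jump_step n R lam h x b "S \<zeta>" F \<gamma> \<nu> e by (rule euler_jump_step_at[OF \<zeta>]) (use h in auto)
    show "0 \<le> ?c * g\<^sup>2" using T.cP_nonneg[OF K] T.cQ_nonneg[OF K] by simp
  qed
  finally show ?thesis by (simp only: cT_def mult_ac)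
qed

lemma S_cov:
  "integrable sign_pair (\<lambda>\<zeta>. S \<zeta> $ i * S \<zeta> $ j)"
  "(\<integral>\<zeta>. S \<zeta> $ i * S \<zeta> $ j \<partial>sign_pair) = (\<sigma> ** transpose \<sigma> + F ** (\<beta> ** transpose \<beta>) ** transpose F) $ i $ j"
proof -
  have S: "S \<zeta> = \<sigma> *v fst \<zeta> + (F ** \<beta>) *v snd \<zeta>" for \<zeta>
    by (simp add: S_def matrix_vector_mul_assoc)
  show "integrable sign_pair (\<lambda>\<zeta>. S \<zeta> $ i * S \<zeta> $ j)"
    unfolding S by (rule sign_pair_cov)
  have "F ** \<beta> ** transpose (F ** \<beta>) = F ** (\<beta> ** transpose \<beta>) ** transpose F"
    by (simp add: matrix_transpose_mul matrix_mul_assoc)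
  then show "(\<integral>\<zeta>. S \<zeta> $ i * S \<zeta> $ j \<partial>sign_pair) = (\<sigma> ** transpose \<sigma> + F ** (\<beta> ** transpose \<beta>) ** transpose F) $ i $ j"
    unfolding S using sign_pair_cov(2)[of \<sigma> "F ** \<beta>" i j] by simp
qed

text \<open>Averaging over the signs turns the second derivative along the noise into the trace with
  \<open>\<sigma> \<sigma>\<^sup>T + F (\<beta> \<beta>\<^sup>T) F\<^sup>T\<close>; apart from the time increment, the first-order terms are the mean step times
  the generator and the term with \<open>c\<close>.\<close>

theorem one_step_expansion:
  shows "integrable (step_law \<nu> e h) H"
    and "\<bar>(\<integral>N. H N \<partial>step_law \<nu> e h) - (V 0 x + (\<integral>c'. w (dur h c') x \<partial>clock lam h)
      + mean_step lam h * (dird (b - F *v \<gamma>) (V 0) x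
        + 1 / 2 * (\<Sum>i\<in>UNIV. \<Sum>j\<in>UNIV. (\<sigma> ** transpose \<sigma> + F ** (\<beta> ** transpose \<beta>) ** transpose F) $ i $ j * pd i (pd j (V 0)) x)
        + jump_op \<nu> e F (V 0) x + c * V 0 x))\<bar>
      \<le> cT * g\<^sup>2 * wt_moment lam h 0"
proof -
  note law = step_law_integral[OF lev e lam h(1) W_jump_integrable H_measurable H_bound]
  show "integrable (step_law \<nu> e h) H" by (rule law(1))
  interpret P: prob_space "sign_pair :: ((real ^ 'd) \<times> (real ^ 'm)) measure" by (rule prob_space_sign_pair)
  let ?SP = "sign_pair :: ((real ^ 'd) \<times> (real ^ 'm)) measure"
  have f: "smooth_wt n (Suc (Suc 2)) K (V 0)" using V0 by (simp only: Suc_numeral Num.add_num_simps)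
  have EH: "(\<integral>N. H N \<partial>step_law \<nu> e h) = (\<integral>\<zeta>. mean_clock \<zeta> \<partial>?SP)"
    unfolding law(2) mean_clock_def A0_def lam_def ..
  obtain C where C: "\<And>\<zeta>. sign_bounded \<zeta> \<Longrightarrow> \<bar>mean_clock \<zeta>\<bar> \<le> C" using mean_clock_bound by blast
  have sb: "sign_bounded (- \<zeta>) \<longleftrightarrow> sign_bounded \<zeta>" for \<zeta> by (simp add: sign_bounded_def)
  have m: "(\<lambda>\<zeta>. (mean_clock \<zeta> + mean_clock (- \<zeta>)) / 2) \<in> borel_measurable (borel \<Otimes>\<^sub>M borel)"
  proof -
    have "(\<lambda>\<zeta> :: (real ^ 'd) \<times> (real ^ 'm). - \<zeta>) \<in> borel \<Otimes>\<^sub>M borel \<rightarrow>\<^sub>M borel \<Otimes>\<^sub>M borel"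
      unfolding uminus_prod_def by measurable
    from measurable_compose[OF this mean_clock_measurable] show ?thesis
      using mean_clock_measurable by measurable
  qed
  have isym: "integrable ?SP (\<lambda>\<zeta>. (mean_clock \<zeta> + mean_clock (- \<zeta>)) / 2)"
    by (rule sign_pair_integrable[OF m, of C]) (rule half_sum_abs; rule C; simp add: sb)
  let ?M = "\<lambda>i j. (\<sigma> ** transpose \<sigma> + F ** (\<beta> ** transpose \<beta>) ** transpose F) $ i $ j"
  let ?D = "\<lambda>i j. pd i (pd j (V 0)) x"
  have dd: "dird (S \<zeta>) (dird (S \<zeta>) (V 0)) x = (\<Sum>i\<in>UNIV. \<Sum>j\<in>UNIV. S \<zeta> $ i * S \<zeta> $ j * ?D i j)" for \<zeta>
    by (rule dird_dird[OF f])
  have idd: "integrable ?SP (\<lambda>\<zeta>. dird (S \<zeta>) (dird (S \<zeta>) (V 0)) x)"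
    unfolding dd by (intro Bochner_Integration.integrable_sum integrable_mult_left S_cov)
  have Edd: "(\<integral>\<zeta>. dird (S \<zeta>) (dird (S \<zeta>) (V 0)) x \<partial>?SP) = (\<Sum>i\<in>UNIV. \<Sum>j\<in>UNIV. ?M i j * ?D i j)"
    unfolding dd by (simp add: Bochner_Integration.integral_sum S_cov)
  have iE: "integrable ?SP E0"
    unfolding E0_def[abs_def] using idd
    by (intro Bochner_Integration.integrable_add integrable_mult_right Bochner_Integration.integrable_divide) auto
  have EE: "(\<integral>\<zeta>. E0 \<zeta> \<partial>?SP) = V 0 x + (\<integral>c'. w (dur h c') x \<partial>clock lam h)
      + mean_step lam h * (dird (b - F *v \<gamma>) (V 0) x
        + 1 / 2 * (\<Sum>i\<in>UNIV. \<Sum>j\<in>UNIV. ?M i j * ?D i j) + jump_op \<nu> e F (V 0) x + c * V 0 x)"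
    unfolding E0_def[abs_def] using idd by (simp add: Edd P.prob_space algebra_simps)
  have sym: "(\<integral>\<zeta>. mean_clock \<zeta> \<partial>?SP) = (\<integral>\<zeta>. (mean_clock \<zeta> + mean_clock (- \<zeta>)) / 2 \<partial>?SP)"
    by (rule sign_pair_integral_symmetrize[OF mean_clock_measurable C])
  have "(\<integral>N. H N \<partial>step_law \<nu> e h) - (\<integral>\<zeta>. E0 \<zeta> \<partial>?SP) = (\<integral>\<zeta>. (mean_clock \<zeta> + mean_clock (- \<zeta>)) / 2 - E0 \<zeta> \<partial>?SP)"
    unfolding EH sym using isym iE by (rule Bochner_Integration.integral_diff[symmetric])
  then have "\<bar>(\<integral>N. H N \<partial>step_law \<nu> e h) - (\<integral>\<zeta>. E0 \<zeta> \<partial>?SP)\<bar>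
      \<le> (\<integral>\<zeta>. \<bar>(mean_clock \<zeta> + mean_clock (- \<zeta>)) / 2 - E0 \<zeta>\<bar> \<partial>?SP)"
    by (simp only: integral_abs_bound)
  also have "\<dots> \<le> (\<integral>\<zeta>. cT * g\<^sup>2 * wt_moment lam h 0 \<partial>?SP)"
  proof (rule integral_mono_AE)
    show "AE \<zeta> in ?SP. \<bar>(mean_clock \<zeta> + mean_clock (- \<zeta>)) / 2 - E0 \<zeta>\<bar> \<le> cT * g\<^sup>2 * wt_moment lam h 0"
      by (rule eventually_mono[OF AE_sign_pair]) (rule mean_clock_symmetric)
  qed (use isym iE in auto)
  finally show "\<bar>(\<integral>N. H N \<partial>step_law \<nu> e h) - (V 0 x + (\<integral>c'. w (dur h c') x \<partial>clock lam h)
      + mean_step lam h * (dird (b - F *v \<gamma>) (V 0) x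
        + 1 / 2 * (\<Sum>i\<in>UNIV. \<Sum>j\<in>UNIV. ?M i j * ?D i j)
        + jump_op \<nu> e F (V 0) x + c * V 0 x))\<bar>
      \<le> cT * g\<^sup>2 * wt_moment lam h 0"
    unfolding EE[symmetric] by (simp add: P.prob_space)
qed

end

section \<open>Regularity of the solution\<close>

lemma foldr_partial_x_Cons: "foldr partial_x (i # is) v t = pd i (foldr partial_x is v t)"
  by (simp add: fun_eq_iff partial_x_def pd_def)

lemma C_class_smooth_wt:
  assumes C: "C_class t0 T l 4 v" and t: "t \<in> {t0..T}"
    and bound: "\<And>is y. length is \<le> 4 \<Longrightarrow> \<bar>foldr partial_x is v t y\<bar> \<le> A * (1 + norm y) ^ n"
  shows "k + length is \<le> 4 \<Longrightarrow> smooth_wt n k A (foldr partial_x is v t)"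
proof (induction k arbitrary: "is")
  case 0
  then show ?case using bound[of "is"] by simp
next
  case (Suc k)
  have len: "length (i # is) \<le> 4" for i using Suc.prems by simp
  have "(\<lambda>r. foldr partial_x is v t (y + r *\<^sub>R axis i 1)) differentiable at 0" for i y
  proof -
    have "pderivs_exist t0 T 0 (i # is) v" using C len[of i] unfolding C_class_def by blast
    then have "\<forall>n<length (i # is). (\<lambda>r. foldr partial_x (drop (Suc n) (i # is)) v t (y + r *\<^sub>R axis ((i # is) ! n) 1)) differentiable at 0"
      using t unfolding pderivs_exist_def by blast
    from this[rule_format, of 0] show ?thesis by simp
  qed
  moreover have "continuous_on UNIV (pd i (foldr partial_x is v t))" for i
  proof -
    have "continuous_on ({t0..T} \<times> UNIV) (\<lambda>(t, x). pderivs t0 T 0 (i # is) v t x)"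
      using C len[of i] unfolding C_class_def by blast
    then have "continuous_on UNIV ((\<lambda>(t, x). pderivs t0 T 0 (i # is) v t x) \<circ> (\<lambda>x. (t, x)))"
      using t by (intro continuous_on_compose continuous_intros) (auto elim: continuous_on_subset)
    then show ?thesis by (simp add: comp_def pderivs_def foldr_partial_x_Cons[symmetric])
  qed
  ultimately have "(foldr partial_x is v t has_derivative (\<lambda>w. dird w (foldr partial_x is v t) y)) (at y)" for y
    by (rule has_derivative_continuous_partials)
  moreover have "smooth_wt n k A (pd i (foldr partial_x is v t))" for i
    using Suc.IH[of "i # is"] Suc.prems by (simp only: foldr_partial_x_Cons) simp
  ultimately show ?case using bound[of "is"] Suc.prems by simp
qed

lemma pderivs_time_derivative:
  assumes "pderivs_exist t0 T (Suc l) is v" and "s \<in> {t0..T}"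
  shows "((\<lambda>s. pderivs t0 T l is v s y) has_real_derivative pderivs t0 T (Suc l) is v s y) (at s within {t0..T})"
proof -
  have "(\<lambda>s. pderivs t0 T l is v s y) differentiable at s within {t0..T}"
    using assms unfolding pderivs_exist_def by blast
  then show ?thesis
    by (simp add: vector_derivative_works has_real_derivative_iff_has_vector_derivative pderivs_def partial_t_def)
qed

lemma pderivs_time_increment:
  assumes ex: "pderivs_exist t0 T (Suc l) is v" and b: "\<And>s. s \<in> {t0..T} \<Longrightarrow> \<bar>pderivs t0 T (Suc l) is v s y\<bar> \<le> C"
    and t: "t \<in> {t0..T}" "t' \<in> {t0..T}"
  shows "\<bar>pderivs t0 T l is v t' y - pderivs t0 T l is v t y\<bar> \<le> C * \<bar>t' - t\<bar>"
  using field_differentiable_bound[of "{t0..T}" "\<lambda>s. pderivs t0 T l is v s y" "\<lambda>s. pderivs t0 T (Suc l) is v s y" C t' t]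
    pderivs_time_derivative[OF ex] b t by simp

text \<open>The mean value theorem in time is applied to each space derivative separately.  Thus only time
  derivatives of space derivatives enter, and the order of differentiation is never exchanged.\<close>

lemma smooth_wt_time_increment:
  assumes C: "C_class t0 T 2 4 v"
    and bound: "\<And>l is s y. 2 * l + length is \<le> 4 \<Longrightarrow> s \<in> {t0..T} \<Longrightarrow> \<bar>pderivs t0 T l is v s y\<bar> \<le> A * (1 + norm y) ^ n"
    and ex: "\<And>l is. 2 * l + length is \<le> 4 \<Longrightarrow> pderivs_exist t0 T l is v"
    and t: "t \<in> {t0..T}" "t' \<in> {t0..T}"
  shows "k + length is \<le> 2 \<Longrightarrow>
    smooth_wt n k (A * \<bar>t' - t\<bar>) (\<lambda>y. foldr partial_x is v t' y - foldr partial_x is v t y)"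
proof (induction k arbitrary: "is")
  case 0
  have "\<bar>foldr partial_x is v t' y - foldr partial_x is v t y\<bar> \<le> A * (1 + norm y) ^ n * \<bar>t' - t\<bar>" for y
    using pderivs_time_increment[of t0 T 0 "is" v y "A * (1 + norm y) ^ n" t t'] ex[of "Suc 0" "is"] bound[of "Suc 0" "is"] 0 t
    by (simp add: pderivs_def)
  then show ?case by (simp add: mult_ac)
next
  case (Suc k)
  have sm: "smooth_wt n 1 A (foldr partial_x is v s)" if "s \<in> {t0..T}" for s
    by (rule C_class_smooth_wt[OF C that]) (use bound[of 0, OF _ that] Suc.prems in \<open>auto simp: pderivs_def\<close>)
  have d: "(foldr partial_x is v s has_derivative (\<lambda>w. dird w (foldr partial_x is v s) y)) (at y)" if "s \<in> {t0..T}" for s y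
    by (rule smooth_wt_has_derivative[OF sm[OF that]]) simp
  show ?case
  proof (rule smooth_wtI)
    show "\<bar>foldr partial_x is v t' y - foldr partial_x is v t y\<bar> \<le> A * \<bar>t' - t\<bar> * (1 + norm y) ^ n" for y
      using pderivs_time_increment[of t0 T 0 "is" v y "A * (1 + norm y) ^ n" t t'] ex[of "Suc 0" "is"] bound[of "Suc 0" "is"] Suc.prems t
      by (simp add: pderivs_def mult_ac)
    show "((\<lambda>y. foldr partial_x is v t' y - foldr partial_x is v t y) has_derivative
        (\<lambda>w. dird w (foldr partial_x is v t') y - dird w (foldr partial_x is v t) y)) (at y)" for y
      using d t by (auto intro!: derivative_eq_intros)
    show "smooth_wt n k (A * \<bar>t' - t\<bar>) (\<lambda>y. dird (axis i 1) (foldr partial_x is v t') y - dird (axis i 1) (foldr partial_x is v t) y)" for i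
      using Suc.IH[of "i # is"] Suc.prems by (simp only: foldr_partial_x_Cons dird_axis) simp
  qed
qed

lemma time_taylor2:
  assumes bound: "\<And>s. s \<in> {t0..T} \<Longrightarrow> \<bar>pderivs t0 T 2 [] v s y\<bar> \<le> C"
    and ex: "pderivs_exist t0 T 2 [] v" and t: "t0 \<le> t" "t \<le> t'" "t' \<le> T"
  shows "\<bar>v t' y - v t y - (t' - t) * partial_t t0 T v t y\<bar> \<le> C * (t' - t)\<^sup>2"
proof -
  have ex1: "pderivs_exist t0 T (Suc 0) [] v" using ex by (simp add: pderivs_exist_def)
  have ex2: "pderivs_exist t0 T (Suc (Suc 0)) [] v" using ex by (simp add: numeral_2_eq_2)
  have b2: "\<bar>pderivs t0 T (Suc (Suc 0)) [] v s y\<bar> \<le> C" if "s \<in> {t0..T}" for s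
    using bound[OF that] by (simp only: numeral_2_eq_2)
  let ?D = "\<lambda>s. pderivs t0 T (Suc 0) [] v s y"
  have C0: "0 \<le> C" using order_trans[OF abs_ge_zero b2[of t]] t by simp
  have "norm ((v t' y - t' * ?D t) - (v t y - t * ?D t)) \<le> C * (t' - t) * norm (t' - t)"
  proof (rule field_differentiable_bound[of "{t..t'}" "\<lambda>s. v s y - s * ?D t" "\<lambda>s. ?D s - ?D t"])
    fix s assume s: "s \<in> {t..t'}"
    then have "s \<in> {t0..T}" using t by auto
    from pderivs_time_derivative[OF ex1 this, of y]
    have "((\<lambda>s. v s y) has_real_derivative ?D s) (at s within {t0..T})" by (simp add: pderivs_def)
    then have "((\<lambda>s. v s y) has_real_derivative ?D s) (at s within {t..t'})"
      using t by (auto elim!: has_field_derivative_subset)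
    then show "((\<lambda>s. v s y - s * ?D t) has_real_derivative ?D s - ?D t) (at s within {t..t'})"
      by (auto intro!: derivative_eq_intros)
    have "\<bar>?D s - ?D t\<bar> \<le> C * \<bar>s - t\<bar>"
      by (rule pderivs_time_increment[OF ex2 b2]) (use s t in auto)
    also have "\<dots> \<le> C * (t' - t)" using s C0 by (intro mult_left_mono) auto
    finally show "norm (?D s - ?D t) \<le> C * (t' - t)" by simp
  qed (use t in auto)
  then show ?thesis using t by (simp add: pderivs_def algebra_simps power2_eq_square)
qed

lemma powr_weight_le:
  fixes y :: "'a::real_normed_vector"
  assumes "1 \<le> q" "q \<le> real n"
  shows "1 + norm y powr q \<le> 2 * (1 + norm y) ^ n"
proof -
  have "norm y powr q \<le> (1 + norm y) powr q" using assms by (intro powr_mono2) auto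
  also have "\<dots> \<le> (1 + norm y) powr real n" using assms by (intro powr_mono) auto
  also have "\<dots> = (1 + norm y) ^ n" by (rule powr_realpow) (simp add: add_pos_nonneg)
  finally have "norm y powr q \<le> (1 + norm y) ^ n" .
  moreover have "1 \<le> (1 + norm y) ^ n" by (rule one_le_power) simp
  ultimately show ?thesis by linarith
qed

section \<open>The walk\<close>

lemma AE_step_law:
  assumes lev: "levy_density \<nu>" and e: "0 < e" and lam: "0 < intensity \<nu> e" and h: "0 < h"
  shows "AE (\<xi>, \<eta>, I, \<delta>, z) in (step_law \<nu> e h :: ('d::finite, 'm::finite) noise measure).
    sign_bounded (\<xi>, \<eta>) \<and> 0 < \<delta> \<and> \<delta> \<le> h"
proof -
  let ?r = "intensity \<nu> e"
  let ?B = "measure_pmf (bernoulli_pmf (1 - exp (- ?r * h)))" and ?E = "trunc_exp_law ?r h" and ?J = "jump_law \<nu> e"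
  let ?S = "sign_law :: (real ^ 'd) measure" and ?T = "sign_law :: (real ^ 'm) measure"
  note B = measure_pmf.prob_space_axioms[of "bernoulli_pmf (1 - exp (- ?r * h))"]
  note E = prob_space_trunc_exp_law[OF lam h] and J = prob_space_jump_law[OF lev e lam]
  note EJ = prob_space_pair[OF E J]
  note BEJ = prob_space_pair[OF B EJ]
  note TBEJ = prob_space_pair[OF prob_space_sign_law[where 'n = 'm] BEJ]
  note sf = prob_space_imp_sigma_finite
  have A: "AE p in ?B \<Otimes>\<^sub>M ?E \<Otimes>\<^sub>M ?J. 0 < fst (snd p) \<and> fst (snd p) \<le> h"
    by (rule AE_snd_pair[OF B sf[OF EJ]], rule AE_fst_pair[OF J AE_trunc_exp_law])
  have A': "AE p in ?T \<Otimes>\<^sub>M ?B \<Otimes>\<^sub>M ?E \<Otimes>\<^sub>M ?J. norm (fst p) \<le> CARD('m) \<and> 0 < fst (snd (snd p)) \<and> fst (snd (snd p)) \<le> h"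
    using AE_fst_pair[OF BEJ AE_sign_law_norm[where 'n = 'm]] AE_snd_pair[OF prob_space_sign_law[where 'n = 'm] sf[OF BEJ] A]
    by eventually_elim auto
  show ?thesis unfolding step_law_def
    using AE_fst_pair[OF TBEJ AE_sign_law_norm[where 'n = 'd]] AE_snd_pair[OF prob_space_sign_law[where 'n = 'd] sf[OF TBEJ] A']
    by eventually_elim (auto simp: sign_bounded_def)
qed

definition noise_dur :: "real \<Rightarrow> ('d, 'm) noise \<Rightarrow> real" where
  "noise_dur h N = (case N of (\<xi>, \<eta>, I, \<delta>, z) \<Rightarrow> dur h (I, \<delta>))"

lemma noise_dur_measurable [measurable]: "noise_dur h \<in> borel_measurable noise_space"
  unfolding noise_dur_def[abs_def] dur_def by measurable

lemma AE_noise_dur: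
  assumes "levy_density \<nu>" "0 < e" "0 < intensity \<nu> e" "0 < h"
  shows "AE N in (step_law \<nu> e h :: ('d::finite, 'm::finite) noise measure). 0 < noise_dur h N \<and> noise_dur h N \<le> h"
  using AE_step_law[OF assms] by eventually_elim (use assms in \<open>auto simp: noise_dur_def dur_def\<close>)

lemma step_law_integral_dur:
  fixes f :: "real \<Rightarrow> real"
  assumes lev: "levy_density \<nu>" and e: "0 < e" and lam: "0 < intensity \<nu> e" and h: "0 < h"
    and int: "integrable (jump_law \<nu> e) (\<lambda>z. (1 + norm z) ^ n)"
    and f [measurable]: "f \<in> borel_measurable borel" and C: "\<And>s. 0 < s \<Longrightarrow> s \<le> h \<Longrightarrow> \<bar>f s\<bar> \<le> C"
  shows "integrable (step_law \<nu> e h :: ('d::finite, 'm::finite) noise measure) (\<lambda>N. f (noise_dur h N))"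
    "(\<integral>N. f (noise_dur h N) \<partial>(step_law \<nu> e h :: ('d::finite, 'm::finite) noise measure)) = (\<integral>w. f (dur h w) \<partial>clock (intensity \<nu> e) h)"
proof -
  interpret J: prob_space "jump_law \<nu> e" by (rule prob_space_jump_law[OF lev e lam])
  interpret P: prob_space "sign_pair :: ((real ^ 'd) \<times> (real ^ 'm)) measure" by (rule prob_space_sign_pair)
  let ?k = "\<lambda>N :: ('d, 'm) noise. f (noise_dur h N)"
  have k: "?k \<in> borel_measurable noise_space" by measurable
  have C0: "0 \<le> C" using order_trans[OF abs_ge_zero C[of h]] h by simp
  have bound: "\<exists>C. \<forall>\<xi> \<eta> I \<delta> z. norm \<xi> \<le> r \<longrightarrow> norm \<eta> \<le> r \<longrightarrow> 0 < \<delta> \<longrightarrow> \<delta> \<le> h \<longrightarrow>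
      \<bar>?k (\<xi>, \<eta>, I, \<delta>, z)\<bar> \<le> C * (1 + norm z) ^ n" for r
  proof -
    have "\<bar>?k (\<xi>, \<eta>, I, \<delta>, z)\<bar> \<le> C * (1 + norm z) ^ n" if "0 < \<delta>" "\<delta> \<le> h" for \<xi> \<eta> I \<delta> z
    proof -
      have "\<bar>?k (\<xi>, \<eta>, I, \<delta>, z)\<bar> \<le> C" using that h by (auto simp: noise_dur_def dur_def intro: C)
      also have "\<dots> \<le> C * (1 + norm z) ^ n" using mult_left_mono[OF one_le_power[of "1 + norm z" n] C0] by simp
      finally show ?thesis .
    qed
    then show ?thesis by blast
  qed
  note law = step_law_integral[OF lev e lam h int k bound]
  show "integrable (step_law \<nu> e h :: ('d, 'm) noise measure) (\<lambda>N. f (noise_dur h N))" by (rule law(1))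
  show "(\<integral>N. f (noise_dur h N) \<partial>(step_law \<nu> e h :: ('d::finite, 'm::finite) noise measure)) = (\<integral>w. f (dur h w) \<partial>clock (intensity \<nu> e) h)"
    unfolding law(2) by (simp add: noise_dur_def J.prob_space P.prob_space)
qed

lemma borel_measurable_matrix_vector_mult [measurable (raw)]:
  fixes A :: "'a \<Rightarrow> real ^ 'm ^ 'k"
  assumes "A \<in> borel_measurable M" "v \<in> borel_measurable M"
  shows "(\<lambda>w. A w *v v w) \<in> borel_measurable M"
proof -
  have "continuous_on UNIV (\<lambda>p :: (real ^ 'm ^ 'k) \<times> (real ^ 'm). fst p *v snd p)"
    unfolding matrix_vector_mult_def by (intro continuous_intros)
  from borel_measurable_continuous_Pair[OF assms, of "(*v)"] this show ?thesis by simp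
qed

text \<open>The data for one cut-off \<open>e\<close> and one step size \<open>h\<close>, with all bounds collected in \<open>R\<close>, \<open>K\<close> and \<open>n\<close>,
  which are to be independent of both.\<close>

locale walk_model =
  fixes t0 T :: real and G :: "(real ^ 'd) set" and \<nu> :: "real ^ 'm \<Rightarrow> real"
    and a \<sigma> :: "real \<Rightarrow> real ^ 'd \<Rightarrow> real ^ 'd ^ 'd" and b :: "real \<Rightarrow> real ^ 'd \<Rightarrow> real ^ 'd"
    and c g \<phi> :: "real \<Rightarrow> real ^ 'd \<Rightarrow> real" and F :: "real \<Rightarrow> real ^ 'd \<Rightarrow> real ^ 'm ^ 'd"
    and \<beta> :: "real ^ 'm ^ 'm" and u :: "real \<Rightarrow> real ^ 'd \<Rightarrow> real"
    and e h R K :: real and n :: nat and x0 :: "real ^ 'd"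
  assumes t0T: "t0 < T" and openG: "open G" and x0: "x0 \<in> G" and lev: "levy_density \<nu>"
    and b_meas: "(\<lambda>(t, x). b t x) \<in> borel_measurable borel"
    and \<sigma>_meas: "(\<lambda>(t, x). \<sigma> t x) \<in> borel_measurable borel"
    and c_meas: "(\<lambda>(t, x). c t x) \<in> borel_measurable borel"
    and g_meas: "(\<lambda>(t, x). g t x) \<in> borel_measurable borel"
    and F_meas: "(\<lambda>(t, x). F t x) \<in> borel_measurable borel"
    and \<phi>_meas: "(\<lambda>(t, x). \<phi> t x) \<in> borel_measurable borel"
    and \<sigma>a: "\<And>t x. t \<in> {t0..T} \<Longrightarrow> \<sigma> t x ** transpose (\<sigma> t x) = a t x"
    and \<beta>: "\<beta> ** transpose \<beta> = small_jump_cov \<nu> e"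
    and e: "0 < e" and lam: "0 < intensity \<nu> e"
    and int: "integrable (levy \<nu>) (\<lambda>z. (norm z)\<^sup>2 * (1 + norm z) ^ n)"
    and h: "0 < h" "h \<le> T - t0" and R: "1 \<le> R" "T - t0 \<le> R"
    and bounds: "\<And>t x. t \<in> {t0..T} \<Longrightarrow> x \<in> G \<Longrightarrow>
      norm x \<le> R \<and> norm (b t x) \<le> R \<and> norm (F t x) \<le> R \<and> \<bar>c t x\<bar> \<le> R \<and> \<bar>g t x\<bar> \<le> R"
    and noise: "\<And>t x \<zeta>. t \<in> {t0..T} \<Longrightarrow> x \<in> G \<Longrightarrow> sign_bounded \<zeta> \<Longrightarrow>
      norm (\<sigma> t x *v fst \<zeta> + F t x *v (\<beta> *v snd \<zeta>)) \<le> R"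
    and drift: "norm (drift_corr \<nu> e) \<le> R * intensity \<nu> e"
    and K_pos: "0 < K" and u_class: "C_class t0 T 2 4 u" and u_sol: "dirichlet_solution t0 T G \<nu> a b c g F \<phi> e u"
    and u_ex: "\<And>l is. 2 * l + length is \<le> 4 \<Longrightarrow> pderivs_exist t0 T l is u"
    and u_bound: "\<And>l is t y. 2 * l + length is \<le> 4 \<Longrightarrow> t \<in> {t0..T} \<Longrightarrow> \<bar>pderivs t0 T l is u t y\<bar> \<le> K * (1 + norm y) ^ n"
begin

text \<open>\<open>m\<close> is the mean of the time step and \<open>M1\<close> half of its second moment.  Freezing \<open>u\<close> after
  \<open>T\<close> serves the last step, which may pass \<open>T\<close>; freezing it before \<open>t0\<close> as well makes \<open>u_frozen\<close>
  continuous everywhere.\<close>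

definition "lam = intensity \<nu> e"
definition "\<gamma> = drift_corr \<nu> e"
definition "m = mean_step lam h"
definition "M1 = wt_moment lam h 0"
definition "u_frozen t y = u (min (max t t0) T) y"

lemma lam_pos: "0 < lam" using lam by (simp add: lam_def)

lemma u_frozen_eq: "t0 \<le> t \<Longrightarrow> u_frozen t = u (min t T)"
  by (simp add: u_frozen_def fun_eq_iff)

lemma u_frozen_measurable: "(\<lambda>(t, y). u_frozen t y) \<in> borel_measurable borel"
proof -
  have "continuous_on ({t0..T} \<times> UNIV) (\<lambda>(t, x). u t x)"
    using u_class unfolding C_class_def by (force simp: pderivs_def)
  then have "continuous_on UNIV ((\<lambda>(t, x). u t x) \<circ> (\<lambda>p. (min (max (fst p) t0) T, snd p)))"
    using t0T by (intro continuous_on_compose continuous_intros) (auto elim!: continuous_on_subset)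
  then show ?thesis by (intro borel_measurable_continuous_onI) (simp add: comp_def case_prod_beta' u_frozen_def)
qed

lemma u_smooth: "t \<in> {t0..T} \<Longrightarrow> smooth_wt n 4 K (u t)"
  using C_class_smooth_wt[OF u_class, of t K n 4 "[]"] u_bound[of 0] by (simp add: pderivs_def)

lemma u_increment: "t \<in> {t0..T} \<Longrightarrow> t' \<in> {t0..T} \<Longrightarrow> smooth_wt n 2 (K * \<bar>t' - t\<bar>) (\<lambda>y. u t' y - u t y)"
  using smooth_wt_time_increment[OF u_class u_bound u_ex, of t t' 2 "[]"] by simp

lemma K: "0 \<le> K" using K_pos by simp

lemma one_step_at:
  assumes \<tau>: "t0 \<le> \<tau>" "\<tau> < T" and x: "x \<in> G"
  shows "one_step n R h \<nu> e x (b \<tau> x) (\<sigma> \<tau> x) \<beta> (F \<tau> x) (c \<tau> x) K (\<lambda>\<theta>. u_frozen (\<tau> + \<theta>))"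
proof
  have t: "\<tau> \<in> {t0..T}" using \<tau> by simp
  show "norm x \<le> R" "norm (b \<tau> x) \<le> R" "norm (F \<tau> x) \<le> R" "\<bar>c \<tau> x\<bar> \<le> R"
    using bounds[OF t x] by auto
  show "case_prod (\<lambda>\<theta>. u_frozen (\<tau> + \<theta>)) \<in> borel_measurable (borel \<Otimes>\<^sub>M borel)"
  proof -
    have "(\<lambda>p. (\<tau> + fst p, snd p)) \<in> borel \<Otimes>\<^sub>M borel \<rightarrow>\<^sub>M (borel :: (real \<times> (real ^ 'd)) measure)"
      unfolding borel_prod[symmetric] by measurable
    from measurable_compose[OF this u_frozen_measurable] show ?thesis by (simp add: case_prod_beta')
  qed
  show "smooth_wt n 4 K (u_frozen (\<tau> + 0))" using u_smooth[OF t] \<tau> by (simp add: u_frozen_eq min_absorb1)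
  show "smooth_wt n 2 (K * \<theta>) (\<lambda>y. u_frozen (\<tau> + \<theta>) y - u_frozen (\<tau> + 0) y)" if "0 \<le> \<theta>" "\<theta> \<le> h" for \<theta>
  proof -
    have "smooth_wt n 2 (K * \<bar>min (\<tau> + \<theta>) T - \<tau>\<bar>) (\<lambda>y. u (min (\<tau> + \<theta>) T) y - u \<tau> y)"
      by (rule u_increment) (use \<tau> that in auto)
    then have "smooth_wt n 2 (K * \<theta>) (\<lambda>y. u (min (\<tau> + \<theta>) T) y - u \<tau> y)"
      by (rule smooth_wt_mono) (use \<tau> that K in \<open>auto intro!: mult_left_mono\<close>)
    then show ?thesis using \<tau> that by (simp add: u_frozen_eq min_absorb1)
  qed
qed (use noise[OF _ x] \<tau> R lev int e lam h drift in auto)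

definition "overshoot \<tau> = (\<integral>w. max 0 (dur h w - (T - \<tau>)) \<partial>clock lam h)"
definition "C1 = one_step.cT TYPE('d) n R \<nu> K + 6 * K * (1 + R) ^ n"

lemma M1_pos: "0 < M1"
proof -
  have "0 < lam * h" using lam_pos h by simp
  have "lam * h + 1 < (1 + lam * h / 2)\<^sup>2"
    using lam_pos h by (simp add: power2_eq_square algebra_simps)
  also have "\<dots> \<le> (exp (lam * h / 2))\<^sup>2"
    using \<open>0 < lam * h\<close> by (intro power_mono) auto
  also have "\<dots> = exp (lam * h)" by (simp add: exp_double[symmetric])
  finally have "lam * h + 1 < exp (lam * h)" .
  then have "(1 + lam * h) * exp (- (lam * h)) < exp (lam * h) * exp (- (lam * h))"
    by (intro mult_strict_right_mono) auto
  then have "exp (- lam * h) + lam * h * exp (- lam * h) < 1" by (simp add: exp_minus algebra_simps)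
  then have "0 < (1 - exp (- lam * h) - lam * h * exp (- lam * h)) / lam / lam" using lam_pos by simp
  also have "\<dots> = M1" using lam_pos h by (simp add: M1_def wt_moment_0 mean_step_def field_simps)
  finally show ?thesis .
qed

lemma m_pos: "0 < m" using lam_pos h by (simp add: m_def mean_step_def)

lemma dur_sq: "integrable (clock lam h) (\<lambda>w. (dur h w)\<^sup>2)" "(\<integral>w. (dur h w)\<^sup>2 \<partial>clock lam h) \<le> 6 * M1"
proof -
  show i: "integrable (clock lam h) (\<lambda>w. (dur h w)\<^sup>2)"
    by (rule clock_integral_dur(1)[OF lam_pos h(1), of _ "h\<^sup>2"]) (auto intro: power_mono)
  have "(\<integral>w. (dur h w)\<^sup>2 \<partial>clock lam h)
    \<le> (\<integral>w. (dur h w)\<^sup>2 * (1 + lam * dur h w) ^ 0 + of_bool (fst w) * (snd w * (1 + lam * snd w) ^ 0) / lam \<partial>clock lam h)"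
    by (rule integral_mono_AE[OF i clock_weight_moment(1)[OF lam_pos h(1)]], rule eventually_mono[OF AE_clock[OF lam_pos h(1)]])
       (use lam_pos in auto)
  also have "\<dots> \<le> 6 * M1" using clock_weight_moment(2)[OF lam_pos h(1), of 0] by (simp add: M1_def fact_2)
  finally show "(\<integral>w. (dur h w)\<^sup>2 \<partial>clock lam h) \<le> 6 * M1" .
qed

lemma overshoot_integrable: "\<tau> < T \<Longrightarrow> integrable (clock lam h) (\<lambda>w. max 0 (dur h w - (T - \<tau>)))"
  by (rule clock_integral_dur(1)[OF lam_pos h(1), of _ h]) auto

text \<open>Steps that pass the final time are seen through \<open>u\<close> frozen at \<open>T\<close>, which costs the part of the
  time derivative beyond \<open>T\<close>.\<close>

lemma time_increment_mean:
  assumes \<tau>: "t0 \<le> \<tau>" "\<tau> < T" and x: "norm x \<le> R"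
    and i: "integrable (clock lam h) (\<lambda>w. u_frozen (\<tau> + dur h w) x - u \<tau> x)"
  shows "\<bar>(\<integral>w. u_frozen (\<tau> + dur h w) x - u \<tau> x \<partial>clock lam h) - partial_t t0 T u \<tau> x * (m - overshoot \<tau>)\<bar>
    \<le> 6 * K * (1 + R) ^ n * M1"
proof -
  let ?D = "partial_t t0 T u \<tau> x" and ?s = "T - \<tau>"
  note dm = clock_mean[OF lam_pos h(1)] and oi = overshoot_integrable[OF \<tau>(2)]
  have i2: "integrable (clock lam h) (\<lambda>w. ?D * (dur h w - max 0 (dur h w - ?s)))" using dm oi by simp
  have "?D * (m - overshoot \<tau>) = (\<integral>w. ?D * (dur h w - max 0 (dur h w - ?s)) \<partial>clock lam h)"
    using dm oi by (simp add: overshoot_def m_def)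
  then have "(\<integral>w. u_frozen (\<tau> + dur h w) x - u \<tau> x \<partial>clock lam h) - ?D * (m - overshoot \<tau>)
    = (\<integral>w. (u_frozen (\<tau> + dur h w) x - u \<tau> x) - ?D * (dur h w - max 0 (dur h w - ?s)) \<partial>clock lam h)"
    using i i2 by simp
  then have "\<bar>(\<integral>w. u_frozen (\<tau> + dur h w) x - u \<tau> x \<partial>clock lam h) - ?D * (m - overshoot \<tau>)\<bar>
    \<le> (\<integral>w. \<bar>(u_frozen (\<tau> + dur h w) x - u \<tau> x) - ?D * (dur h w - max 0 (dur h w - ?s))\<bar> \<partial>clock lam h)"
    by (simp only: integral_abs_bound)
  also have "\<dots> \<le> (\<integral>w. K * (1 + R) ^ n * (dur h w)\<^sup>2 \<partial>clock lam h)"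
  proof (rule integral_mono_AE)
    show "AE w in clock lam h. \<bar>(u_frozen (\<tau> + dur h w) x - u \<tau> x) - ?D * (dur h w - max 0 (dur h w - ?s))\<bar> \<le> K * (1 + R) ^ n * (dur h w)\<^sup>2"
    proof (rule eventually_mono[OF AE_clock_dur[OF lam_pos h(1)]])
      fix w assume d: "0 < dur h w \<and> dur h w \<le> h"
      define t' where "t' = min (\<tau> + dur h w) T"
      have t': "t' - \<tau> = dur h w - max 0 (dur h w - ?s)" "\<tau> \<le> t'" "t' \<le> T" "t' - \<tau> \<le> dur h w"
        using d \<tau> by (auto simp: t'_def)
      have "\<bar>u t' x - u \<tau> x - (t' - \<tau>) * ?D\<bar> \<le> K * (1 + norm x) ^ n * (t' - \<tau>)\<^sup>2"
        by (rule time_taylor2) (use u_bound[of 2 "[]"] u_ex[of 2 "[]"] \<tau> t' in auto)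
      also have "\<dots> \<le> K * (1 + R) ^ n * (dur h w)\<^sup>2"
        using K x t' d R by (intro mult_mono mult_left_mono power_mono) auto
      finally show "\<bar>(u_frozen (\<tau> + dur h w) x - u \<tau> x) - ?D * (dur h w - max 0 (dur h w - ?s))\<bar> \<le> K * (1 + R) ^ n * (dur h w)\<^sup>2"
        using \<tau> d t'(1) by (simp add: u_frozen_eq t'_def mult.commute)
    qed
  qed (use i i2 dur_sq(1) in \<open>auto intro!: integrable_abs Bochner_Integration.integrable_diff\<close>)
  also have "\<dots> = K * (1 + R) ^ n * (\<integral>w. (dur h w)\<^sup>2 \<partial>clock lam h)" by simp
  also have "\<dots> \<le> K * (1 + R) ^ n * (6 * M1)" using K R by (intro mult_left_mono dur_sq) auto
  finally show ?thesis by (simp add: mult_ac)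
qed

lemma pde_at:
  assumes "t0 \<le> \<tau>" "\<tau> < T" "x \<in> G"
  shows "partial_t t0 T u \<tau> x + (dird (b \<tau> x - F \<tau> x *v \<gamma>) (u \<tau>) x
        + 1 / 2 * (\<Sum>i\<in>UNIV. \<Sum>j\<in>UNIV. (\<sigma> \<tau> x ** transpose (\<sigma> \<tau> x) + F \<tau> x ** (\<beta> ** transpose \<beta>) ** transpose (F \<tau> x)) $ i $ j * pd i (pd j (u \<tau>)) x)
        + jump_op \<nu> e (F \<tau> x) (u \<tau>) x + c \<tau> x * u \<tau> x) = - g \<tau> x"
proof -
  have t: "\<tau> \<in> {t0..T}" using assms by simp
  have "partial_t t0 T u \<tau> x + generator \<nu> a b F e u \<tau> x + c \<tau> x * u \<tau> x + g \<tau> x = 0"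
    using u_sol assms unfolding dirichlet_solution_def Q_def by force
  moreover have "(LINT z:{z. norm z \<ge> e}|levy \<nu>. u \<tau> (x + F \<tau> x *v z) - u \<tau> x) = jump_op \<nu> e (F \<tau> x) (u \<tau>) x"
  proof -
    have [measurable]: "u \<tau> \<in> borel_measurable borel" using smooth_wt_measurable[OF u_smooth[OF t]] by simp
    have "(\<lambda>z. u \<tau> (x + F \<tau> x *v z) - u \<tau> x) \<in> borel_measurable borel" by measurable
    then show ?thesis unfolding jump_op_def by (rule LINT_ge_eq_gt[OF lev])
  qed
  moreover have "partial_x i (partial_x j u) \<tau> x = pd i (pd j (u \<tau>)) x" "partial_x i u \<tau> x = pd i (u \<tau>) x" for i j
    by (simp_all add: partial_x_def pd_def)
  ultimately show ?thesis
    unfolding generator_def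
    by (simp add: \<sigma>a[OF t] \<beta> \<gamma>_def dird_def matrix_vector_mult_def)
qed

abbreviation "L \<equiv> step_law \<nu> e h :: ('d, 'm) noise measure"
definition "chain_step = walk_step b \<sigma> c g F \<gamma> \<beta> h"

lemma W_jump: "integrable (jump_law \<nu> e) (\<lambda>z. (1 + norm z) ^ n)"
  by (rule one_step.W_jump_integrable[OF one_step_at[of t0 x0]]) (use t0T x0 in auto)

lemma payoff_step:
  assumes "t0 \<le> \<tau>" "\<tau> < T" "x \<in> G"
  shows "payoff u_frozen (chain_step (\<tau>, x, y, z) N) =
    y * one_step.H h \<nu> e x (b \<tau> x) (\<sigma> \<tau> x) \<beta> (F \<tau> x) (c \<tau> x) (\<lambda>\<theta>. u_frozen (\<tau> + \<theta>)) N + z + noise_dur h N * (g \<tau> x * y)"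
proof -
  interpret O: one_step n R h \<nu> e x "b \<tau> x" "\<sigma> \<tau> x" \<beta> "F \<tau> x" "c \<tau> x" K "\<lambda>\<theta>. u_frozen (\<tau> + \<theta>)"
    by (rule one_step_at[OF assms])
  show ?thesis
    unfolding chain_step_def O.H_def O.pre_def O.S_def O.\<gamma>_def \<gamma>_def noise_dur_def dur_def
    by (cases N) (auto simp: Let_def algebra_simps)
qed

text \<open>The equation for \<open>u\<close> cancels the terms of first order.  It holds at the starting point of the step only,
  which lies in \<open>Q\<close>.\<close>

lemma one_step_defect:
  assumes \<tau>: "t0 \<le> \<tau>" "\<tau> < T" and x: "x \<in> G"
  shows "integrable L (\<lambda>N. payoff u_frozen (chain_step (\<tau>, x, y, z) N))"
    "\<bar>(\<integral>N. payoff u_frozen (chain_step (\<tau>, x, y, z) N) \<partial>L) - payoff u_frozen (\<tau>, x, y, z)\<bar>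
      \<le> \<bar>y\<bar> * (C1 * (1 + norm \<gamma>)\<^sup>2 * M1 + K * (1 + R) ^ n * overshoot \<tau>)"
proof -
  interpret O: one_step n R h \<nu> e x "b \<tau> x" "\<sigma> \<tau> x" \<beta> "F \<tau> x" "c \<tau> x" K "\<lambda>\<theta>. u_frozen (\<tau> + \<theta>)"
    by (rule one_step_at[OF assms])
  interpret L: prob_space L by (rule prob_space_step_law[OF lev e lam h(1)])
  have t: "\<tau> \<in> {t0..T}" using \<tau> by simp
  have u\<tau>: "u_frozen \<tau> = u \<tau>" using \<tau> by (simp add: u_frozen_eq)
  have xR: "norm x \<le> R" using bounds[OF t x] by simp
  have lam_eq: "O.lam = lam" "O.\<gamma> = \<gamma>" by (simp_all add: O.lam_def lam_def O.\<gamma>_def \<gamma>_def)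
  note exp = O.one_step_expansion[unfolded lam_eq]
  have dur: "integrable L (noise_dur h)" "(\<integral>N. noise_dur h N \<partial>L) = m"
    using step_law_integral_dur[OF lev e lam h(1) W_jump, of "\<lambda>s. s" h, where 'd = 'd]
    by (auto simp: m_def lam_def clock_mean[OF lam h(1)])
  show "integrable L (\<lambda>N. payoff u_frozen (chain_step (\<tau>, x, y, z) N))"
    unfolding payoff_step[OF assms] using exp(1) dur(1) by auto
  have EV: "(\<integral>N. payoff u_frozen (chain_step (\<tau>, x, y, z) N) \<partial>L) = y * (\<integral>N. O.H N \<partial>L) + z + m * (g \<tau> x * y)"
    unfolding payoff_step[OF assms] using exp(1) dur by (simp add: L.prob_space)
  define D where "D = dird (b \<tau> x - F \<tau> x *v \<gamma>) (u \<tau>) x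
        + 1 / 2 * (\<Sum>i\<in>UNIV. \<Sum>j\<in>UNIV. (\<sigma> \<tau> x ** transpose (\<sigma> \<tau> x) + F \<tau> x ** (\<beta> ** transpose \<beta>) ** transpose (F \<tau> x)) $ i $ j * pd i (pd j (u \<tau>)) x)
        + jump_op \<nu> e (F \<tau> x) (u \<tau>) x + c \<tau> x * u \<tau> x"
  define I where "I = (\<integral>w. u_frozen (\<tau> + dur h w) x - u \<tau> x \<partial>clock lam h)"
  define ut where "ut = partial_t t0 T u \<tau> x"
  have 1: "\<bar>(\<integral>N. O.H N \<partial>L) - (u \<tau> x + I + m * D)\<bar> \<le> one_step.cT TYPE('d) n R \<nu> K * (1 + norm \<gamma>)\<^sup>2 * M1"
    using exp(2) unfolding O.g_def lam_eq O.w_def D_def I_def m_def M1_def by (simp add: u\<tau>)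
  have iw: "integrable (clock lam h) (\<lambda>w. u_frozen (\<tau> + dur h w) x - u \<tau> x)"
    using O.w_dur_integrable unfolding O.w_def lam_eq by (simp add: u\<tau>)
  have 2: "\<bar>I - ut * (m - overshoot \<tau>)\<bar> \<le> 6 * K * (1 + R) ^ n * M1"
    unfolding I_def ut_def by (rule time_increment_mean[OF \<tau> xR iw])
  have utb: "\<bar>ut\<bar> \<le> K * (1 + R) ^ n"
  proof -
    have "\<bar>ut\<bar> \<le> K * (1 + norm x) ^ n" using u_bound[of 1 "[]" \<tau> x] t by (simp add: pderivs_def ut_def)
    also have "\<dots> \<le> K * (1 + R) ^ n" using K xR by (intro mult_left_mono power_mono) auto
    finally show ?thesis .
  qed
  have o0: "0 \<le> overshoot \<tau>" unfolding overshoot_def by (intro integral_nonneg_AE) auto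
  have 3: "\<bar>ut * overshoot \<tau>\<bar> \<le> K * (1 + R) ^ n * overshoot \<tau>"
    unfolding abs_mult using utb o0 by (simp add: mult_right_mono)
  have pde: "ut + D = - g \<tau> x" unfolding ut_def D_def by (rule pde_at[OF assms])
  have M0: "0 \<le> M1" using M1_pos by simp
  have "6 * K * (1 + R) ^ n * M1 * 1 \<le> 6 * K * (1 + R) ^ n * M1 * (1 + norm \<gamma>)\<^sup>2"
    using K R M0 by (intro mult_left_mono one_le_power) auto
  then have 4: "6 * K * (1 + R) ^ n * M1 \<le> 6 * K * (1 + R) ^ n * (1 + norm \<gamma>)\<^sup>2 * M1" by (simp add: mult_ac)
  have key: "(\<integral>N. O.H N \<partial>L) + m * g \<tau> x - u \<tau> x
    = ((\<integral>N. O.H N \<partial>L) - (u \<tau> x + I + m * D)) + (I - ut * (m - overshoot \<tau>)) - ut * overshoot \<tau>"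
  proof -
    have "m * (ut + D) = - (m * g \<tau> x)" by (simp add: pde)
    then show ?thesis by (simp add: algebra_simps)
  qed
  have "\<bar>(\<integral>N. O.H N \<partial>L) + m * g \<tau> x - u \<tau> x\<bar> \<le> C1 * (1 + norm \<gamma>)\<^sup>2 * M1 + K * (1 + R) ^ n * overshoot \<tau>"
  proof -
    have "C1 * (1 + norm \<gamma>)\<^sup>2 * M1 = one_step.cT TYPE('d) n R \<nu> K * (1 + norm \<gamma>)\<^sup>2 * M1 + 6 * K * (1 + R) ^ n * (1 + norm \<gamma>)\<^sup>2 * M1"
      by (simp add: C1_def algebra_simps)
    then show ?thesis unfolding key using 1 2 3 4 by linarith
  qed
  moreover have "(\<integral>N. payoff u_frozen (chain_step (\<tau>, x, y, z) N) \<partial>L) - payoff u_frozen (\<tau>, x, y, z) = y * ((\<integral>N. O.H N \<partial>L) + m * g \<tau> x - u \<tau> x)"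
    unfolding EV by (simp add: u\<tau> algebra_simps)
  ultimately show "\<bar>(\<integral>N. payoff u_frozen (chain_step (\<tau>, x, y, z) N) \<partial>L) - payoff u_frozen (\<tau>, x, y, z)\<bar>
      \<le> \<bar>y\<bar> * (C1 * (1 + norm \<gamma>)\<^sup>2 * M1 + K * (1 + R) ^ n * overshoot \<tau>)"
    by (simp add: abs_mult mult_left_mono)
qed

definition "E1 = exp (R * (T - t0))"
text \<open>The states in which the walk is still running, with the growth of \<open>Y\<close> and \<open>Z\<close> that the recursion
  allows.  On this set the value function is bounded, because \<open>G\<close> is.\<close>

definition "good = {(\<tau>, x, y, z). t0 \<le> \<tau> \<and> \<tau> < T \<and> x \<in> G
  \<and> \<bar>y\<bar> \<le> exp (R * (\<tau> - t0)) \<and> \<bar>z\<bar> \<le> R * E1 * (\<tau> - t0)}"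

lemma goodD:
  assumes "(\<tau>, x, y, z) \<in> good"
  shows "t0 \<le> \<tau>" "\<tau> < T" "x \<in> G" "\<bar>y\<bar> \<le> exp (R * (\<tau> - t0))" "\<bar>y\<bar> \<le> E1"
    "\<bar>z\<bar> \<le> R * E1 * (\<tau> - t0)" "\<bar>z\<bar> \<le> R * E1 * R"
proof -
  show 1: "t0 \<le> \<tau>" "\<tau> < T" "x \<in> G" "\<bar>y\<bar> \<le> exp (R * (\<tau> - t0))" "\<bar>z\<bar> \<le> R * E1 * (\<tau> - t0)"
    using assms by (auto simp: good_def)
  have "exp (R * (\<tau> - t0)) \<le> E1" using 1 R by (simp add: E1_def)
  then show "\<bar>y\<bar> \<le> E1" using 1 by linarith
  have "R * E1 * (\<tau> - t0) \<le> R * E1 * R" using 1 R by (intro mult_left_mono) (auto simp: E1_def)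
  then show "\<bar>z\<bar> \<le> R * E1 * R" using 1 by linarith
qed

lemma good_init: "(t0, x0, 1, 0) \<in> good"
  using t0T x0 by (simp add: good_def)

text \<open>By \<open>1 + \<theta> R \<le> exp (\<theta> R)\<close> the functional \<open>Y\<close> stays below the exponential, and then \<open>Z\<close> grows at a rate
  of at most \<open>R E1\<close>.\<close>

lemma good_step:
  assumes s: "(\<tau>, x, y, z) \<in> good" and N: "0 < noise_dur h N" "noise_dur h N \<le> h"
    and s': "chain_step (\<tau>, x, y, z) N = (\<tau>', x', y', z')"
  shows "\<tau>' = \<tau> + noise_dur h N" "\<tau>' < T \<Longrightarrow> x' \<in> G \<Longrightarrow> (\<tau>', x', y', z') \<in> good"
proof -
  let ?\<theta> = "noise_dur h N"
  note g = goodD[OF s]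
  have e: "\<tau>' = \<tau> + ?\<theta>" "y' = y + ?\<theta> * c \<tau> x * y" "z' = z + ?\<theta> * g \<tau> x * y"
    using s' by (cases N; auto simp: chain_step_def noise_dur_def dur_def Let_def)+
  then show "\<tau>' = \<tau> + ?\<theta>" by simp
  assume a: "\<tau>' < T" "x' \<in> G"
  have t: "\<tau> \<in> {t0..T}" using g by simp
  have b: "\<bar>c \<tau> x\<bar> \<le> R" "\<bar>g \<tau> x\<bar> \<le> R" using bounds[OF t g(3)] by auto
  have "\<bar>y'\<bar> = \<bar>1 + ?\<theta> * c \<tau> x\<bar> * \<bar>y\<bar>" by (simp add: e abs_mult[symmetric] algebra_simps)
  also have "\<dots> \<le> exp (R * ?\<theta>) * exp (R * (\<tau> - t0))"
  proof (rule mult_mono)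
    have "\<bar>?\<theta> * c \<tau> x\<bar> \<le> R * ?\<theta>" using b N mult_left_mono[of "\<bar>c \<tau> x\<bar>" R ?\<theta>] by (simp add: abs_mult mult.commute)
    then show "\<bar>1 + ?\<theta> * c \<tau> x\<bar> \<le> exp (R * ?\<theta>)" using exp_ge_add_one_self[of "R * ?\<theta>"] by linarith
  qed (use g in auto)
  also have "\<dots> = exp (R * (\<tau>' - t0))" by (simp add: e exp_add[symmetric] algebra_simps)
  finally have y': "\<bar>y'\<bar> \<le> exp (R * (\<tau>' - t0))" .
  have "\<bar>?\<theta> * g \<tau> x * y\<bar> \<le> ?\<theta> * R * E1"
    unfolding abs_mult using b N g R by (intro mult_mono) auto
  then have "\<bar>z'\<bar> \<le> R * E1 * (\<tau>' - t0)" using g(6) by (simp add: e algebra_simps)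
  then show "(\<tau>', x', y', z') \<in> good" using a y' g N by (simp add: good_def e)
qed

abbreviation "state_space \<equiv> borel \<Otimes>\<^sub>M (borel \<Otimes>\<^sub>M (borel \<Otimes>\<^sub>M borel)) :: 'd state measure"

lemma state_space_borel: "state_space = borel"
  unfolding borel_prod ..

lemma good_sets: "good \<in> sets borel"
proof -
  note [measurable] = borel_open[OF openG]
  have "{s \<in> space state_space. t0 \<le> fst s \<and> fst s < T \<and> fst (snd s) \<in> G \<and> \<bar>fst (snd (snd s))\<bar> \<le> exp (R * (fst s - t0))
    \<and> \<bar>snd (snd (snd s))\<bar> \<le> R * E1 * (fst s - t0)} \<in> sets state_space" by measurable
  also have "{s \<in> space state_space. t0 \<le> fst s \<and> fst s < T \<and> fst (snd s) \<in> G \<and> \<bar>fst (snd (snd s))\<bar> \<le> exp (R * (fst s - t0))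
    \<and> \<bar>snd (snd (snd s))\<bar> \<le> R * E1 * (fst s - t0)} = good"
    by (auto simp: good_def space_pair_measure)
  finally show ?thesis by (simp only: state_space_borel)
qed

lemma space_time_comp:
  fixes f :: "real \<Rightarrow> real ^ 'd \<Rightarrow> 'z::topological_space"
  assumes "(\<lambda>(t, x). f t x) \<in> borel_measurable borel" "p \<in> borel_measurable M" "q \<in> borel_measurable M"
  shows "(\<lambda>w. f (p w) (q w)) \<in> borel_measurable M"
proof -
  have "(\<lambda>w. (p w, q w)) \<in> M \<rightarrow>\<^sub>M (borel :: (real \<times> (real ^ 'd)) measure)"
    unfolding borel_prod[symmetric] using assms(2,3) by measurable
  from measurable_compose[OF this assms(1)] show ?thesis by simp
qed

lemmas coefficient_measurable [measurable (raw)] =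
  space_time_comp[OF b_meas] space_time_comp[OF \<sigma>_meas] space_time_comp[OF c_meas]
  space_time_comp[OF g_meas] space_time_comp[OF F_meas] space_time_comp[OF \<phi>_meas] space_time_comp[OF u_frozen_measurable]

lemma chain_step_measurable: "case_prod chain_step \<in> borel \<Otimes>\<^sub>M L \<rightarrow>\<^sub>M borel"
proof -
  have eq: "case_prod chain_step = (\<lambda>p. let \<tau> = fst (fst p); X = fst (snd (fst p)); Y = fst (snd (snd (fst p))); Z = snd (snd (snd (fst p)));
      \<xi> = fst (snd p); \<eta> = fst (snd (snd p)); I = fst (snd (snd (snd p))); \<delta> = fst (snd (snd (snd (snd p)))); J = snd (snd (snd (snd (snd p))));
      \<theta> = (if I then \<delta> else h) in
       (\<tau> + \<theta>,
        X + \<theta> *\<^sub>R (b \<tau> X - F \<tau> X *v \<gamma>)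
          + sqrt \<theta> *\<^sub>R (\<sigma> \<tau> X *v \<xi> + F \<tau> X *v (\<beta> *v \<eta>))
          + (if I then F \<tau> X *v J else 0),
        Y + \<theta> * c \<tau> X * Y,
        Z + \<theta> * g \<tau> X * Y))"
    by (auto simp: fun_eq_iff chain_step_def Let_def)
  have "case_prod chain_step \<in> state_space \<Otimes>\<^sub>M noise_space \<rightarrow>\<^sub>M state_space"
    unfolding eq Let_def by measurable
  moreover have "sets (borel \<Otimes>\<^sub>M L) = sets (state_space \<Otimes>\<^sub>M noise_space)"
    by (intro sets_pair_measure_cong sets_step_law) (simp only: state_space_borel)
  ultimately show ?thesis unfolding measurable_cong_sets[OF _ refl] state_space_borel by (simp cong: measurable_cong_sets)
qed

lemma payoff_measurable:
  assumes "(\<lambda>(t, x). f t x) \<in> borel_measurable borel"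
  shows "payoff f \<in> borel_measurable (borel :: 'd state measure)"
proof -
  note [measurable (raw)] = space_time_comp[OF assms]
  have "payoff f = (\<lambda>s. f (fst s) (fst (snd s)) * fst (snd (snd s)) + snd (snd (snd s)))" by (auto simp: fun_eq_iff)
  moreover have "(\<lambda>s. f (fst s) (fst (snd s)) * fst (snd (snd s)) + snd (snd (snd s))) \<in> borel_measurable state_space"
    by measurable
  ultimately show ?thesis by (simp only: state_space_borel)
qed

text \<open>Constants in front of the two terms of \<open>one_step_defect\<close>, with \<open>|Y|\<close> bounded by \<open>E1\<close>.\<close>

definition "Ca = E1 * C1 * (1 + norm \<gamma>)\<^sup>2"
definition "Cb = E1 * (K * (1 + R) ^ n)"

definition "rate = (\<lambda>(\<tau>, x :: real ^ 'd, y :: real, z :: real). Ca * M1 + Cb * overshoot \<tau>)"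
definition "potential = (\<lambda>(\<tau>, x :: real ^ 'd, y :: real, z :: real). Ca * M1 / m * (T + h - \<tau>) + Cb * m)"

lemma E1: "1 \<le> E1" using R t0T by (simp add: E1_def)

lemma C1_pos: "0 < C1"
proof -
  interpret O: one_step n R h \<nu> e x0 "b t0 x0" "\<sigma> t0 x0" \<beta> "F t0 x0" "c t0 x0" K "\<lambda>\<theta>. u_frozen (t0 + \<theta>)"
    by (rule one_step_at) (use t0T x0 in auto)
  have "0 \<le> O.cT * O.g\<^sup>2 * wt_moment O.lam h 0"
    using O.one_step_expansion(2) abs_ge_zero order_trans by blast
  moreover have "0 < O.g\<^sup>2 * wt_moment O.lam h 0"
    using M1_pos by (auto simp: O.g_def M1_def O.lam_def lam_def intro!: mult_pos_pos zero_less_power add_pos_nonneg)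
  ultimately have "0 \<le> O.cT" by (simp add: mult.assoc zero_le_mult_iff)
  then show ?thesis using K_pos R by (simp add: C1_def add_nonneg_pos)
qed

lemma Ca_pos: "0 < Ca"
  using C1_pos E1 by (auto simp: Ca_def intro!: mult_pos_pos zero_less_power add_pos_nonneg)
lemma Ca_nonneg: "0 \<le> Ca" using Ca_pos by simp
lemma Cb_nonneg: "0 \<le> Cb" using K R E1 by (simp add: Cb_def)

lemma overshoot_measurable: "overshoot \<in> borel_measurable borel"
proof -
  interpret C: prob_space "clock lam h" by (rule prob_space_clock[OF lam_pos h(1)])
  show ?thesis unfolding overshoot_def by measurable
qed

lemma overshoot_nonneg: "0 \<le> overshoot \<tau>"
  unfolding overshoot_def by (intro integral_nonneg_AE) auto

text \<open>The first summand of the potential counts the remaining time in units of the mean step; the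
  second one, kept until the walk stops, pays for the single overshoot of the final time.\<close>

lemma potential_drop:
  assumes s: "s \<in> good"
  shows "(\<integral>\<^sup>+N. ennreal (potential (chain_step s N)) * indicator good (chain_step s N) \<partial>L) + ennreal (rate s) \<le> ennreal (potential s)"
proof -
  obtain \<tau> x y z where s_eq: "s = (\<tau>, x, y, z)" by (cases s)
  note g = goodD[OF s[unfolded s_eq]]
  define f where "f r = Ca * M1 / m * (T + h - \<tau> - r) + Cb * m * (1 - indicator {T - \<tau>..} r)" for r
  have Cm: "0 \<le> Ca * M1 / m" "0 \<le> Cb * m" using Ca_nonneg Cb_nonneg m_pos M1_pos by auto
  have f0: "0 \<le> f r" if "r \<le> h" for r
    unfolding f_def using that g by (intro add_nonneg_nonneg mult_nonneg_nonneg[OF Cm(1)] mult_nonneg_nonneg[OF Cm(2)]) (auto split: split_indicator)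
  have fm: "f \<in> borel_measurable borel" unfolding f_def[abs_def] by measurable
  have fb: "\<bar>f r\<bar> \<le> Ca * M1 / m * (T + h - \<tau>) + Cb * m" if "0 < r" "r \<le> h" for r
  proof -
    have "f r \<le> Ca * M1 / m * (T + h - \<tau>) + Cb * m * 1"
      unfolding f_def using that Cm by (intro add_mono mult_left_mono) (auto split: split_indicator)
    then show ?thesis using f0[OF that(2)] by simp
  qed
  note fi = step_law_integral_dur[OF lev e lam h(1) W_jump fm fb, where 'd = 'd]
  have "(\<integral>\<^sup>+N. ennreal (potential (chain_step s N)) * indicator good (chain_step s N) \<partial>L) \<le> (\<integral>\<^sup>+N. ennreal (f (noise_dur h N)) \<partial>L)"
  proof (rule nn_integral_mono_AE)
    show "AE N in L. ennreal (potential (chain_step s N)) * indicator good (chain_step s N) \<le> ennreal (f (noise_dur h N))"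
      using AE_noise_dur[OF lev e lam h(1)]
    proof eventually_elim
      case (elim N)
      obtain \<tau>' x' y' z' where s': "chain_step (\<tau>, x, y, z) N = (\<tau>', x', y', z')" by (cases "chain_step (\<tau>, x, y, z) N")
      have \<tau>': "\<tau>' = \<tau> + noise_dur h N" using good_step(1)[OF s[unfolded s_eq] _ _ s'] elim by simp
      show ?case
      proof (cases "(\<tau>', x', y', z') \<in> good")
        case True
        then have "\<tau>' < T" by (rule goodD)
        then have "potential (\<tau>', x', y', z') = f (noise_dur h N)"
          by (simp add: potential_def f_def \<tau>' indicator_def algebra_simps)
        then show ?thesis using True by (simp add: s_eq s')
      qed (simp add: s_eq s')
    qed
  qed
  also have "\<dots> = ennreal (\<integral>N. f (noise_dur h N) \<partial>L)"
  proof (rule nn_integral_eq_integral)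
    show "integrable L (\<lambda>N. f (noise_dur h N))" by (rule fi(1))
    show "AE N in L. 0 \<le> f (noise_dur h N)"
      using AE_noise_dur[OF lev e lam h(1)] by eventually_elim (simp add: f0)
  qed
  also have "(\<integral>N. f (noise_dur h N) \<partial>L) = (\<integral>w. f (dur h w) \<partial>clock lam h)" using fi(2) by (simp add: lam_def)
  also have "\<dots> = Ca * M1 / m * (T + h - \<tau> - m) + Cb * m * (1 - (\<integral>w. indicator {T - \<tau>..} (dur h w) \<partial>clock lam h))"
  proof -
    interpret C: prob_space "clock lam h" by (rule prob_space_clock[OF lam_pos h(1)])
    have i: "integrable (clock lam h) (\<lambda>w. indicator {T - \<tau>..} (dur h w) :: real)"
      by (rule clock_integral_dur(1)[OF lam_pos h(1), of _ 1]) auto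
    show ?thesis unfolding f_def using i clock_mean[OF lam_pos h(1)] by (simp add: C.prob_space m_def)
  qed
  finally have 1: "(\<integral>\<^sup>+N. ennreal (potential (chain_step s N)) * indicator good (chain_step s N) \<partial>L)
    \<le> ennreal (Ca * M1 / m * (T + h - \<tau> - m) + Cb * m * (1 - (\<integral>w. indicator {T - \<tau>..} (dur h w) \<partial>clock lam h)))" .
  let ?p = "\<integral>w. indicator {T - \<tau>..} (dur h w) \<partial>clock lam h"
  have "overshoot \<tau> \<le> m * ?p"
    unfolding overshoot_def m_def using g by (intro clock_overshoot[OF lam_pos h(1)]) auto
  then have "Cb * overshoot \<tau> \<le> Cb * (m * ?p)" using Cb_nonneg by (rule mult_left_mono)
  moreover have "Ca * M1 / m * (T + h - \<tau> - m) = Ca * M1 / m * (T + h - \<tau>) - Ca * M1"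
    using m_pos by (simp add: field_simps)
  ultimately have 2: "(Ca * M1 / m * (T + h - \<tau> - m) + Cb * m * (1 - ?p)) + rate s \<le> potential s"
    by (simp add: s_eq rate_def potential_def algebra_simps)
  have 3: "0 \<le> rate s"
    using Ca_nonneg Cb_nonneg M1_pos overshoot_nonneg by (simp add: s_eq rate_def)
  have 4: "0 \<le> Ca * M1 / m * (T + h - \<tau> - m) + Cb * m * (1 - ?p)"
  proof -
    have "0 \<le> (\<integral>w. f (dur h w) \<partial>clock lam h)"
      by (rule integral_nonneg_AE, rule eventually_mono[OF AE_clock_dur[OF lam_pos h(1)]]) (simp add: f0)
    then show ?thesis using \<open>(\<integral>w. f (dur h w) \<partial>clock lam h) = _\<close> by simp
  qed
  have "(\<integral>\<^sup>+N. ennreal (potential (chain_step s N)) * indicator good (chain_step s N) \<partial>L) + ennreal (rate s)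
    \<le> ennreal (Ca * M1 / m * (T + h - \<tau> - m) + Cb * m * (1 - ?p)) + ennreal (rate s)"
    by (rule add_right_mono[OF 1])
  also have "\<dots> = ennreal ((Ca * M1 / m * (T + h - \<tau> - m) + Cb * m * (1 - ?p)) + rate s)"
    by (rule ennreal_plus[symmetric, OF 4 3])
  also have "\<dots> \<le> ennreal (potential s)" by (rule ennreal_leI[OF 2])
  finally show ?thesis .
qed

definition "Hc = one_step.H_const n R \<nu> e K R"
definition "payoff_const = max (K * (1 + R) ^ n * E1 + R * E1 * R)
  (E1 * Hc * (\<integral>N. (1 + norm (snd (snd (snd (snd N))))) ^ n \<partial>L) + (R * E1 * R + h * (R * E1)))"

lemma payoff_step_integrable_bound:
  assumes s: "s \<in> good"
  shows "(\<integral>\<^sup>+N. ennreal \<bar>payoff u_frozen (chain_step s N)\<bar> \<partial>L) \<le> ennreal payoff_const"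
proof -
  obtain \<tau> x y z where s_eq: "s = (\<tau>, x, y, z)" by (cases s)
  note g = goodD[OF s[unfolded s_eq]]
  interpret O: one_step n R h \<nu> e x "b \<tau> x" "\<sigma> \<tau> x" \<beta> "F \<tau> x" "c \<tau> x" K "\<lambda>\<theta>. u_frozen (\<tau> + \<theta>)"
    by (rule one_step_at[OF g(1-3)])
  have t: "\<tau> \<in> {t0..T}" using g by simp
  interpret L: prob_space L by (rule prob_space_step_law[OF lev e lam h(1)])
  let ?W = "\<lambda>N :: ('d, 'm) noise. (1 + norm (snd (snd (snd (snd N))))) ^ n"
  have Wi: "integrable L ?W"
  proof (rule step_law_integral(1)[OF lev e lam h(1) W_jump])
    show "?W \<in> borel_measurable noise_space" by measurable
    show "\<exists>C. \<forall>\<xi> \<eta> I \<delta> z. norm \<xi> \<le> r \<longrightarrow> norm \<eta> \<le> r \<longrightarrow> 0 < \<delta> \<longrightarrow> \<delta> \<le> h \<longrightarrow>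
      \<bar>?W (\<xi>, \<eta>, I, \<delta>, z)\<bar> \<le> C * (1 + norm z) ^ n" for r by (intro exI[of _ 1]) simp
  qed
  have le: "AE N in L. \<bar>payoff u_frozen (chain_step s N)\<bar> \<le> E1 * Hc * ?W N + (R * E1 * R + h * (R * E1))"
    using AE_step_law[OF lev e lam h(1)] AE_noise_dur[OF lev e lam h(1)]
  proof eventually_elim
    case (elim N)
    obtain \<xi> \<eta> I \<delta> j where N: "N = (\<xi>, \<eta>, I, \<delta>, j)" by (cases N)
    have sb: "sign_bounded (\<xi>, \<eta>)" "0 < \<delta>" "\<delta> \<le> h" using elim(1) by (auto simp: N)
    have "norm (O.S (\<xi>, \<eta>)) \<le> R" unfolding O.S_def by (rule noise[OF t g(3) sb(1)])
    then have "\<bar>O.H N\<bar> \<le> Hc * ?W N" unfolding N Hc_def using O.H_bound_S[OF _ sb(2,3)] by simp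
    then have 1: "\<bar>y * O.H N\<bar> \<le> E1 * (Hc * ?W N)"
      unfolding abs_mult using g(5) E1 by (intro mult_mono) auto
    have "\<bar>g \<tau> x\<bar> \<le> R" using bounds[OF t g(3)] by simp
    then have "\<bar>noise_dur h N * (g \<tau> x * y)\<bar> \<le> h * (R * E1)"
      unfolding abs_mult using elim(2) g(5) E1 R h by (intro mult_mono) auto
    then show ?case
      unfolding s_eq payoff_step[OF g(1-3)] using 1 g(7) by (simp add: mult.assoc)
  qed
  have Bi: "integrable L (\<lambda>N. E1 * Hc * ?W N + (R * E1 * R + h * (R * E1)))" using Wi by simp
  have pi: "integrable L (\<lambda>N. payoff u_frozen (chain_step s N))" unfolding s_eq by (rule one_step_defect(1)[OF g(1-3)])
  have "(\<integral>\<^sup>+N. ennreal \<bar>payoff u_frozen (chain_step s N)\<bar> \<partial>L) = ennreal (\<integral>N. \<bar>payoff u_frozen (chain_step s N)\<bar> \<partial>L)"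
    by (rule nn_integral_eq_integral) (use pi in auto)
  also have "\<dots> \<le> ennreal (\<integral>N. E1 * Hc * ?W N + (R * E1 * R + h * (R * E1)) \<partial>L)"
    by (intro ennreal_leI integral_mono_AE integrable_abs pi Bi le)
  also have "(\<integral>N. E1 * Hc * ?W N + (R * E1 * R + h * (R * E1)) \<partial>L) = E1 * Hc * (\<integral>N. ?W N \<partial>L) + (R * E1 * R + h * (R * E1))"
    using Wi by (simp add: L.prob_space)
  also have "ennreal \<dots> \<le> ennreal payoff_const" by (intro ennreal_leI) (simp add: payoff_const_def)
  finally show ?thesis .
qed

lemma payoff_bound:
  assumes s: "s \<in> good"
  shows "\<bar>payoff u_frozen s\<bar> \<le> payoff_const"
proof -
  obtain \<tau> x y z where s_eq: "s = (\<tau>, x, y, z)" by (cases s)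
  note g = goodD[OF s[unfolded s_eq]]
  have t: "\<tau> \<in> {t0..T}" using g by simp
  have "\<bar>u_frozen \<tau> x\<bar> \<le> K * (1 + norm x) ^ n"
    using smooth_wt_bound[OF u_smooth[OF t], of x] g by (simp add: u_frozen_eq)
  also have "\<dots> \<le> K * (1 + R) ^ n" using K bounds[OF t g(3)] by (intro mult_left_mono power_mono) auto
  finally have "\<bar>u_frozen \<tau> x * y\<bar> \<le> K * (1 + R) ^ n * E1"
    unfolding abs_mult using g(5) K R by (intro mult_mono) auto
  then have "\<bar>payoff u_frozen s\<bar> \<le> K * (1 + R) ^ n * E1 + R * E1 * R" using g(7) by (simp add: s_eq)
  then show ?thesis by (simp add: payoff_const_def)
qed

definition "test s = (case s of (\<tau>, X, Y, Z) \<Rightarrow> T \<le> \<tau> \<or> X \<notin> G)" for s :: "'d state"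

lemma test_measurable [measurable]: "Measurable.pred borel test"
proof -
  note [measurable] = borel_open[OF openG]
  have "test = (\<lambda>s. T \<le> fst s \<or> \<not> fst (snd s) \<in> G)" by (auto simp: test_def fun_eq_iff)
  moreover have "Measurable.pred state_space (\<lambda>s. T \<le> fst s \<or> \<not> fst (snd s) \<in> G)" by measurable
  ultimately show ?thesis by (simp only: state_space_borel)
qed

text \<open>Where the test succeeds, the boundary values of \<open>u\<close> are those of \<open>\<phi>\<close>.\<close>

lemma payoff_at_exit:
  assumes "t0 < \<tau>" "T \<le> \<tau> \<or> X \<notin> G"
  shows "payoff \<phi> (min \<tau> T, X, Y, Z) = payoff u_frozen (\<tau>, X, Y, Z)"
proof -
  have "(min \<tau> T, X) \<in> Qc t0 T G"
    using assms t0T closure_subset[of G] by (auto simp: Qc_def min_def)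
  then have "u (min \<tau> T) X = \<phi> (min \<tau> T) X"
    using u_sol unfolding dirichlet_solution_def by force
  then show ?thesis using assms(1) by (simp add: u_frozen_eq)
qed

text \<open>Almost surely all time steps are positive, and then the exit from \<open>good\<close> happens exactly when the
  stopping test first succeeds.\<close>

theorem walk_error:
  fixes M :: "'w measure" and N
  assumes noise: "walk_noise \<nu> e h M N"
  defines "P \<equiv> \<lambda>\<omega>. payoff \<phi> (walk_output T G (walk b \<sigma> c g F \<gamma> \<beta> h t0 x0 (\<lambda>k. N k \<omega>)))"
  shows "integrable M P"
    and "\<bar>(\<integral>\<omega>. P \<omega> \<partial>M) - u t0 x0\<bar> \<le> Ca * M1 / m * (2 * (T - t0)) + Cb * m"
proof -
  let ?S = "\<lambda>k \<omega>. walk b \<sigma> c g F \<gamma> \<beta> h t0 x0 (\<lambda>k. N k \<omega>) k"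
  interpret M: prob_space M using noise by (simp add: walk_noise_def)
  interpret C: iid_chain M L N chain_step "(t0, x0, 1, 0)" ?S
    by unfold_locales (use noise chain_step_measurable in \<open>auto simp: walk_noise_def chain_step_def case_prod_beta'\<close>)
  define \<kappa> where "\<kappa> \<omega> = (LEAST k. ?S k \<omega> \<notin> good)" for \<omega>
  note cm [measurable] = payoff_measurable[OF u_frozen_measurable] good_sets overshoot_measurable
  have rate_meas: "rate \<in> borel_measurable borel" and pot_meas: "potential \<in> borel_measurable borel"
  proof -
    have "(\<lambda>s :: 'd state. Ca * M1 + Cb * overshoot (fst s)) \<in> borel_measurable state_space" by measurable
    then show "rate \<in> borel_measurable borel" by (simp add: rate_def case_prod_beta' state_space_borel)
    have "(\<lambda>s :: 'd state. Ca * M1 / m * (T + h - fst s) + Cb * m) \<in> borel_measurable state_space" by measurable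
    then show "potential \<in> borel_measurable borel" by (simp add: potential_def case_prod_beta' state_space_borel)
  qed
  have killed: "AE \<omega> in M. ?S (\<kappa> \<omega>) \<omega> \<notin> good" "integrable M (\<lambda>\<omega>. payoff u_frozen (?S (\<kappa> \<omega>) \<omega>))"
      "\<bar>(\<integral>\<omega>. payoff u_frozen (?S (\<kappa> \<omega>) \<omega>) \<partial>M) - payoff u_frozen (t0, x0, 1, 0)\<bar> \<le> potential (t0, x0, 1, 0)"
  proof -
    have "0 < Ca * M1" using Ca_pos M1_pos by simp
    moreover have "Ca * M1 \<le> rate s" if "s \<in> good" for s
      using Cb_nonneg overshoot_nonneg by (auto simp: rate_def split: prod.split)
    moreover have "0 \<le> potential s" if "s \<in> good" for s
      using that Ca_nonneg Cb_nonneg M1_pos m_pos h by (auto simp: potential_def good_def)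
    moreover have "\<bar>(\<integral>N. payoff u_frozen (chain_step s N) \<partial>L) - payoff u_frozen s\<bar> \<le> rate s" if s: "s \<in> good" for s
    proof -
      obtain \<tau> x y z where s_eq: "s = (\<tau>, x, y, z)" by (cases s)
      note g = goodD[OF s[unfolded s_eq]]
      have "0 \<le> C1 * (1 + norm \<gamma>)\<^sup>2 * M1 + K * (1 + R) ^ n * overshoot \<tau>"
        using C1_pos K R M1_pos overshoot_nonneg by simp
      from order_trans[OF one_step_defect(2)[OF g(1-3)] mult_right_mono[OF g(5) this]]
      show ?thesis by (simp add: s_eq rate_def Ca_def Cb_def algebra_simps)
    qed
    ultimately have *: "(AE \<omega> in M. ?S (\<kappa> \<omega>) \<omega> \<notin> good) \<and> integrable M (\<lambda>\<omega>. payoff u_frozen (?S (\<kappa> \<omega>) \<omega>)) \<and>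
      \<bar>(\<integral>\<omega>. payoff u_frozen (?S (\<kappa> \<omega>) \<omega>) \<partial>M) - payoff u_frozen (t0, x0, 1, 0)\<bar> \<le> potential (t0, x0, 1, 0)"
      unfolding \<kappa>_def
      by (intro conjI C.killed_chain_defect[where B = good and V = "payoff u_frozen" and \<Psi> = potential and r = rate and C = payoff_const and ?r0.0 = "Ca * M1"]
          good_sets cm rate_meas pot_meas good_init potential_drop payoff_bound payoff_step_integrable_bound) auto
    then show "AE \<omega> in M. ?S (\<kappa> \<omega>) \<omega> \<notin> good" "integrable M (\<lambda>\<omega>. payoff u_frozen (?S (\<kappa> \<omega>) \<omega>))"
      "\<bar>(\<integral>\<omega>. payoff u_frozen (?S (\<kappa> \<omega>) \<omega>) \<partial>M) - payoff u_frozen (t0, x0, 1, 0)\<bar> \<le> potential (t0, x0, 1, 0)" by auto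
  qed
  have "AE \<omega> in M. \<forall>k. 0 < noise_dur h (N k \<omega>) \<and> noise_dur h (N k \<omega>) \<le> h"
    unfolding AE_all_countable
  proof
    fix k
    have "AE x in distr M L (N k). 0 < noise_dur h x \<and> noise_dur h x \<le> h"
      unfolding C.law by (rule AE_noise_dur[OF lev e lam h(1)])
    then show "AE \<omega> in M. 0 < noise_dur h (N k \<omega>) \<and> noise_dur h (N k \<omega>) \<le> h"
      by (rule AE_distrD[OF C.N_measurable])
  qed
  then have P_eq: "AE \<omega> in M. P \<omega> = payoff u_frozen (?S (\<kappa> \<omega>) \<omega>)"
    using killed(1)
  proof eventually_elim
    case (elim \<omega>)
    have before: "?S j \<omega> \<in> good" if "j < \<kappa> \<omega>" for j
      using not_less_Least[of j "\<lambda>k. ?S k \<omega> \<notin> good"] that unfolding \<kappa>_def by blast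
    have "\<kappa> \<omega> \<noteq> 0" using elim(2) good_init by (metis walk.simps(1))
    then obtain i where i: "\<kappa> \<omega> = Suc i" using not0_implies_Suc by blast
    obtain \<tau> x y z where s: "?S i \<omega> = (\<tau>, x, y, z)" by (cases "?S i \<omega>")
    obtain \<tau>' x' y' z' where s': "?S (\<kappa> \<omega>) \<omega> = (\<tau>', x', y', z')" by (cases "?S (\<kappa> \<omega>) \<omega>")
    have gi: "(\<tau>, x, y, z) \<in> good" using before[of i] s i by simp
    have st: "chain_step (\<tau>, x, y, z) (N i \<omega>) = (\<tau>', x', y', z')" using s s' i by (simp add: chain_step_def)
    note gs = good_step[OF gi _ _ st]
    have \<tau>': "t0 < \<tau>'" using gs(1) elim(1)[rule_format, of i] goodD(1)[OF gi] by simp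
    have ex: "T \<le> \<tau>' \<or> x' \<notin> G" using gs(2) elim(1)[rule_format, of i] elim(2) s' by auto
    have "stop_index T G (\<lambda>k. ?S k \<omega>) = \<kappa> \<omega>"
      unfolding stop_index_def
    proof (rule Least_equality)
      show "0 < \<kappa> \<omega> \<and> (case ?S (\<kappa> \<omega>) \<omega> of (\<tau>, X, Y, Z) \<Rightarrow> T \<le> \<tau> \<or> X \<notin> G)"
        using ex s' i by simp
      fix j assume j: "0 < j \<and> (case ?S j \<omega> of (\<tau>, X, Y, Z) \<Rightarrow> T \<le> \<tau> \<or> X \<notin> G)"
      show "\<kappa> \<omega> \<le> j"
      proof (rule ccontr)
        assume "\<not> \<kappa> \<omega> \<le> j"
        then have "?S j \<omega> \<in> good" by (intro before) simp
        then show False using j by (auto simp: good_def)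
      qed
    qed
    then show ?case
      using payoff_at_exit[OF \<tau>' ex] by (simp add: P_def walk_output_def s')
  qed
  have P_meas: "P \<in> borel_measurable M"
  proof -
    have ti: "Measurable.pred M (\<lambda>\<omega>. 0 < k \<and> test (?S k \<omega>))" for k
      using measurable_compose[OF C.S_measurable[of k] test_measurable] by simp
    have si: "(\<lambda>\<omega>. LEAST k. 0 < k \<and> test (?S k \<omega>)) \<in> M \<rightarrow>\<^sub>M count_space UNIV"
      by (rule measurable_Least) (rule ti)
    define out where "out s = (case s of (\<tau>, X, Y, Z) \<Rightarrow> payoff \<phi> (min \<tau> T, X, Y, Z))" for s :: "'d state"
    have out: "out \<in> borel_measurable borel"
    proof -
      have "(\<lambda>s :: 'd state. \<phi> (min (fst s) T) (fst (snd s)) * fst (snd (snd s)) + snd (snd (snd s))) \<in> borel_measurable state_space"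
        by measurable
      then show ?thesis by (simp add: out_def[abs_def] case_prod_beta' state_space_borel)
    qed
    have "(\<lambda>\<omega>. (\<lambda>k \<omega>. out (?S k \<omega>)) (LEAST k. 0 < k \<and> test (?S k \<omega>)) \<omega>) \<in> borel_measurable M"
      by (rule measurable_compose_countable[OF _ si]) (rule measurable_compose[OF C.S_measurable out])
    moreover have "P = (\<lambda>\<omega>. (\<lambda>k \<omega>. out (?S k \<omega>)) (LEAST k. 0 < k \<and> test (?S k \<omega>)) \<omega>)"
      by (auto simp: P_def fun_eq_iff walk_output_def out_def stop_index_def test_def split: prod.split)
    ultimately show ?thesis by simp
  qed
  have V_meas: "(\<lambda>\<omega>. payoff u_frozen (?S (\<kappa> \<omega>) \<omega>)) \<in> borel_measurable M" using killed(2) by simp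
  show "integrable M P" using killed(2) integrable_cong_AE[OF P_meas V_meas P_eq] by simp
  have "(\<integral>\<omega>. P \<omega> \<partial>M) = (\<integral>\<omega>. payoff u_frozen (?S (\<kappa> \<omega>) \<omega>) \<partial>M)" by (rule integral_cong_AE[OF P_meas V_meas P_eq])
  moreover have "payoff u_frozen (t0, x0, 1, 0) = u t0 x0" using t0T by (simp add: u_frozen_eq)
  moreover have "potential (t0, x0, 1, 0) \<le> Ca * M1 / m * (2 * (T - t0)) + Cb * m"
  proof -
    have "Ca * M1 / m * (T + h - t0) \<le> Ca * M1 / m * (2 * (T - t0))"
      using Ca_nonneg M1_pos m_pos h by (intro mult_left_mono) auto
    then show ?thesis by (simp add: potential_def)
  qed
  ultimately show "\<bar>(\<integral>\<omega>. P \<omega> \<partial>M) - u t0 x0\<bar> \<le> Ca * M1 / m * (2 * (T - t0)) + Cb * m"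
    using killed(3) by simp
qed

end

section \<open>Uniform constants and the error estimate\<close>

lemma square_le_imp_le: "r\<^sup>2 \<le> Q \<Longrightarrow> r \<le> 1 + Q" for r Q :: real
proof (cases "1 \<le> r")
  case True
  then have "r \<le> r\<^sup>2" by (rule self_le_power) simp
  then show "r\<^sup>2 \<le> Q \<Longrightarrow> r \<le> 1 + Q" by simp
next
  case False
  then show "r\<^sup>2 \<le> Q \<Longrightarrow> r \<le> 1 + Q" using zero_le_power2[of r] by linarith
qed

lemma levy_second_moment_pos:
  assumes lev: "levy_density \<nu>" and i: "0 < intensity \<nu> (1/2)"
    and int: "integrable (levy \<nu>) (\<lambda>z. (norm z)\<^sup>2 * (1 + norm z) ^ 0)"
  shows "0 < levy_moment \<nu> 0"
proof -
  have "intensity \<nu> (1/2) * (1/4) = (\<integral>z. indicator {z. 1/2 < norm z} z * (1/4) \<partial>levy \<nu>)"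
    by (simp add: intensity_def)
  also have "\<dots> \<le> levy_moment \<nu> 0"
    unfolding levy_moment_def
  proof (rule integral_mono'[OF int])
    fix z :: "real ^ 'a"
    have "1/4 \<le> (norm z)\<^sup>2" if "1/2 < norm z" using power_mono[of "1/2" "norm z" 2] that by (simp add: power2_eq_square)
    then show "indicator {z. 1/2 < norm z} z * (1/4) \<le> (norm z)\<^sup>2 * (1 + norm z) ^ 0" by (simp add: indicator_def)
  qed simp
  finally show ?thesis using i by simp
qed

text \<open>The bound on \<open>F\<close> comes out of the integral in the growth condition because the Levy measure is not
  zero, which the positive intensity guarantees.\<close>

lemma growth_cond_bounds:
  fixes F :: "real \<Rightarrow> real ^ 'd \<Rightarrow> real ^ 'm ^ 'd"
  assumes lev: "levy_density \<nu>" and i: "0 < intensity \<nu> (1/2)"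
    and int: "integrable (levy \<nu>) (\<lambda>z. (norm z)\<^sup>2 * (1 + norm z) ^ 0)"
    and growth: "growth_cond t0 T \<nu> b \<sigma> c g F" and "bounded G"
  shows "\<exists>C\<ge>1. \<forall>t\<in>{t0..T}. \<forall>x\<in>G. norm x \<le> C \<and> norm (b t x) \<le> C \<and> norm (\<sigma> t x) \<le> C \<and> \<bar>g t x\<bar> \<le> C
    \<and> norm (F t x) \<le> C \<and> \<bar>c t x\<bar> \<le> C"
proof -
  obtain K where K: "0 < K" "\<And>x t. t \<in> {t0..T} \<Longrightarrow>
        ennreal ((norm (b t x))\<^sup>2 + (norm (\<sigma> t x))\<^sup>2 + \<bar>g t x\<bar>\<^sup>2)
        + (\<integral>\<^sup>+ z. ennreal ((norm (F t x))\<^sup>2 * (norm z)\<^sup>2) \<partial>levy \<nu>)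
        \<le> ennreal (K * (1 + norm x)\<^sup>2) \<and> \<bar>c t x\<bar> \<le> K"
    using growth unfolding growth_cond_def by blast
  obtain B where B: "0 < B" "\<And>x. x \<in> G \<Longrightarrow> norm x \<le> B" using assms(5) unfolding bounded_pos by blast
  let ?s = "levy_moment \<nu> 0"
  have s: "0 < ?s" by (rule levy_second_moment_pos[OF lev i int])
  define Q where "Q = K * (1 + B)\<^sup>2"
  have Q: "0 \<le> Q" using K B by (simp add: Q_def)
  define C where "C = 1 + Q + Q / ?s + B + K"
  have main: "norm x \<le> C \<and> norm (b t x) \<le> C \<and> norm (\<sigma> t x) \<le> C \<and> \<bar>g t x\<bar> \<le> C \<and> norm (F t x) \<le> C \<and> \<bar>c t x\<bar> \<le> C"
    if t: "t \<in> {t0..T}" and x: "x \<in> G" for t x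
  proof -
    have le: "ennreal ((norm (b t x))\<^sup>2 + (norm (\<sigma> t x))\<^sup>2 + \<bar>g t x\<bar>\<^sup>2)
        + (\<integral>\<^sup>+ z. ennreal ((norm (F t x))\<^sup>2 * (norm z)\<^sup>2) \<partial>levy \<nu>) \<le> ennreal Q"
    proof -
      have "K * (1 + norm x)\<^sup>2 \<le> Q" unfolding Q_def using B(2)[OF x] K(1) by (intro mult_left_mono power_mono) auto
      then show ?thesis using K(2)[OF t, of x] by (meson ennreal_leI order_trans)
    qed
    have "ennreal ((norm (b t x))\<^sup>2 + (norm (\<sigma> t x))\<^sup>2 + \<bar>g t x\<bar>\<^sup>2) \<le> ennreal Q"
      by (rule order_trans[OF _ le]) simp
    then have sum: "(norm (b t x))\<^sup>2 + (norm (\<sigma> t x))\<^sup>2 + \<bar>g t x\<bar>\<^sup>2 \<le> Q" using Q by (simp only: ennreal_le_iff)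
    then have "(norm (b t x))\<^sup>2 \<le> Q" "(norm (\<sigma> t x))\<^sup>2 \<le> Q" "\<bar>g t x\<bar>\<^sup>2 \<le> Q"
      using zero_le_power2[of "norm (b t x)"] zero_le_power2[of "norm (\<sigma> t x)"] zero_le_power2[of "\<bar>g t x\<bar>"] by linarith+
    note bsg = this[THEN square_le_imp_le]
    have "(\<integral>\<^sup>+ z. ennreal ((norm (F t x))\<^sup>2 * (norm z)\<^sup>2) \<partial>levy \<nu>) \<le> ennreal Q"
      by (rule order_trans[OF _ le]) simp
    moreover have "(\<integral>\<^sup>+ z. ennreal ((norm (F t x))\<^sup>2 * (norm z)\<^sup>2) \<partial>levy \<nu>) = ennreal ((norm (F t x))\<^sup>2 * ?s)"
      unfolding levy_moment_def integral_mult_right_zero[symmetric]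
      using int by (subst nn_integral_eq_integral[symmetric]) auto
    ultimately have "(norm (F t x))\<^sup>2 * ?s \<le> Q" using Q by simp
    then have "(norm (F t x))\<^sup>2 \<le> Q / ?s" using s by (simp add: pos_le_divide_eq)
    note f = square_le_imp_le[OF this]
    have "0 \<le> Q / ?s" using Q s by simp
    then show ?thesis using bsg f B(2)[OF x] B(1) K(1) K(2)[OF t, of x] Q unfolding C_def by linarith
  qed
  have "0 \<le> Q / ?s" using Q s by simp
  then have "1 \<le> C" using Q B K unfolding C_def by linarith
  then show ?thesis using main by blast
qed

theorem theorem3p9:
  fixes t0 T :: real
    and G :: "(real ^ 'd) set"
    and \<nu> :: "real ^ 'm \<Rightarrow> real"
    and a \<sigma> :: "real \<Rightarrow> real ^ 'd \<Rightarrow> real ^ 'd ^ 'd"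
    and b :: "real \<Rightarrow> real ^ 'd \<Rightarrow> real ^ 'd"
    and c g \<phi> :: "real \<Rightarrow> real ^ 'd \<Rightarrow> real"
    and F :: "real \<Rightarrow> real ^ 'd \<Rightarrow> real ^ 'm ^ 'd"
    and \<beta> :: "real \<Rightarrow> real ^ 'm ^ 'm"
    and u :: "real \<Rightarrow> real \<Rightarrow> real ^ 'd \<Rightarrow> real"
    and K' q :: real
    and x0 :: "real ^ 'd"
  assumes "t0 < T"
    and "open G" "connected G" "bounded G"
    and "levy_density \<nu>"
    and "(\<lambda>(t, x). b t x) \<in> borel_measurable borel"
    and "(\<lambda>(t, x). \<sigma> t x) \<in> borel_measurable borel"
    and "(\<lambda>(t, x). c t x) \<in> borel_measurable borel"
    and "(\<lambda>(t, x). g t x) \<in> borel_measurable borel"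
    and "(\<lambda>(t, x). F t x) \<in> borel_measurable borel"
    and "(\<lambda>(t, x). \<phi> t x) \<in> borel_measurable borel"
    and "\<And>t x. t \<in> {t0..T} \<Longrightarrow> \<sigma> t x ** transpose (\<sigma> t x) = a t x"
    and "\<And>\<epsilon>. \<epsilon> \<in> {0<..<1} \<Longrightarrow> \<beta> \<epsilon> ** transpose (\<beta> \<epsilon>) = small_jump_cov \<nu> \<epsilon>"
    and "\<And>\<epsilon>. \<epsilon> \<in> {0<..<1} \<Longrightarrow> 0 < intensity \<nu> \<epsilon>"
    and "lipschitz_cond t0 T \<nu> b \<sigma> c g F"
    and "growth_cond t0 T \<nu> b \<sigma> c g F"
    and "jump_moment_cond \<nu>"
    and "\<And>\<epsilon>. \<epsilon> \<in> {0<..<1} \<Longrightarrow>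
           C_class t0 T 2 4 (u \<epsilon>) \<and> dirichlet_solution t0 T G \<nu> a b c g F \<phi> \<epsilon> (u \<epsilon>)"
    and "0 < K'" "1 \<le> q"
    and "\<And>\<epsilon> l is. \<epsilon> \<in> {0<..<1} \<Longrightarrow> 2 * l + length is \<le> 4 \<Longrightarrow>
           pderivs_exist t0 T l is (u \<epsilon>) \<and>
           (\<forall>t\<in>{t0..T}. \<forall>x. \<bar>pderivs t0 T l is (u \<epsilon>) t x\<bar> \<le> K' * (1 + norm x powr q))"
    and "(t0, x0) \<in> Q t0 T G"
  shows "\<exists>K>0. \<forall>\<epsilon>\<in>{0<..<1}. \<forall>h\<in>{0<..T - t0}.
           \<forall>(M :: 'w measure) N. walk_noise \<nu> \<epsilon> h M N \<longrightarrow>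
             (let P = (\<lambda>\<omega>. payoff \<phi> (walk_output T G
                         (walk b \<sigma> c g F (drift_corr \<nu> \<epsilon>) (\<beta> \<epsilon>) h t0 x0 (\<lambda>k. N k \<omega>))))
              in integrable M P \<and>
                 \<bar>(\<integral>\<omega>. P \<omega> \<partial>M) - u \<epsilon> t0 x0\<bar>
                 \<le> K * (1 + (norm (drift_corr \<nu> \<epsilon>))\<^sup>2) *
                     (1 / intensity \<nu> \<epsilon>
                        - h * (exp (- intensity \<nu> \<epsilon> * h) / (1 - exp (- intensity \<nu> \<epsilon> * h))))
                   + K * ((1 - exp (- intensity \<nu> \<epsilon> * h)) / intensity \<nu> \<epsilon>))"
proof -
  note t0T = assms(1) and openG = assms(2) and bG = assms(4) and lev = assms(5)
  note meas = assms(6-11) and \<sigma>a = assms(12) and \<beta> = assms(13) and lam = assms(14) and growth = assms(16)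
  note jm = assms(17) and sol = assms(18) and K' = assms(19) and q = assms(20) and ub = assms(21) and x0Q = assms(22)
  have lam2: "0 < intensity \<nu> (1/2)" by (rule lam) simp
  note int = levy_moment_integrable[OF lev jm lam2]
  define n where "n = nat \<lceil>q\<rceil>"
  have n: "q \<le> real n" unfolding n_def by linarith
  obtain C where C: "1 \<le> C" "\<And>t x. t \<in> {t0..T} \<Longrightarrow> x \<in> G \<Longrightarrow> norm x \<le> C \<and> norm (b t x) \<le> C \<and> norm (\<sigma> t x) \<le> C
    \<and> \<bar>g t x\<bar> \<le> C \<and> norm (F t x) \<le> C \<and> \<bar>c t x\<bar> \<le> C"
    using growth_cond_bounds[OF lev lam2 int growth bG] by blast
  define B where "B = 1 + CARD('m) * levy_moment \<nu> n"
  have B: "1 \<le> B" using levy_moment_nonneg[of \<nu> n] by (simp add: B_def)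
  define R where "R = C + (T - t0) + C * CARD('d) + C * (B * CARD('m)) + CARD('m)"
  have R: "1 \<le> R" "C \<le> R" "T - t0 \<le> R" "C * CARD('d) + C * (B * CARD('m)) \<le> R" "CARD('m) \<le> R"
  proof -
    have "0 \<le> C * CARD('d)" "0 \<le> C * (B * CARD('m))" using C(1) B by auto
    then show "1 \<le> R" "C \<le> R" "T - t0 \<le> R" "C * CARD('d) + C * (B * CARD('m)) \<le> R" "CARD('m) \<le> R"
      using C(1) t0T unfolding R_def by linarith+
  qed
  \<comment> \<open>The factor 2 absorbs the passage from \<open>1 + |y|\<^sup>q\<close> to \<open>(1 + |y|)\<^sup>n\<close>.\<close>
  define K where "K = 2 * K'"
  define E1 where "E1 = exp (R * (T - t0))"
  define C1 where "C1 = one_step.cT TYPE('d) n R \<nu> K + 6 * K * (1 + R) ^ n"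
  \<comment> \<open>The factor 4 is 2 from the number of steps times 2 from \<open>(1 + |\<gamma>|)\<^sup>2 \<le> 2 (1 + |\<gamma>|\<^sup>2)\<close>.\<close>
  define KK where "KK = 1 + max (4 * (E1 * C1 * (T - t0))) (E1 * (K * (1 + R) ^ n))"
  show ?thesis
  proof (intro exI[of _ KK] conjI ballI allI impI)
    show "0 < KK"
    proof -
      have "0 \<le> E1 * (K * (1 + R) ^ n)" using K' R by (simp add: E1_def K_def)
      then show ?thesis by (simp add: KK_def)
    qed
    fix \<epsilon> h :: real and M :: "'w measure" and N :: "nat \<Rightarrow> 'w \<Rightarrow> ('d, 'm) noise"
    assume \<epsilon>: "\<epsilon> \<in> {0<..<1}" and h: "h \<in> {0<..T - t0}" and noise: "walk_noise \<nu> \<epsilon> h M N"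
    have nb: "norm (\<beta> \<epsilon>) \<le> B"
      unfolding B_def by (rule square_le_imp_le, rule norm_sqrt_small_jump_cov_le[OF lev _ int \<beta>[OF \<epsilon>]]) (use \<epsilon> in simp)
    interpret W: walk_model t0 T G \<nu> a \<sigma> b c g \<phi> F "\<beta> \<epsilon>" "u \<epsilon>" \<epsilon> h R K n x0
    proof
      show "t0 < T" "open G" "levy_density \<nu>" by fact+
      show "x0 \<in> G" using x0Q by (simp add: Q_def)
      show "norm x \<le> R \<and> norm (b t x) \<le> R \<and> norm (F t x) \<le> R \<and> \<bar>c t x\<bar> \<le> R \<and> \<bar>g t x\<bar> \<le> R"
        if "t \<in> {t0..T}" "x \<in> G" for t x using C(2)[OF that] R(2) by auto
      show "norm (\<sigma> t x *v fst \<zeta> + F t x *v (\<beta> \<epsilon> *v snd \<zeta>)) \<le> R"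
        if t: "t \<in> {t0..T}" "x \<in> G" and z: "sign_bounded \<zeta>" for t x \<zeta>
      proof -
        have "norm (\<sigma> t x *v fst \<zeta>) \<le> C * CARD('d)"
          using z C(2)[OF t] by (intro order_trans[OF norm_matrix_vector_le] mult_mono) (auto simp: sign_bounded_def)
        moreover have "norm (\<beta> \<epsilon> *v snd \<zeta>) \<le> B * CARD('m)"
          using z nb B by (intro order_trans[OF norm_matrix_vector_le] mult_mono) (auto simp: sign_bounded_def)
        then have "norm (F t x *v (\<beta> \<epsilon> *v snd \<zeta>)) \<le> C * (B * CARD('m))"
          using C(1) C(2)[OF t] by (intro order_trans[OF norm_matrix_vector_le[of "F t x" "\<beta> \<epsilon> *v snd \<zeta>"]] mult_mono) auto
        ultimately show ?thesis
          using norm_triangle_ineq[of "\<sigma> t x *v fst \<zeta>" "F t x *v (\<beta> \<epsilon> *v snd \<zeta>)"] R(4) by linarith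
      qed
      show "norm (drift_corr \<nu> \<epsilon>) \<le> R * intensity \<nu> \<epsilon>"
        by (rule order_trans[OF drift_corr_le[OF lev] mult_right_mono[OF R(5)]]) (use \<epsilon> lam[OF \<epsilon>] in auto)
      show "\<bar>pderivs t0 T l is (u \<epsilon>) t y\<bar> \<le> K * (1 + norm y) ^ n"
        if "2 * l + length is \<le> 4" "t \<in> {t0..T}" for l "is" t y
      proof -
        have "\<bar>pderivs t0 T l is (u \<epsilon>) t y\<bar> \<le> K' * (1 + norm y powr q)" using ub[OF \<epsilon> that(1)] that(2) by blast
        also have "\<dots> \<le> K' * (2 * (1 + norm y) ^ n)" using K' q n by (intro mult_left_mono powr_weight_le) auto
        finally show ?thesis by (simp add: K_def)
      qed
    qed (use meas \<sigma>a \<beta>[OF \<epsilon>] lam[OF \<epsilon>] int \<epsilon> h R sol[OF \<epsilon>] ub[OF \<epsilon>] K' in \<open>simp_all add: K_def\<close>)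
    let ?P = "\<lambda>\<omega>. payoff \<phi> (walk_output T G (walk b \<sigma> c g F (drift_corr \<nu> \<epsilon>) (\<beta> \<epsilon>) h t0 x0 (\<lambda>k. N k \<omega>)))"
    note err = W.walk_error[OF noise, unfolded W.\<gamma>_def]
    let ?r = "intensity \<nu> \<epsilon>" and ?g = "drift_corr \<nu> \<epsilon>"
    define br where "br = 1 / ?r - h * (exp (- ?r * h) / (1 - exp (- ?r * h)))"
    have r: "0 < ?r" by (rule lam[OF \<epsilon>])
    have br: "W.M1 / W.m = br"
    proof -
      define ex where "ex = exp (- ?r * h)"
      have "ex < 1" using r h by (simp add: ex_def)
      then show ?thesis using r h
        by (simp add: W.M1_def W.m_def W.lam_def wt_moment_0 mean_step_def br_def ex_def[symmetric] field_simps)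
    qed
    have br0: "0 \<le> br" using W.M1_pos W.m_pos by (simp add: br[symmetric])
    have m: "W.m = (1 - exp (- ?r * h)) / ?r" by (simp add: W.m_def W.lam_def mean_step_def)
    have g2: "(1 + norm ?g)\<^sup>2 \<le> 2 * (1 + (norm ?g)\<^sup>2)"
      using zero_le_power2[of "1 - norm ?g"] by (simp add: power2_eq_square algebra_simps)
    have EC: "0 \<le> E1 * C1" using W.C1_pos W.E1 by (simp add: W.C1_def W.E1_def C1_def E1_def)
    have "W.Ca * W.M1 / W.m * (2 * (T - t0)) = (E1 * C1 * (T - t0)) * 2 * (1 + norm ?g)\<^sup>2 * br"
      unfolding br[symmetric] by (simp add: W.Ca_def W.E1_def W.C1_def E1_def C1_def W.\<gamma>_def)
    also have "\<dots> \<le> (E1 * C1 * (T - t0)) * 2 * (2 * (1 + (norm ?g)\<^sup>2)) * br"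
      using EC t0T br0 g2 by (intro mult_right_mono mult_left_mono) auto
    also have "\<dots> = 4 * (E1 * C1 * (T - t0)) * ((1 + (norm ?g)\<^sup>2) * br)" by simp
    also have "\<dots> \<le> KK * ((1 + (norm ?g)\<^sup>2) * br)"
      using br0 by (intro mult_right_mono) (auto simp: KK_def)
    finally have 1: "W.Ca * W.M1 / W.m * (2 * (T - t0)) \<le> KK * (1 + (norm ?g)\<^sup>2) * br" by (simp add: mult.assoc)
    have "W.Cb * W.m \<le> KK * W.m"
      using W.m_pos by (intro mult_right_mono) (auto simp: KK_def W.Cb_def W.E1_def E1_def)
    then have 2: "W.Cb * W.m \<le> KK * ((1 - exp (- ?r * h)) / ?r)" by (simp only: m)
    show "let P = ?P in integrable M P \<and> \<bar>(\<integral>\<omega>. P \<omega> \<partial>M) - u \<epsilon> t0 x0\<bar>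
        \<le> KK * (1 + (norm ?g)\<^sup>2) * (1 / ?r - h * (exp (- ?r * h) / (1 - exp (- ?r * h))))
          + KK * ((1 - exp (- ?r * h)) / ?r)"
      unfolding Let_def using err 1 2 unfolding br_def by linarith
  qed
qed

end
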